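(* Let $\overline{\mathbf{C}}=(\mathbf{C},\perp)$ be an orthogonal category. For all $t\in\mathbf{C}_0$, $n\ge 0$, $\underline{c}\in\mathbf{C}_0^n$, equip the set $\mathcal{O}_{\mathbf{C}}\binom{t}{\underline{c}}$ with the following equivalence relation: $(\sigma,\underline{f})\sim_\perp(\sigma',\underline{f}')$ if and only if (1) $\underline{f}=\underline{f}'$ as elements of $\prod_{i=1}^n\mathbf{C}(c_i,t)$, and (2) the right permutation $\sigma\sigma'^{-1}:\underline{f}\sigma^{-1}\to\underline{f}\sigma'^{-1}$ is generated by transpositions of adjacent orthogonal pairs, i.e. $\sigma\sigma'^{-1}=\tau_1\cdots\tau_N$ with $N\ge 0$ and transpositions $\tau_1,\dots,\tau_N\in\Sigma_n$ such that, for all $k=1,\dots,N$, the right permutation $\tau_k:\underline{f}\sigma^{-1}\tau_1\cdots\tau_{k-1}\to\underline{f}\sigma^{-1}\tau_1\cdots\tau_k$ is a transposition of a pair of $\mathbf{C}$-morphisms that are orthogonal and adjacent in the sequence $\underline{f}\sigma^{-1}\tau_1\cdots\tau_{k-1}$. Then the colored operad structure on $\mathcal{O}_{\mathbf{C}}$ descends to the quotient sets $\mathcal{O}_{\mathbf{C}}\binom{t}{\underline{c}}/{\sim_\perp}$, and the resulting $\mathbf{C}_0$-colored operad $\mathcal{O}_{\mathbf{C}}/{\sim_\perp}$, together with the quotient map $\pi:\mathcal{O}_{\mathbf{C}}\to\mathcal{O}_{\mathbf{C}}/{\sim_\perp}$, is a coequalizer in $\mathbf{Op}_{\mathbf{C}_0}$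 of the pair $s_{\perp,1},s_{\perp,2}:\mathsf{Free}(R_\perp)\rightrightarrows\mathcal{O}_{\mathbf{C}}$; that is, it is a model for $\mathcal{O}_{\overline{\mathbf{C}}}$ with canonical morphism $p_{\overline{\mathbf{C}}}=\pi$.
   Context: Colored operads are symmetric and $\mathbf{Set}$-valued: a colored operad $\mathcal{O}$ has a set of colors, sets of operations $\mathcal{O}\binom{t}{\underline{c}}$ for each color $t$ and each tuple of colors $\underline{c}=(c_1,\dots,c_n)$, $n\ge 0$, maps $\mathcal{O}(\sigma):\mathcal{O}\binom{t}{\underline{c}}\to\mathcal{O}\binom{t}{\underline{c}\sigma}$ for $\sigma\in\Sigma_n$ with $\underline{c}\sigma=(c_{\sigma(1)},\dots,c_{\sigma(n)})$, compositions $\gamma$ and units, subject to the usual axioms. $\mathbf{Op}_{\mathfrak{C}}$ is the category of operads with color set $\mathfrak{C}$ and morphisms that are the identity on colors. $\mathbf{Seq}_{\mathfrak{C}}$ is the category of $\mathfrak{C}$-colored sequences (only the sets $X\binom{t}{\underline{c}}$, no further structure), and $\mathsf{Free}:\mathbf{Seq}_{\mathfrak{C}}\to\mathbf{Op}_{\mathfrak{C}}$ is the left adjoint of the forgetful functor. Orthogonal category: a pair $\overline{\mathbf{C}}=(\mathbf{C},\perp)$ of a small category $\mathbf{C}$ and a set $\perp$ of pairs $(f_1,f_2)$ of $\mathbf{C}$-morphisms with common target (written $f_1\perp f_2$) that is symmetric and stable under post-composition ($f_1\perp f_2\Rightarrow gf_1\perp gf_2$) and pre-composition ($f_1\perp f_2\Rightarrow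 f_1h_1\perp f_2h_2$). The operad $\mathcal{O}_{\mathbf{C}}$: the colors are the objects $\mathbf{C}_0$ of $\mathbf{C}$; $\mathcal{O}_{\mathbf{C}}\binom{t}{\underline{c}}=\Sigma_n\times\prod_{i=1}^n\mathbf{C}(c_i,t)$ with elements $(\sigma,\underline{f})$; permutations act by $(\sigma,\underline{f})\mapsto(\sigma\sigma',\underline{f}\sigma')$ with $\underline{f}\sigma'=(f_{\sigma'(1)},\dots,f_{\sigma'(n)})$; composition is $\gamma\big((\sigma,\underline{f}),((\sigma_1,\underline{g}_1),\dots,(\sigma_m,\underline{g}_m))\big)=\big(\sigma(\sigma_1,\dots,\sigma_m),(f_1g_{11},\dots,f_1g_{1k_1},\dots,f_mg_{m1},\dots,f_mg_{mk_m})\big)$, where $\sigma(\sigma_1,\dots,\sigma_m)\in\Sigma_{k_1+\cdots+k_m}$ is the composition of the associative operad, i.e. the sum permutation $\sigma_1\oplus\cdots\oplus\sigma_m$ followed by the block permutation moving the $i$-th block (of length $k_i$) to the $\sigma(i)$-th block position; the units are $(e,\mathrm{id}_t)$. The $\mathbf{C}_0$-colored sequence $R_\perp$ has $R_\perp\binom{t}{(c_1,c_2)}=\{(f_1,f_2)\in\mathbf{C}(c_1,t)\times\mathbf{C}(c_2,t): f_1\perp f_2\}$ and is empty for tuples of length $\ne 2$. The maps $s_{\perp,1}(f_1,f_2)=(e,(f_1,f_2))$ and $s_{\perp,2}(f_1,f_2)=(\tau,(f_1,f_2))$, with $e,\tau\in\Sigma_2$ the identity and the transposition, induce operad morphisms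 $s_{\perp,1},s_{\perp,2}:\mathsf{Free}(R_\perp)\rightrightarrows\mathcal{O}_{\mathbf{C}}$. $\mathcal{O}_{\overline{\mathbf{C}}}$ is by definition their coequalizer in $\mathbf{Op}_{\mathbf{C}_0}$ and $p_{\overline{\mathbf{C}}}:\mathcal{O}_{\mathbf{C}}\to\mathcal{O}_{\overline{\mathbf{C}}}$ is the canonical morphism. *)

theory Defs
  imports "HOL-Combinatorics.Permutations"
begin

section \<open>Sum and block permutations\<close>

text \<open>
  Positions are counted from 0, and \<open>\<Sigma>\<^sub>n\<close> is the set of \<open>\<sigma>\<close> with \<open>\<sigma> permutes {..<n}\<close>.
  The library function \<open>permute_list \<sigma> c = (c ! \<sigma> 0, \<dots>, c ! \<sigma> (n - 1))\<close> is the right action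
  \<open>c\<sigma>\<close>.
\<close>

text \<open>\<open>block_pos ks p = (i, j)\<close>: position \<open>p\<close> in a concatenation of blocks of lengths \<open>ks\<close> is
  the position \<open>j\<close> of the \<open>i\<close>-th block.\<close>

fun block_pos :: "nat list \<Rightarrow> nat \<Rightarrow> nat \<times> nat" where
  "block_pos [] p = (0, p)"
| "block_pos (k # ks) p =
     (if p < k then (0, p) else (case block_pos ks (p - k) of (i, j) \<Rightarrow> (Suc i, j)))"

definition sum_perm :: "nat list \<Rightarrow> (nat \<Rightarrow> nat) list \<Rightarrow> nat \<Rightarrow> nat" where
  "sum_perm ks \<sigma>s p =
     (if p < sum_list ks
      then (case block_pos ks p of (i, j) \<Rightarrow> sum_list (take i ks) + (\<sigma>s ! i) j)
      else p)"

text \<open>The \<open>i\<close>-th block, of length \<open>ks ! i\<close>, moves to the \<open>\<sigma> i\<close>-th block position; in front of it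
  come the blocks \<open>a\<close> with \<open>\<sigma> a < \<sigma> i\<close>.\<close>

definition block_perm :: "(nat \<Rightarrow> nat) \<Rightarrow> nat list \<Rightarrow> nat \<Rightarrow> nat" where
  "block_perm \<sigma> ks p =
     (if p < sum_list ks
      then (case block_pos ks p of (i, j) \<Rightarrow> (\<Sum>a\<in>{a. a < length ks \<and> \<sigma> a < \<sigma> i}. ks ! a) + j)
      else p)"

definition assoc_comp :: "(nat \<Rightarrow> nat) \<Rightarrow> nat list \<Rightarrow> (nat \<Rightarrow> nat) list \<Rightarrow> nat \<Rightarrow> nat" where
  "assoc_comp \<sigma> ks \<sigma>s = block_perm \<sigma> ks \<circ> sum_perm ks \<sigma>s"


section \<open>Colored operads\<close>

text \<open>
  \<open>opset P t c\<close> is the set of operations with output color \<open>t\<close> and input colors \<open>c\<close>. These sets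
  need not be disjoint, so the structure maps carry the colors as arguments:
  \<open>opact P t c \<sigma>\<close> acts on \<open>opset P t c\<close>, and \<open>opcomp P t c bs\<close> composes an operation in
  \<open>opset P t c\<close> with operations in \<open>opset P (c ! i) (bs ! i)\<close>. Only the values on colors in the
  color set and on elements of the indicated sets are meaningful.
\<close>

type_synonym ('o, 'x) colseq = "'o \<Rightarrow> 'o list \<Rightarrow> 'x set"

record ('o, 'p) operad =
  opset :: "('o, 'p) colseq"
  opact :: "'o \<Rightarrow> 'o list \<Rightarrow> (nat \<Rightarrow> nat) \<Rightarrow> 'p \<Rightarrow> 'p"
  opcomp :: "'o \<Rightarrow> 'o list \<Rightarrow> 'o list list \<Rightarrow> 'p \<Rightarrow> 'p list \<Rightarrow> 'p"
  opunit :: "'o \<Rightarrow> 'p"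

definition inputs :: "('o, 'x) colseq \<Rightarrow> 'o list \<Rightarrow> 'o list list \<Rightarrow> 'x list \<Rightarrow> bool" where
  "inputs X c bs ys \<longleftrightarrow> length bs = length c \<and> length ys = length c \<and>
     (\<forall>i<length c. ys ! i \<in> X (c ! i) (bs ! i))"

locale colored_operad =
  fixes Col :: "'o set" and P :: "('o, 'p) operad"
  assumes act_closed:
      "\<lbrakk>t \<in> Col; c \<in> lists Col; x \<in> opset P t c; \<sigma> permutes {..<length c}\<rbrakk>
       \<Longrightarrow> opact P t c \<sigma> x \<in> opset P t (permute_list \<sigma> c)"
    and unit_closed: "t \<in> Col \<Longrightarrow> opunit P t \<in> opset P t [t]"
    and comp_closed:
      "\<lbrakk>t \<in> Col; c \<in> lists Col; bs \<in> lists (lists Col); x \<in> opset P t c;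
        inputs (opset P) c bs ys\<rbrakk>
       \<Longrightarrow> opcomp P t c bs x ys \<in> opset P t (concat bs)"
    and act_id:
      "\<lbrakk>t \<in> Col; c \<in> lists Col; x \<in> opset P t c\<rbrakk> \<Longrightarrow> opact P t c id x = x"
    and act_act:
      "\<lbrakk>t \<in> Col; c \<in> lists Col; x \<in> opset P t c;
        \<sigma> permutes {..<length c}; \<sigma>' permutes {..<length c}\<rbrakk>
       \<Longrightarrow> opact P t (permute_list \<sigma> c) \<sigma>' (opact P t c \<sigma> x) = opact P t c (\<sigma> \<circ> \<sigma>') x"
    and unit_left:
      "\<lbrakk>t \<in> Col; c \<in> lists Col; x \<in> opset P t c\<rbrakk>
       \<Longrightarrow> opcomp P t [t] [c] (opunit P t) [x] = x"
    and unit_right: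
      "\<lbrakk>t \<in> Col; c \<in> lists Col; x \<in> opset P t c\<rbrakk>
       \<Longrightarrow> opcomp P t c (map (\<lambda>a. [a]) c) x (map (opunit P) c) = x"
    and comp_assoc:
      "\<lbrakk>t \<in> Col; c \<in> lists Col; bs \<in> lists (lists Col); as \<in> lists (lists (lists Col));
        x \<in> opset P t c; inputs (opset P) c bs ys;
        length as = length c; length zs = length c;
        \<And>i. i < length c \<Longrightarrow> inputs (opset P) (bs ! i) (as ! i) (zs ! i)\<rbrakk>
       \<Longrightarrow> opcomp P t (concat bs) (concat as) (opcomp P t c bs x ys) (concat zs) =
           opcomp P t c (map concat as) x
             (map (\<lambda>i. opcomp P (c ! i) (bs ! i) (as ! i) (ys ! i) (zs ! i)) [0..<length c])"
    and comp_act_outer: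
      "\<lbrakk>t \<in> Col; c \<in> lists Col; bs \<in> lists (lists Col); x \<in> opset P t c;
        inputs (opset P) c bs ys; \<sigma> permutes {..<length c}\<rbrakk>
       \<Longrightarrow> opcomp P t (permute_list \<sigma> c) (permute_list \<sigma> bs) (opact P t c \<sigma> x)
             (permute_list \<sigma> ys) =
           opact P t (concat bs) (block_perm \<sigma> (map length (permute_list \<sigma> bs)))
             (opcomp P t c bs x ys)"
    and comp_act_inner:
      "\<lbrakk>t \<in> Col; c \<in> lists Col; bs \<in> lists (lists Col); x \<in> opset P t c;
        inputs (opset P) c bs ys; length \<sigma>s = length c;
        \<And>i. i < length c \<Longrightarrow> \<sigma>s ! i permutes {..<length (bs ! i)}\<rbrakk>
       \<Longrightarrow> opcomp P t c (map2 permute_list \<sigma>s bs) x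
             (map (\<lambda>i. opact P (c ! i) (bs ! i) (\<sigma>s ! i) (ys ! i)) [0..<length c]) =
           opact P t (concat bs) (sum_perm (map length bs) \<sigma>s) (opcomp P t c bs x ys)"

definition seq_hom ::
  "'o set \<Rightarrow> ('o, 'x) colseq \<Rightarrow> ('o, 'y) colseq \<Rightarrow> ('o \<Rightarrow> 'o list \<Rightarrow> 'x \<Rightarrow> 'y) \<Rightarrow> bool" where
  "seq_hom Col X Y h \<longleftrightarrow> (\<forall>t\<in>Col. \<forall>c\<in>lists Col. \<forall>x\<in>X t c. h t c x \<in> Y t c)"

text \<open>Equality of morphisms is equality on the elements of the domain only.\<close>

definition seq_hom_eq ::
  "'o set \<Rightarrow> ('o, 'x) colseq \<Rightarrow> ('o \<Rightarrow> 'o list \<Rightarrow> 'x \<Rightarrow> 'y) \<Rightarrow> ('o \<Rightarrow> 'o list \<Rightarrow> 'x \<Rightarrow> 'y) \<Rightarrow> bool" where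
  "seq_hom_eq Col X h h' \<longleftrightarrow> (\<forall>t\<in>Col. \<forall>c\<in>lists Col. \<forall>x\<in>X t c. h t c x = h' t c x)"

locale operad_hom = dom: colored_operad Col P + cod: colored_operad Col Q
  for Col :: "'o set" and P :: "('o, 'p) operad" and Q :: "('o, 'q) operad" +
  fixes h :: "'o \<Rightarrow> 'o list \<Rightarrow> 'p \<Rightarrow> 'q"
  assumes hom_closed: "seq_hom Col (opset P) (opset Q) h"
    and hom_act:
      "\<lbrakk>t \<in> Col; c \<in> lists Col; x \<in> opset P t c; \<sigma> permutes {..<length c}\<rbrakk>
       \<Longrightarrow> h t (permute_list \<sigma> c) (opact P t c \<sigma> x) = opact Q t c \<sigma> (h t c x)"
    and hom_unit: "t \<in> Col \<Longrightarrow> h t [t] (opunit P t) = opunit Q t"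
    and hom_comp:
      "\<lbrakk>t \<in> Col; c \<in> lists Col; bs \<in> lists (lists Col); x \<in> opset P t c;
        inputs (opset P) c bs ys\<rbrakk>
       \<Longrightarrow> h t (concat bs) (opcomp P t c bs x ys) =
           opcomp Q t c bs (h t c x) (map (\<lambda>i. h (c ! i) (bs ! i) (ys ! i)) [0..<length c])"

text \<open>
  A coequalizer in the category of operads with color set \<open>Col\<close>. HOL cannot quantify over types
  inside a formula, so the type \<open>'z\<close> of the operations of the test operads is a parameter; a
  theorem with \<open>'z\<close> a free type variable covers test operads of every type.
\<close>

definition is_coequalizer ::
  "'z itself \<Rightarrow> 'o set \<Rightarrow> ('o, 'f) operad \<Rightarrow> ('o, 'p) operad \<Rightarrow>
   ('o \<Rightarrow> 'o list \<Rightarrow> 'f \<Rightarrow> 'p) \<Rightarrow> ('o \<Rightarrow> 'o list \<Rightarrow> 'f \<Rightarrow> 'p) \<Rightarrow>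
   ('o, 'q) operad \<Rightarrow> ('o \<Rightarrow> 'o list \<Rightarrow> 'p \<Rightarrow> 'q) \<Rightarrow> bool" where
  "is_coequalizer (_ :: 'z itself) Col F P r s Q q \<longleftrightarrow>
     operad_hom Col F P r \<and> operad_hom Col F P s \<and> operad_hom Col P Q q \<and>
     seq_hom_eq Col (opset F) (\<lambda>t c x. q t c (r t c x)) (\<lambda>t c x. q t c (s t c x)) \<and>
     (\<forall>(Z :: ('o, 'z) operad) h.
        operad_hom Col P Z h \<and>
        seq_hom_eq Col (opset F) (\<lambda>t c x. h t c (r t c x)) (\<lambda>t c x. h t c (s t c x)) \<longrightarrow>
        (\<exists>u. operad_hom Col Q Z u \<and>
           seq_hom_eq Col (opset P) (\<lambda>t c x. u t c (q t c x)) h \<and>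
           (\<forall>u'. operad_hom Col Q Z u' \<and>
              seq_hom_eq Col (opset P) (\<lambda>t c x. u' t c (q t c x)) h \<longrightarrow>
              seq_hom_eq Col (opset Q) u' u)))"


section \<open>Quotients of operads\<close>

text \<open>
  This is the condition under which the structure maps of \<open>P\<close> descend to the quotient sets
  \<open>opset P t c // E t c\<close>.
\<close>

definition operad_congruence ::
  "'o set \<Rightarrow> ('o, 'p) operad \<Rightarrow> ('o \<Rightarrow> 'o list \<Rightarrow> ('p \<times> 'p) set) \<Rightarrow> bool" where
  "operad_congruence Col P E \<longleftrightarrow>
     (\<forall>t\<in>Col. \<forall>c\<in>lists Col. equiv (opset P t c) (E t c)) \<and>
     (\<forall>t\<in>Col. \<forall>c\<in>lists Col. \<forall>\<sigma> x x'. \<sigma> permutes {..<length c} \<and> (x, x') \<in> E t c \<longrightarrow>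
        (opact P t c \<sigma> x, opact P t c \<sigma> x') \<in> E t (permute_list \<sigma> c)) \<and>
     (\<forall>t\<in>Col. \<forall>c\<in>lists Col. \<forall>bs\<in>lists (lists Col). \<forall>x x' ys ys'.
        (x, x') \<in> E t c \<and> inputs (opset P) c bs ys \<and> inputs (opset P) c bs ys' \<and>
        (\<forall>i<length c. (ys ! i, ys' ! i) \<in> E (c ! i) (bs ! i)) \<longrightarrow>
        (opcomp P t c bs x ys, opcomp P t c bs x' ys') \<in> E t (concat bs))"

text \<open>When \<open>E\<close> is a congruence, the sets united below are all the same class.\<close>

definition quot_operad ::
  "('o, 'p) operad \<Rightarrow> ('o \<Rightarrow> 'o list \<Rightarrow> ('p \<times> 'p) set) \<Rightarrow> ('o, 'p set) operad" where
  "quot_operad P E = \<lparr>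
     opset = (\<lambda>t c. opset P t c // E t c),
     opact = (\<lambda>t c \<sigma> A. \<Union>x\<in>A. E t (permute_list \<sigma> c) `` {opact P t c \<sigma> x}),
     opcomp = (\<lambda>t c bs A Bs. \<Union>x\<in>A. \<Union>ys\<in>listset Bs. E t (concat bs) `` {opcomp P t c bs x ys}),
     opunit = (\<lambda>t. E t [t] `` {opunit P t}) \<rparr>"

definition quot_map ::
  "('o \<Rightarrow> 'o list \<Rightarrow> ('p \<times> 'p) set) \<Rightarrow> 'o \<Rightarrow> 'o list \<Rightarrow> 'p \<Rightarrow> 'p set" where
  "quot_map E t c x = E t c `` {x}"


section \<open>Free operads\<close>

text \<open>
  The free operad on a colored sequence consists of the formal operadic expressions in the
  elements of the sequence, modulo the smallest congruence that enforces the operad axioms.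
\<close>

datatype ('o, 'x) opterm =
    Gen 'o "'o list" 'x
  | UnitT 'o
  | ActT "nat \<Rightarrow> nat" "('o, 'x) opterm"
  | CompT "('o, 'x) opterm" "('o, 'x) opterm list"

fun out_color :: "('o, 'x) opterm \<Rightarrow> 'o" where
  "out_color (Gen t c x) = t"
| "out_color (UnitT t) = t"
| "out_color (ActT \<sigma> u) = out_color u"
| "out_color (CompT u vs) = out_color u"

fun in_colors :: "('o, 'x) opterm \<Rightarrow> 'o list" where
  "in_colors (Gen t c x) = c"
| "in_colors (UnitT t) = [t]"
| "in_colors (ActT \<sigma> u) = permute_list \<sigma> (in_colors u)"
| "in_colors (CompT u vs) = concat (map in_colors vs)"

fun wf_term :: "'o set \<Rightarrow> ('o, 'x) colseq \<Rightarrow> ('o, 'x) opterm \<Rightarrow> bool" where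
  "wf_term Col X (Gen t c x) \<longleftrightarrow> t \<in> Col \<and> c \<in> lists Col \<and> x \<in> X t c"
| "wf_term Col X (UnitT t) \<longleftrightarrow> t \<in> Col"
| "wf_term Col X (ActT \<sigma> u) \<longleftrightarrow> wf_term Col X u \<and> \<sigma> permutes {..<length (in_colors u)}"
| "wf_term Col X (CompT u vs) \<longleftrightarrow> wf_term Col X u \<and> (\<forall>v\<in>set vs. wf_term Col X v) \<and>
     map out_color vs = in_colors u"

inductive term_eq :: "'o set \<Rightarrow> ('o, 'x) colseq \<Rightarrow> ('o, 'x) opterm \<Rightarrow> ('o, 'x) opterm \<Rightarrow> bool"
  for Col X where
  refl: "wf_term Col X u \<Longrightarrow> term_eq Col X u u"
| sym: "term_eq Col X u v \<Longrightarrow> term_eq Col X v u"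
| trans: "term_eq Col X u v \<Longrightarrow> term_eq Col X v w \<Longrightarrow> term_eq Col X u w"
| cong_act: "term_eq Col X u v \<Longrightarrow> \<sigma> permutes {..<length (in_colors u)} \<Longrightarrow>
    term_eq Col X (ActT \<sigma> u) (ActT \<sigma> v)"
| cong_comp: "term_eq Col X u u' \<Longrightarrow> list_all2 (term_eq Col X) vs vs' \<Longrightarrow>
    map out_color vs = in_colors u \<Longrightarrow> term_eq Col X (CompT u vs) (CompT u' vs')"
| act_id: "wf_term Col X u \<Longrightarrow> term_eq Col X (ActT id u) u"
| act_act: "wf_term Col X u \<Longrightarrow>
    \<sigma> permutes {..<length (in_colors u)} \<Longrightarrow> \<sigma>' permutes {..<length (in_colors u)} \<Longrightarrow>
    term_eq Col X (ActT \<sigma>' (ActT \<sigma> u)) (ActT (\<sigma> \<circ> \<sigma>') u)"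
| unit_left: "wf_term Col X u \<Longrightarrow> term_eq Col X (CompT (UnitT (out_color u)) [u]) u"
| unit_right: "wf_term Col X u \<Longrightarrow> term_eq Col X (CompT u (map UnitT (in_colors u))) u"
| comp_assoc: "wf_term Col X (CompT u vs) \<Longrightarrow> length ws = length vs \<Longrightarrow>
    (\<And>i. i < length vs \<Longrightarrow> wf_term Col X (CompT (vs ! i) (ws ! i))) \<Longrightarrow>
    term_eq Col X (CompT (CompT u vs) (concat ws)) (CompT u (map2 CompT vs ws))"
| comp_act_outer: "wf_term Col X (CompT u vs) \<Longrightarrow> \<sigma> permutes {..<length (in_colors u)} \<Longrightarrow>
    term_eq Col X (CompT (ActT \<sigma> u) (permute_list \<sigma> vs))
      (ActT (block_perm \<sigma> (map (\<lambda>v. length (in_colors v)) (permute_list \<sigma> vs))) (CompT u vs))"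
| comp_act_inner: "wf_term Col X (CompT u vs) \<Longrightarrow> length \<sigma>s = length vs \<Longrightarrow>
    (\<And>i. i < length vs \<Longrightarrow> \<sigma>s ! i permutes {..<length (in_colors (vs ! i))}) \<Longrightarrow>
    term_eq Col X (CompT u (map2 ActT \<sigma>s vs))
      (ActT (sum_perm (map (\<lambda>v. length (in_colors v)) vs) \<sigma>s) (CompT u vs))"

definition term_operad :: "'o set \<Rightarrow> ('o, 'x) colseq \<Rightarrow> ('o, ('o, 'x) opterm) operad" where
  "term_operad Col X = \<lparr>
     opset = (\<lambda>t c. {u. wf_term Col X u \<and> out_color u = t \<and> in_colors u = c}),
     opact = (\<lambda>t c. ActT),
     opcomp = (\<lambda>t c bs. CompT),
     opunit = UnitT \<rparr>"

definition term_rel ::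
  "'o set \<Rightarrow> ('o, 'x) colseq \<Rightarrow> 'o \<Rightarrow> 'o list \<Rightarrow> (('o, 'x) opterm \<times> ('o, 'x) opterm) set" where
  "term_rel Col X t c = {(u, v). term_eq Col X u v \<and> out_color u = t \<and> in_colors u = c}"

definition free_operad :: "'o set \<Rightarrow> ('o, 'x) colseq \<Rightarrow> ('o, ('o, 'x) opterm set) operad" where
  "free_operad Col X = quot_operad (term_operad Col X) (term_rel Col X)"

definition free_unit ::
  "'o set \<Rightarrow> ('o, 'x) colseq \<Rightarrow> 'o \<Rightarrow> 'o list \<Rightarrow> 'x \<Rightarrow> ('o, 'x) opterm set" where
  "free_unit Col X t c x = quot_map (term_rel Col X) t c (Gen t c x)"

fun eval_term ::
  "('o, 'q) operad \<Rightarrow> ('o \<Rightarrow> 'o list \<Rightarrow> 'x \<Rightarrow> 'q) \<Rightarrow> ('o, 'x) opterm \<Rightarrow> 'q" where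
  "eval_term Q h (Gen t c x) = h t c x"
| "eval_term Q h (UnitT t) = opunit Q t"
| "eval_term Q h (ActT \<sigma> u) = opact Q (out_color u) (in_colors u) \<sigma> (eval_term Q h u)"
| "eval_term Q h (CompT u vs) =
     opcomp Q (out_color u) (in_colors u) (map in_colors vs) (eval_term Q h u)
       (map (eval_term Q h) vs)"

text \<open>The morphism \<open>Free X \<rightarrow> Q\<close> induced by a map of sequences \<open>h\<close> from \<open>X\<close> to \<open>Q\<close>.\<close>

definition free_lift ::
  "('o, 'q) operad \<Rightarrow> ('o \<Rightarrow> 'o list \<Rightarrow> 'x \<Rightarrow> 'q) \<Rightarrow>
   'o \<Rightarrow> 'o list \<Rightarrow> ('o, 'x) opterm set \<Rightarrow> 'q" where
  "free_lift Q h t c A = the_elem (eval_term Q h ` A)"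

section \<open>Permuted concatenations\<close>

lemma block_pos_bound:
  "p < sum_list ks \<Longrightarrow> block_pos ks p = (i, j) \<Longrightarrow>
   i < length ks \<and> j < ks ! i \<and> p = sum_list (take i ks) + j"
proof (induction ks arbitrary: p i)
  case (Cons k ks)
  show ?case
  proof (cases "p < k")
    case False
    obtain i' j' where ij: "block_pos ks (p - k) = (i', j')" by (rule prod.exhaust)
    then have "i = Suc i'" "j' = j" using Cons.prems False by auto
    moreover have "p - k < sum_list ks" using Cons.prems False by simp
    ultimately show ?thesis using Cons.IH[of "p - k" i'] ij False by auto
  qed (use Cons.prems in auto)
qed simp

lemma block_pos_start:
  "i < length ks \<Longrightarrow> j < ks ! i \<Longrightarrow>
   block_pos ks (sum_list (take i ks) + j) = (i, j) \<and> sum_list (take i ks) + j < sum_list ks"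
proof (induction ks arbitrary: i)
  case (Cons k ks)
  show ?case
  proof (cases i)
    case (Suc i')
    then show ?thesis using Cons.IH[of i'] Cons.prems by (simp add: add.assoc)
  qed (use Cons.prems in simp)
qed simp

lemma concat_nth_start:
  "i < length css \<Longrightarrow> j < length (css ! i) \<Longrightarrow>
   concat css ! (sum_list (take i (map length css)) + j) = css ! i ! j"
proof (induction css arbitrary: i)
  case (Cons c css)
  show ?case
  proof (cases i)
    case (Suc i')
    then show ?thesis using Cons.IH[of i'] Cons.prems by (simp add: nth_append add.assoc)
  qed (use Cons.prems in \<open>simp add: nth_append\<close>)
qed simp

lemma block_cases:
  fixes ks :: "nat list"
  assumes "p < sum_list ks"
  obtains i j where "i < length ks" "j < ks ! i" "p = sum_list (take i ks) + j"
proof -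
  obtain i j where "block_pos ks p = (i, j)" by (rule prod.exhaust)
  then show ?thesis using block_pos_bound[OF assms] that by blast
qed

lemma block_eq:
  fixes ks :: "nat list"
  assumes "i < length ks" "j < ks ! i" "i' < length ks" "j' < ks ! i'"
    and "sum_list (take i ks) + j = sum_list (take i' ks) + j'"
  shows "i = i' \<and> j = j'"
proof -
  have "(i, j) = (i', j')"
    using block_pos_start[OF assms(1,2)] block_pos_start[OF assms(3,4)]
    unfolding assms(5) by argo
  then show ?thesis by simp
qed

lemma sum_perm_start:
  assumes "i < length ks" "j < ks ! i"
  shows "sum_perm ks \<sigma>s (sum_list (take i ks) + j) = sum_list (take i ks) + (\<sigma>s ! i) j"
  using block_pos_start[OF assms] by (simp add: sum_perm_def)

lemma endo_permutes:
  assumes "\<And>p. p < n \<Longrightarrow> f p < n" "inj_on f {..<n}" "\<And>p. \<not> p < n \<Longrightarrow> f p = (p::nat)"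
  shows "f permutes {..<n}"
proof (rule bij_imp_permutes)
  show "bij_betw f {..<n} {..<n}"
    unfolding bij_betw_def using assms(2) by (intro conjI endo_inj_surj) (use assms(1) in auto)
qed (use assms(3) in auto)

lemma sum_perm_permutes:
  assumes "length \<sigma>s = length ks" "\<And>i. i < length ks \<Longrightarrow> \<sigma>s ! i permutes {..<ks ! i}"
  shows "sum_perm ks \<sigma>s permutes {..<sum_list ks}"
proof (rule endo_permutes)
  have lt: "(\<sigma>s ! i) j < ks ! i" if "i < length ks" "j < ks ! i" for i j
    using permutes_in_image[OF assms(2)[OF that(1)]] that(2) by auto
  show "sum_perm ks \<sigma>s p < sum_list ks" if p: "p < sum_list ks" for p
  proof -
    obtain i j where "i < length ks" "j < ks ! i" "p = sum_list (take i ks) + j"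
      using block_cases[OF p] by blast
    then show ?thesis using block_pos_start[OF _ lt, of i j] by (simp add: sum_perm_start)
  qed
  show "inj_on (sum_perm ks \<sigma>s) {..<sum_list ks}"
  proof (rule inj_onI, unfold lessThan_iff)
    fix p q assume p: "p < sum_list ks" and q: "q < sum_list ks"
      and eq: "sum_perm ks \<sigma>s p = sum_perm ks \<sigma>s q"
    obtain i j where ij: "i < length ks" "j < ks ! i" "p = sum_list (take i ks) + j"
      using block_cases[OF p] by blast
    obtain i' j' where ij': "i' < length ks" "j' < ks ! i'" "q = sum_list (take i' ks) + j'"
      using block_cases[OF q] by blast
    have "i = i' \<and> (\<sigma>s ! i) j = (\<sigma>s ! i') j'"
      using eq ij ij' lt by (intro block_eq[of _ ks]) (auto simp: sum_perm_start)
    moreover have "inj (\<sigma>s ! i)" using permutes_inj[OF assms(2)[OF ij(1)]] .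
    ultimately show "p = q" using ij ij' by (auto dest: injD)
  qed
qed (simp add: sum_perm_def)

lemma block_perm_start:
  fixes ks :: "nat list"
  assumes \<sigma>: "\<sigma> permutes {..<length ks}" and ij: "i < length ks" "j < ks ! i"
  shows "block_perm \<sigma> ks (sum_list (take i ks) + j) =
    sum_list (take (\<sigma> i) (permute_list (inv \<sigma>) ks)) + j"
proof -
  let ?ls = "permute_list (inv \<sigma>) ks"
  have si: "\<sigma> i < length ks" using permutes_in_image[OF \<sigma>] ij(1) by auto
  have "(\<Sum>a\<in>{a. a < length ks \<and> \<sigma> a < \<sigma> i}. ks ! a) = (\<Sum>q\<in>{..<\<sigma> i}. ?ls ! q)"
  proof (rule sum.reindex_cong[where l = "inv \<sigma>"])
    show "inj_on (inv \<sigma>) {..<\<sigma> i}"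
      using permutes_inj[OF permutes_inv[OF \<sigma>]] inj_on_subset by blast
    show "{a. a < length ks \<and> \<sigma> a < \<sigma> i} = inv \<sigma> ` {..<\<sigma> i}" (is "?A = ?B")
    proof (intro set_eqI iffI)
      fix a assume "a \<in> ?A"
      then show "a \<in> ?B"
        by (intro image_eqI[of _ _ "\<sigma> a"]) (simp_all add: permutes_inverses(2)[OF \<sigma>])
    next
      fix a assume "a \<in> ?B"
      then obtain q where q: "q < \<sigma> i" "a = inv \<sigma> q" by blast
      then have "inv \<sigma> q < length ks"
        using permutes_in_image[OF permutes_inv[OF \<sigma>], of q] si by simp
      with q show "a \<in> ?A" by (simp add: permutes_inverses(1)[OF \<sigma>])
    qed
  qed (use si in \<open>simp add: permute_list_def\<close>)
  also have "\<dots> = sum_list (take (\<sigma> i) ?ls)"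
    using si by (simp add: sum_list_sum_nth atLeast0LessThan min_def)
  finally show ?thesis using block_pos_start[OF ij] by (simp add: block_perm_def)
qed

lemma block_perm_permutes:
  fixes ks :: "nat list"
  assumes \<sigma>: "\<sigma> permutes {..<length ks}"
  shows "block_perm \<sigma> ks permutes {..<sum_list ks}"
proof (rule endo_permutes)
  let ?ls = "permute_list (inv \<sigma>) ks"
  have inv: "inv \<sigma> permutes {..<length ks}" by (rule permutes_inv[OF \<sigma>])
  have sum: "sum_list ?ls = sum_list ks"
    using arg_cong[OF mset_permute_list[OF inv], of sum_mset] by (simp only: sum_mset_sum_list)
  have si: "\<sigma> i < length ?ls" "?ls ! \<sigma> i = ks ! i" if "i < length ks" for i
    using that permutes_in_image[OF \<sigma>, of i]
    by (auto simp: permute_list_nth[OF inv] permutes_inverses[OF \<sigma>])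
  show "block_perm \<sigma> ks p < sum_list ks" if p: "p < sum_list ks" for p
  proof -
    obtain i j where ij: "i < length ks" "j < ks ! i" "p = sum_list (take i ks) + j"
      using block_cases[OF p] by blast
    then show ?thesis
      using block_perm_start[OF \<sigma> ij(1,2)] block_pos_start[of "\<sigma> i" ?ls j] si[OF ij(1)] sum
      by simp
  qed
  show "inj_on (block_perm \<sigma> ks) {..<sum_list ks}"
  proof (rule inj_onI, unfold lessThan_iff)
    fix p q assume p: "p < sum_list ks" and q: "q < sum_list ks"
      and eq: "block_perm \<sigma> ks p = block_perm \<sigma> ks q"
    obtain i j where ij: "i < length ks" "j < ks ! i" "p = sum_list (take i ks) + j"
      using block_cases[OF p] by blast
    obtain i' j' where ij': "i' < length ks" "j' < ks ! i'" "q = sum_list (take i' ks) + j'"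
      using block_cases[OF q] by blast
    have "\<sigma> i = \<sigma> i' \<and> j = j'"
      using eq ij ij' si[OF ij(1)] si[OF ij'(1)]
      by (intro block_eq[of "\<sigma> i" ?ls]) (auto simp: block_perm_start[OF \<sigma>])
    then show "p = q" using ij ij' permutes_inj[OF \<sigma>] by (auto dest: injD)
  qed
qed (simp add: block_perm_def)

lemma permute_list_sum_perm:
  assumes len: "length \<sigma>s = length bs"
    and \<sigma>s: "\<And>i. i < length bs \<Longrightarrow> \<sigma>s ! i permutes {..<length (bs ! i)}"
  shows "permute_list (sum_perm (map length bs) \<sigma>s) (concat bs) =
    concat (map2 permute_list \<sigma>s bs)"
proof (rule nth_equalityI)
  let ?ks = "map length bs"
  let ?bs = "map2 permute_list \<sigma>s bs"
  have ks: "map length ?bs = ?ks" using len by (auto intro: nth_equalityI)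
  show "length (permute_list (sum_perm ?ks \<sigma>s) (concat bs)) = length (concat ?bs)"
    by (simp add: length_concat ks del: map_map)
  fix p assume "p < length (permute_list (sum_perm ?ks \<sigma>s) (concat bs))"
  then have p: "p < sum_list ?ks" by (simp add: length_concat)
  then obtain i j where ij: "i < length ?ks" "j < ?ks ! i" "p = sum_list (take i ?ks) + j"
    using block_cases by blast
  have i: "i < length bs" and j: "j < length (bs ! i)" using ij by auto
  have sj: "(\<sigma>s ! i) j < length (bs ! i)"
    using permutes_in_image[OF \<sigma>s[OF i], of j] j by auto
  have "permute_list (sum_perm ?ks \<sigma>s) (concat bs) ! p = concat bs ! sum_perm ?ks \<sigma>s p"
    using p by (simp add: permute_list_def length_concat)
  also have "\<dots> = bs ! i ! (\<sigma>s ! i) j"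
    using sum_perm_start[OF ij(1,2), of \<sigma>s] ij(3) concat_nth_start[OF i sj] by simp
  also have "\<dots> = ?bs ! i ! j" using i j len by (simp add: permute_list_nth[OF \<sigma>s[OF i]])
  also have "\<dots> = concat ?bs ! p"
    using concat_nth_start[of i ?bs j] i j len ij(3) unfolding ks by simp
  finally show "permute_list (sum_perm ?ks \<sigma>s) (concat bs) ! p = concat ?bs ! p" .
qed

lemma permute_list_block_perm:
  assumes \<sigma>: "\<sigma> permutes {..<length bs}"
  shows "permute_list (block_perm \<sigma> (map length (permute_list \<sigma> bs))) (concat bs) =
    concat (permute_list \<sigma> bs)"
proof (rule nth_equalityI)
  let ?bs = "permute_list \<sigma> bs"
  let ?ks = "map length ?bs"
  let ?\<beta> = "block_perm \<sigma> ?ks"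
  have \<sigma>': "\<sigma> permutes {..<length ?ks}" using \<sigma> by simp
  have "sum_mset (image_mset length (mset ?bs)) = sum_mset (image_mset length (mset bs))"
    using \<sigma> by simp
  then have sum: "sum_list ?ks = sum_list (map length bs)"
    by (simp only: mset_map[symmetric] sum_mset_sum_list)
  have "permute_list (inv \<sigma>) ?bs = bs"
    using \<sigma> permute_list_compose[of "inv \<sigma>" bs \<sigma>]
    by (simp add: permutes_inv permutes_inv_o(1))
  then have inv: "permute_list (inv \<sigma>) ?ks = map length bs"
    using permute_list_map[of "inv \<sigma>" ?bs length] permutes_inv[OF \<sigma>] by simp
  show len: "length (permute_list ?\<beta> (concat bs)) = length (concat ?bs)"
    using sum by (simp add: length_concat)
  fix p assume "p < length (permute_list ?\<beta> (concat bs))"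
  then have p: "p < sum_list ?ks" "p < length (concat bs)" using len by (simp_all add: length_concat)
  then obtain i j where ij: "i < length ?ks" "j < ?ks ! i" "p = sum_list (take i ?ks) + j"
    using block_cases by blast
  have i: "i < length bs" and si: "\<sigma> i < length bs"
    using ij(1) permutes_in_image[OF \<sigma>, of i] by auto
  have j: "j < length (bs ! \<sigma> i)" using ij(2) i by (simp add: permute_list_nth[OF \<sigma>])
  have "permute_list ?\<beta> (concat bs) ! p = concat bs ! ?\<beta> p"
    using p(2) by (simp add: permute_list_def)
  also have "\<dots> = bs ! \<sigma> i ! j"
    using block_perm_start[OF \<sigma>' ij(1,2)] ij(3) inv concat_nth_start[OF si j] by simp
  also have "\<dots> = concat ?bs ! p"
    using concat_nth_start[of i ?bs j] i j ij(3) by (simp add: permute_list_nth[OF \<sigma>])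
  finally show "permute_list ?\<beta> (concat bs) ! p = concat ?bs ! p" .
qed

section \<open>Freeness of the free operad\<close>

text \<open>
  The theorems \<open>colored_operad_free\<close>, \<open>free_unit_hom\<close>, \<open>free_lift_hom\<close>, \<open>free_lift_unit\<close> and
  \<open>free_lift_unique\<close> below say that \<open>free_unit\<close> is a universal arrow from \<open>X\<close> to the functor
  forgetting the operad structure, so that \<open>free_operad\<close> is its left adjoint.
\<close>

lemma wf_term_colors:
  "wf_term Col X u \<Longrightarrow> out_color u \<in> Col \<and> in_colors u \<in> lists Col"
proof (induction u rule: wf_term.induct)
  case (3 Col X \<sigma> u)
  then show ?case by (auto simp: in_lists_conv_set)
qed (auto simp: in_lists_conv_set)

lemma map_concat_concat: "map f (concat xss) = concat (map (map f) xss)"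
  by (induction xss) auto

lemma concat_map_concat: "concat (concat xsss) = concat (map concat xsss)"
  by (induction xsss) auto

lemma term_eq_wf:
  "term_eq Col X u v \<Longrightarrow>
   wf_term Col X u \<and> wf_term Col X v \<and> out_color u = out_color v \<and> in_colors u = in_colors v"
proof (induction rule: term_eq.induct)
  case (cong_comp u u' vs vs')
  have "map out_color vs = map out_color vs'" "map in_colors vs = map in_colors vs'"
    "\<forall>v\<in>set vs. wf_term Col X v" "\<forall>v\<in>set vs'. wf_term Col X v"
    using cong_comp.IH(2) by (induction rule: list_all2_induct) auto
  then show ?case using cong_comp by (auto simp del: map_eq_conv)
next
  case (act_act u \<sigma> \<sigma>')
  then show ?case by (auto simp: permute_list_compose permutes_compose)
next
  case (unit_right u)
  then show ?case using wf_term_colors[of Col X u] by (auto simp: in_lists_conv_set comp_def)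
next
  case (unit_left u)
  then show ?case using wf_term_colors[of Col X u] by auto
next
  case (comp_assoc u vs ws)
  have out: "map (map out_color) ws = map in_colors vs"
    using comp_assoc by (auto intro!: nth_equalityI)
  have "map in_colors (map2 CompT vs ws) = map concat (map (map in_colors) ws)"
    using comp_assoc(2) by (auto intro!: nth_equalityI)
  then have "in_colors (CompT u (map2 CompT vs ws)) = in_colors (CompT (CompT u vs) (concat ws))"
    by (simp only: in_colors.simps map_concat_concat concat_map_concat)
  moreover have "wf_term Col X (CompT (CompT u vs) (concat ws))"
  proof -
    have "\<forall>w\<in>set (concat ws). wf_term Col X w"
    proof
      fix w assume "w \<in> set (concat ws)"
      then obtain w' where "w' \<in> set ws" and w: "w \<in> set w'" by auto
      then obtain i where "i < length ws" "w' = ws ! i" by (auto simp: in_set_conv_nth)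
      then show "wf_term Col X w" using comp_assoc(2) comp_assoc(3)[of i] w by simp
    qed
    moreover have "map out_color (concat ws) = in_colors (CompT u vs)"
      using out by (simp add: map_concat_concat)
    ultimately show ?thesis using comp_assoc(1) by simp
  qed
  moreover have "wf_term Col X (CompT u (map2 CompT vs ws))"
  proof -
    have "map out_color (map2 CompT vs ws) = map out_color vs"
      using comp_assoc(2) by (auto intro!: nth_equalityI)
    moreover have "\<forall>v\<in>set (map2 CompT vs ws). wf_term Col X v"
      using comp_assoc(3) by (auto simp: set_zip)
    ultimately show ?thesis using comp_assoc(1) by (simp del: map_map)
  qed
  ultimately show ?case by simp
next
  case (comp_act_outer u vs \<sigma>)
  let ?ks = "map (\<lambda>v. length (in_colors v)) (permute_list \<sigma> vs)"
  have len: "length vs = length (in_colors u)"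
    using comp_act_outer(1) by (metis length_map wf_term.simps(4))
  then have \<sigma>: "\<sigma> permutes {..<length vs}" using comp_act_outer(2) by simp
  have p: "permute_list \<sigma> (map f vs) = map f (permute_list \<sigma> vs)"
    for f :: "('a, 'b) opterm \<Rightarrow> 'c" by (rule permute_list_map[OF \<sigma>])
  have "mset (map (\<lambda>v. length (in_colors v)) (permute_list \<sigma> vs)) =
    mset (map (\<lambda>v. length (in_colors v)) vs)" using \<sigma> by simp
  then have sum: "sum_list ?ks = length (concat (map in_colors vs))"
    unfolding length_concat map_map comp_def by (metis sum_mset_sum_list)
  have 1: "map out_color (permute_list \<sigma> vs) = permute_list \<sigma> (in_colors u)"
    using comp_act_outer(1) \<sigma> by (simp add: permute_list_map[symmetric])
  have 2: "block_perm \<sigma> ?ks permutes {..<length (concat (map in_colors vs))}"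
    using block_perm_permutes[of \<sigma> ?ks] \<sigma> unfolding sum by simp
  have 3: "permute_list (block_perm \<sigma> ?ks) (concat (map in_colors vs)) =
      concat (map in_colors (permute_list \<sigma> vs))"
    using permute_list_block_perm[of \<sigma> "map in_colors vs"] \<sigma>
    by (simp add: permute_list_map comp_def)
  show ?case using comp_act_outer \<sigma> 1 2 3 by simp
next
  case (comp_act_inner u vs \<sigma>s)
  let ?ks = "map (\<lambda>v. length (in_colors v)) vs"
  have 1: "map out_color (map2 ActT \<sigma>s vs) = map out_color vs"
    using comp_act_inner(2) by (auto intro!: nth_equalityI)
  have 2: "sum_perm ?ks \<sigma>s permutes {..<length (concat (map in_colors vs))}"
    using sum_perm_permutes[of \<sigma>s ?ks] comp_act_inner(2,3) by (simp add: length_concat comp_def)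
  have "map in_colors (map2 ActT \<sigma>s vs) = map2 permute_list \<sigma>s (map in_colors vs)"
    using comp_act_inner(2) by (auto intro!: nth_equalityI)
  then have 3: "concat (map in_colors (map2 ActT \<sigma>s vs)) =
      permute_list (sum_perm ?ks \<sigma>s) (concat (map in_colors vs))"
    using permute_list_sum_perm[of \<sigma>s "map in_colors vs"] comp_act_inner(2,3)
    by (simp add: comp_def)
  have "\<forall>v\<in>set (map2 ActT \<sigma>s vs). wf_term Col X v"
    using comp_act_inner by (auto simp: set_zip)
  then show ?case using comp_act_inner(1) 1 2 3 by (simp del: map_map)
qed auto

definition term_class :: "'o set \<Rightarrow> ('o, 'x) colseq \<Rightarrow> ('o, 'x) opterm \<Rightarrow> ('o, 'x) opterm set" where
  "term_class Col X u = {v. term_eq Col X u v}"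

lemma quot_map_term_rel:
  "out_color u = t \<Longrightarrow> in_colors u = c \<Longrightarrow> quot_map (term_rel Col X) t c u = term_class Col X u"
  by (auto simp: quot_map_def term_rel_def term_class_def)

lemma term_class_eqI: "term_eq Col X u v \<Longrightarrow> term_class Col X u = term_class Col X v"
  unfolding term_class_def by (auto intro: term_eq.sym term_eq.trans)

lemma opset_free:
  "opset (free_operad Col X) t c =
   {term_class Col X u | u. wf_term Col X u \<and> out_color u = t \<and> in_colors u = c}"
  unfolding free_operad_def quot_operad_def term_operad_def quotient_def
  by (auto simp: quot_map_def[symmetric] quot_map_term_rel intro: quot_map_term_rel)

lemma opact_free:
  assumes "wf_term Col X u" "out_color u = t" "in_colors u = c" "\<sigma> permutes {..<length c}"
  shows "opact (free_operad Col X) t c \<sigma> (term_class Col X u) = term_class Col X (ActT \<sigma> u)"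
proof -
  have "quot_map (term_rel Col X) t (permute_list \<sigma> c) (ActT \<sigma> v) = term_class Col X (ActT \<sigma> u)"
    if v: "v \<in> term_class Col X u" for v
  proof -
    have e: "term_eq Col X u v" using v by (simp add: term_class_def)
    then have "term_class Col X (ActT \<sigma> u) = term_class Col X (ActT \<sigma> v)"
      using assms by (intro term_class_eqI term_eq.cong_act) auto
    then show ?thesis using term_eq_wf[OF e] assms by (simp add: quot_map_term_rel)
  qed
  moreover have "u \<in> term_class Col X u" using assms(1) by (simp add: term_class_def term_eq.refl)
  ultimately show ?thesis
    unfolding free_operad_def quot_operad_def term_operad_def quot_map_def[symmetric] by auto
qed

lemma in_listset_iff: "ys \<in> listset As \<longleftrightarrow> list_all2 (\<in>) ys As"
  by (induction As arbitrary: ys) (auto simp: set_Cons_def list_all2_Cons2)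

lemma opcomp_free:
  assumes u: "wf_term Col X u" "out_color u = t" "in_colors u = c"
    and vs: "\<forall>v\<in>set vs. wf_term Col X v" "map out_color vs = c" "map in_colors vs = bs"
  shows "opcomp (free_operad Col X) t c bs (term_class Col X u) (map (term_class Col X) vs) =
    term_class Col X (CompT u vs)"
proof -
  have "quot_map (term_rel Col X) t (concat bs) (CompT u' vs') = term_class Col X (CompT u vs)"
    if u': "u' \<in> term_class Col X u" and vs': "vs' \<in> listset (map (term_class Col X) vs)" for u' vs'
  proof -
    have e: "term_eq Col X u u'" using u' by (simp add: term_class_def)
    have l: "list_all2 (term_eq Col X) vs vs'"
    proof (rule list_all2_all_nthI)
      show "length vs = length vs'" using vs' by (auto simp: in_listset_iff dest: list_all2_lengthD)
    next
      fix i assume "i < length vs"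
      then show "term_eq Col X (vs ! i) (vs' ! i)"
        using list_all2_nthD2[of "(\<in>)" vs' "map (term_class Col X) vs" i] vs'
        by (simp add: in_listset_iff term_class_def)
    qed
    have "map in_colors vs' = bs"
      using l term_eq_wf vs(3) by (fastforce simp: list_all2_conv_all_nth intro!: nth_equalityI)
    moreover have "term_class Col X (CompT u vs) = term_class Col X (CompT u' vs')"
      using e l u(3) vs(2) by (intro term_class_eqI term_eq.cong_comp) auto
    ultimately show ?thesis using term_eq_wf[OF e] u(2) by (simp add: quot_map_term_rel)
  qed
  moreover have "u \<in> term_class Col X u" using u(1) by (simp add: term_class_def term_eq.refl)
  moreover have "vs \<in> listset (map (term_class Col X) vs)"
    using vs(1) by (simp add: in_listset_iff list_all2_conv_all_nth term_class_def term_eq.refl)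
  ultimately show ?thesis
    unfolding free_operad_def quot_operad_def term_operad_def quot_map_def[symmetric]
    by (auto 0 3)
qed

lemma opunit_free: "opunit (free_operad Col X) t = term_class Col X (UnitT t)"
  by (simp add: free_operad_def quot_operad_def term_operad_def quot_map_def[symmetric]
      quot_map_term_rel)

lemma inputs_free:
  assumes "inputs (opset (free_operad Col X)) c bs As"
  obtains vs where "\<forall>v\<in>set vs. wf_term Col X v" "map out_color vs = c" "map in_colors vs = bs"
    "As = map (term_class Col X) vs"
proof -
  have "\<exists>v. As ! i = term_class Col X v \<and> wf_term Col X v \<and>
      out_color v = c ! i \<and> in_colors v = bs ! i" if "i < length c" for i
    using assms that by (auto simp: inputs_def opset_free)
  then obtain f where "\<And>i. i < length c \<Longrightarrow> As ! i = term_class Col X (f i) \<and> wf_term Col X (f i) \<and>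
      out_color (f i) = c ! i \<and> in_colors (f i) = bs ! i" by metis
  then show ?thesis
    using assms by (intro that[of "map f [0..<length c]"]) (auto simp: inputs_def intro!: nth_equalityI)
qed

theorem colored_operad_free: "colored_operad Col (free_operad Col X)"
proof
  let ?F = "free_operad Col X" and ?cls = "term_class Col X"
  note ops = opact_free opcomp_free opunit_free
  fix t :: 'a assume t: "t \<in> Col"
  show "opunit ?F t \<in> opset ?F t [t]"
    using t by (auto simp: opunit_free opset_free intro!: exI[of _ "UnitT t"])
  fix c A assume c: "c \<in> lists Col" and "A \<in> opset ?F t c"
  from this(2) obtain u where u: "wf_term Col X u" "out_color u = t" "in_colors u = c" and A: "A = ?cls u"
    by (auto simp: opset_free)
  show "opact ?F t c id A = A"
    unfolding A using u by (simp add: opact_free permutes_id term_class_eqI term_eq.act_id)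
  show "opcomp ?F t [t] [c] (opunit ?F t) [A] = A"
    using opcomp_free[of Col X "UnitT t" t "[t]" "[u]"] t u term_eq.unit_left[OF u(1)]
    by (simp add: A opunit_free term_class_eqI)
  have "map (opunit ?F) c = map ?cls (map UnitT c)" by (simp add: opunit_free)
  moreover have "opcomp ?F t c (map (\<lambda>a. [a]) c) A (map ?cls (map UnitT c)) =
      ?cls (CompT u (map UnitT c))"
    unfolding A using u c by (intro opcomp_free) (auto simp: in_lists_conv_set comp_def)
  ultimately show "opcomp ?F t c (map (\<lambda>a. [a]) c) A (map (opunit ?F) c) = A"
    using term_class_eqI[OF term_eq.unit_right[OF u(1)]] u(3) A by (simp del: map_eq_conv map_map)
  fix \<sigma> assume \<sigma>: "\<sigma> permutes {..<length c}"
  show "opact ?F t c \<sigma> A \<in> opset ?F t (permute_list \<sigma> c)"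
    using u \<sigma> by (auto simp: A opact_free opset_free intro!: exI[of _ "ActT \<sigma> u"])
  fix \<sigma>' assume \<sigma>': "\<sigma>' permutes {..<length c}"
  show "opact ?F t (permute_list \<sigma> c) \<sigma>' (opact ?F t c \<sigma> A) = opact ?F t c (\<sigma> \<circ> \<sigma>') A"
    using u \<sigma> \<sigma>' by (simp add: A opact_free permutes_compose term_class_eqI term_eq.act_act)
next
  let ?F = "free_operad Col X" and ?cls = "term_class Col X"
  fix t :: 'a and c bs A Bs
  assume t: "t \<in> Col" and c: "c \<in> lists Col" and "bs \<in> lists (lists Col)"
    and A: "A \<in> opset ?F t c" and Bs: "inputs (opset ?F) c bs Bs"
  from A obtain u where u: "wf_term Col X u" "out_color u = t" "in_colors u = c" and A: "A = ?cls u"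
    by (auto simp: opset_free)
  from Bs obtain vs where vs: "\<forall>v\<in>set vs. wf_term Col X v" "map out_color vs = c"
    "map in_colors vs = bs" and Bs: "Bs = map ?cls vs" by (rule inputs_free)
  have len: "length vs = length c" using vs(2) by auto
  have comp: "opcomp ?F t c bs A Bs = ?cls (CompT u vs)"
    using opcomp_free[OF u vs] by (simp add: A Bs)
  have wf: "wf_term Col X (CompT u vs)" "out_color (CompT u vs) = t"
    "in_colors (CompT u vs) = concat bs" using u vs by auto
  have nth: "out_color (vs ! i) = c ! i" "in_colors (vs ! i) = bs ! i" "wf_term Col X (vs ! i)"
    "Bs ! i = ?cls (vs ! i)"
    if "i < length c" for i using vs(1) vs(2,3)[symmetric] that by (auto simp: Bs)
  show "opcomp ?F t c bs A Bs \<in> opset ?F t (concat bs)"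
    using wf by (auto simp: comp opset_free)
  {
    fix \<sigma> assume \<sigma>: "\<sigma> permutes {..<length c}"
    have \<sigma>': "\<sigma> permutes {..<length vs}" using \<sigma> len by simp
    have perm: "permute_list \<sigma> bs = map in_colors (permute_list \<sigma> vs)"
      "permute_list \<sigma> c = map out_color (permute_list \<sigma> vs)"
      "permute_list \<sigma> Bs = map ?cls (permute_list \<sigma> vs)"
      using permute_list_map[OF \<sigma>'] vs(2,3) Bs by auto
    have l: "map length (permute_list \<sigma> bs) =
        map (\<lambda>v. length (in_colors v)) (permute_list \<sigma> vs)"
      by (simp add: perm)
    have e: "term_eq Col X (CompT (ActT \<sigma> u) (permute_list \<sigma> vs))
        (ActT (block_perm \<sigma> (map length (permute_list \<sigma> bs))) (CompT u vs))"
      unfolding l using wf(1) \<sigma> u(3) by (intro term_eq.comp_act_outer) auto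
    have "block_perm \<sigma> (map length (permute_list \<sigma> bs)) permutes {..<length (concat bs)}"
      using term_eq_wf[OF e] wf(3) by simp
    then have "opact ?F t (concat bs) (block_perm \<sigma> (map length (permute_list \<sigma> bs)))
        (opcomp ?F t c bs A Bs) =
        ?cls (ActT (block_perm \<sigma> (map length (permute_list \<sigma> bs))) (CompT u vs))"
      unfolding comp using wf by (intro opact_free) auto
    moreover have "opcomp ?F t (permute_list \<sigma> c) (permute_list \<sigma> bs) (opact ?F t c \<sigma> A)
        (permute_list \<sigma> Bs) = ?cls (CompT (ActT \<sigma> u) (permute_list \<sigma> vs))"
      unfolding A opact_free[OF u \<sigma>] perm(3)
      using u \<sigma> \<sigma>' vs(1) perm by (intro opcomp_free) auto
    ultimately show "opcomp ?F t (permute_list \<sigma> c) (permute_list \<sigma> bs) (opact ?F t c \<sigma> A)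
        (permute_list \<sigma> Bs) =
      opact ?F t (concat bs) (block_perm \<sigma> (map length (permute_list \<sigma> bs)))
        (opcomp ?F t c bs A Bs)"
      using term_class_eqI[OF e] by simp
  }
  {
    fix \<sigma>s :: "(nat \<Rightarrow> nat) list"
    assume \<sigma>s: "length \<sigma>s = length c" "\<And>i. i < length c \<Longrightarrow> \<sigma>s ! i permutes {..<length (bs ! i)}"
    have l: "map length bs = map (\<lambda>v. length (in_colors v)) vs"
      by (simp add: vs(3)[symmetric])
    have e: "term_eq Col X (CompT u (map2 ActT \<sigma>s vs))
        (ActT (sum_perm (map length bs) \<sigma>s) (CompT u vs))"
      unfolding l using wf(1) \<sigma>s len nth(2) by (intro term_eq.comp_act_inner) auto
    have "sum_perm (map length bs) \<sigma>s permutes {..<length (concat bs)}"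
      using term_eq_wf[OF e] wf(3) by simp
    then have "opact ?F t (concat bs) (sum_perm (map length bs) \<sigma>s) (opcomp ?F t c bs A Bs) =
        ?cls (ActT (sum_perm (map length bs) \<sigma>s) (CompT u vs))"
      unfolding comp using wf by (intro opact_free) auto
    moreover have "map (\<lambda>i. opact ?F (c ! i) (bs ! i) (\<sigma>s ! i) (Bs ! i)) [0..<length c] =
        map ?cls (map2 ActT \<sigma>s vs)"
      using len \<sigma>s nth by (auto intro!: nth_equalityI simp: opact_free)
    moreover have "opcomp ?F t c (map2 permute_list \<sigma>s bs) (?cls u) (map ?cls (map2 ActT \<sigma>s vs)) =
        ?cls (CompT u (map2 ActT \<sigma>s vs))"
      using u term_eq_wf[OF e] vs(3) len \<sigma>s(1) by (intro opcomp_free) (auto intro!: nth_equalityI)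
    ultimately show "opcomp ?F t c (map2 permute_list \<sigma>s bs) A
        (map (\<lambda>i. opact ?F (c ! i) (bs ! i) (\<sigma>s ! i) (Bs ! i)) [0..<length c]) =
      opact ?F t (concat bs) (sum_perm (map length bs) \<sigma>s) (opcomp ?F t c bs A Bs)"
      using term_class_eqI[OF e] A by simp
  }
  {
    fix as Cs
    assume len': "length as = length c" "length Cs = length c"
      and Cs: "\<And>i. i < length c \<Longrightarrow> inputs (opset ?F) (bs ! i) (as ! i) (Cs ! i)"
    have "\<exists>w. (\<forall>v\<in>set w. wf_term Col X v) \<and> map out_color w = bs ! i \<and> map in_colors w = as ! i \<and>
        Cs ! i = map ?cls w" if "i < length c" for i
      using Cs[OF that] by (rule inputs_free) blast
    then obtain f where f: "\<And>i. i < length c \<Longrightarrow> (\<forall>v\<in>set (f i). wf_term Col X v) \<and>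
        map out_color (f i) = bs ! i \<and> map in_colors (f i) = as ! i \<and> Cs ! i = map ?cls (f i)"
      by metis
    define ws where "ws = map f [0..<length c]"
    have ws: "length ws = length vs" "map (map out_color) ws = bs" "map (map in_colors) ws = as"
      "map (map ?cls) ws = Cs" "\<forall>w\<in>set ws. \<forall>v\<in>set w. wf_term Col X v"
      using f len len' arg_cong[OF vs(3), of length]
      by (auto simp: ws_def intro!: nth_equalityI)
    have ws_nth: "wf_term Col X (CompT (vs ! i) (ws ! i))" if "i < length vs" for i
      using that f[of i] nth[of i] len by (simp add: ws_def)
    have e: "term_eq Col X (CompT (CompT u vs) (concat ws)) (CompT u (map2 CompT vs ws))"
      using wf(1) ws(1) ws_nth by (rule term_eq.comp_assoc)
    have "opcomp ?F t (concat bs) (concat as) (opcomp ?F t c bs A Bs) (concat Cs) =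
        ?cls (CompT (CompT u vs) (concat ws))"
      unfolding comp ws(4)[symmetric] map_concat_concat[symmetric]
      using wf ws by (intro opcomp_free) (auto simp: map_concat_concat)
    moreover have "map (\<lambda>i. opcomp ?F (c ! i) (bs ! i) (as ! i) (Bs ! i) (Cs ! i)) [0..<length c] =
        map ?cls (map2 CompT vs ws)"
      using len ws(1) f nth by (auto intro!: nth_equalityI simp: opcomp_free ws_def)
    moreover have "opcomp ?F t c (map concat as) (?cls u) (map ?cls (map2 CompT vs ws)) =
        ?cls (CompT u (map2 CompT vs ws))"
      using u term_eq_wf[OF e] ws(1) ws(3)[symmetric]
      by (intro opcomp_free) (auto intro!: nth_equalityI)
    ultimately show "opcomp ?F t (concat bs) (concat as) (opcomp ?F t c bs A Bs) (concat Cs) =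
      opcomp ?F t c (map concat as) A
        (map (\<lambda>i. opcomp ?F (c ! i) (bs ! i) (as ! i) (Bs ! i) (Cs ! i)) [0..<length c])"
      using term_class_eqI[OF e] A by simp
  }
qed

lemma free_unit_class: "free_unit Col X t c x = term_class Col X (Gen t c x)"
  by (simp add: free_unit_def quot_map_term_rel)

theorem free_unit_hom: "seq_hom Col X (opset (free_operad Col X)) (free_unit Col X)"
  unfolding seq_hom_def
proof (intro ballI)
  fix t c x assume "t \<in> Col" "c \<in> lists Col" "x \<in> X t c"
  then show "free_unit Col X t c x \<in> opset (free_operad Col X) t c"
    unfolding free_unit_class opset_free by (intro CollectI exI[of _ "Gen t c x"]) simp
qed

context
  fixes Col :: "'o set" and X :: "('o, 'x) colseq" and Q :: "('o, 'q) operad"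
    and h :: "'o \<Rightarrow> 'o list \<Rightarrow> 'x \<Rightarrow> 'q"
  assumes Q: "colored_operad Col Q" and h: "seq_hom Col X (opset Q) h"
begin

interpretation Q: colored_operad Col Q by (rule Q)

lemma eval_term_closed:
  "wf_term Col X u \<Longrightarrow> eval_term Q h u \<in> opset Q (out_color u) (in_colors u)"
proof (induction u)
  case (Gen t c x)
  then show ?case using h by (simp add: seq_hom_def)
next
  case (UnitT t)
  then show ?case by (simp add: Q.unit_closed)
next
  case (ActT \<sigma> u)
  then show ?case using wf_term_colors[of Col X u] by (simp add: Q.act_closed)
next
  case (CompT u vs)
  have 1: "inputs (opset Q) (in_colors u) (map in_colors vs) (map (eval_term Q h) vs)"
  proof -
    have out: "in_colors u = map out_color vs" using CompT.prems by simp
    show ?thesis using CompT.IH(2) CompT.prems by (simp add: inputs_def out)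
  qed
  have "map in_colors vs \<in> lists (lists Col)"
    using CompT.prems wf_term_colors by (fastforce simp: in_lists_conv_set)
  then show ?case using CompT 1 wf_term_colors[of Col X u] by (simp add: Q.comp_closed)
qed

lemma eval_term_inputs:
  assumes "\<forall>v\<in>set vs. wf_term Col X v"
  shows "inputs (opset Q) (map out_color vs) (map in_colors vs) (map (eval_term Q h) vs)"
  using assms eval_term_closed by (simp add: inputs_def)

lemma in_colors_lists:
  "\<forall>v\<in>set vs. wf_term Col X v \<Longrightarrow> map in_colors vs \<in> lists (lists Col)"
  using wf_term_colors by (fastforce simp: in_lists_conv_set)

lemma eval_term_eq: "term_eq Col X u v \<Longrightarrow> eval_term Q h u = eval_term Q h v"
proof (induction rule: term_eq.induct)
  case (cong_act u v \<sigma>)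
  then show ?case using term_eq_wf[of Col X u v] by simp
next
  case (cong_comp u u' vs vs')
  have "map in_colors vs = map in_colors vs'" "map (eval_term Q h) vs = map (eval_term Q h) vs'"
    using cong_comp.IH(2) by (induction rule: list_all2_induct) (auto dest: term_eq_wf)
  then show ?case
    using cong_comp.IH(1) term_eq_wf[OF cong_comp.hyps(1)] by (simp del: map_eq_conv)
next
  case (act_id u)
  then show ?case using wf_term_colors[of Col X u] eval_term_closed by (simp add: Q.act_id)
next
  case (act_act u \<sigma> \<sigma>')
  then show ?case using wf_term_colors[of Col X u] eval_term_closed by (simp add: Q.act_act)
next
  case (unit_left u)
  then show ?case using wf_term_colors[of Col X u] eval_term_closed by (simp add: Q.unit_left)
next
  case (unit_right u)
  then show ?case
    using wf_term_colors[of Col X u] eval_term_closed[of u]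
      Q.unit_right[of "out_color u" "in_colors u" "eval_term Q h u"]
    by (simp add: comp_def)
next
  case (comp_assoc u vs ws)
  have u: "wf_term Col X u" and vs: "\<forall>v\<in>set vs. wf_term Col X v"
    and out: "in_colors u = map out_color vs" using comp_assoc(1) by auto
  have ws: "\<forall>w\<in>set (ws ! i). wf_term Col X w" "in_colors (vs ! i) = map out_color (ws ! i)"
    if "i < length vs" for i using comp_assoc(3)[OF that] by auto
  have lists: "map (map in_colors) ws \<in> lists (lists (lists Col))"
    using ws(1) comp_assoc(2) in_colors_lists by (fastforce simp: in_lists_conv_set in_set_conv_nth[of _ ws])
  have "eval_term Q h (CompT (CompT u vs) (concat ws)) =
      opcomp Q (out_color u) (concat (map in_colors vs)) (concat (map (map in_colors) ws))
        (opcomp Q (out_color u) (in_colors u) (map in_colors vs) (eval_term Q h u)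
          (map (eval_term Q h) vs))
        (concat (map (map (eval_term Q h)) ws))"
    by (simp add: map_concat_concat)
  also have "\<dots> = opcomp Q (out_color u) (in_colors u) (map concat (map (map in_colors) ws))
      (eval_term Q h u)
      (map (\<lambda>i. opcomp Q (in_colors u ! i) (map in_colors vs ! i) (map (map in_colors) ws ! i)
        (map (eval_term Q h) vs ! i) (map (map (eval_term Q h)) ws ! i)) [0..<length (in_colors u)])"
  proof (rule Q.comp_assoc)
    show "inputs (opset Q) (map in_colors vs ! i) (map (map in_colors) ws ! i)
        (map (map (eval_term Q h)) ws ! i)" if "i < length (in_colors u)" for i
      using eval_term_inputs[OF ws(1), of i] ws(2)[of i] that out comp_assoc(2) by simp
  qed (use u vs out comp_assoc(2) lists wf_term_colors[OF u] in_colors_lists[OF vs]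
      eval_term_closed[OF u] eval_term_inputs[OF vs] in simp_all)
  also have "map concat (map (map in_colors) ws) = map in_colors (map2 CompT vs ws)"
    using comp_assoc(2) by (auto intro!: nth_equalityI)
  also have "map (\<lambda>i. opcomp Q (in_colors u ! i) (map in_colors vs ! i) (map (map in_colors) ws ! i)
        (map (eval_term Q h) vs ! i) (map (map (eval_term Q h)) ws ! i)) [0..<length (in_colors u)] =
      map (eval_term Q h) (map2 CompT vs ws)"
    using comp_assoc(2) out by (auto intro!: nth_equalityI)
  finally show ?case by simp
next
  case (comp_act_outer u vs \<sigma>)
  have u: "wf_term Col X u" and vs: "\<forall>v\<in>set vs. wf_term Col X v"
    and out: "in_colors u = map out_color vs" using comp_act_outer(1) by auto
  have \<sigma>: "\<sigma> permutes {..<length vs}" using comp_act_outer(2) out by simp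
  have "opcomp Q (out_color u) (permute_list \<sigma> (in_colors u)) (permute_list \<sigma> (map in_colors vs))
      (opact Q (out_color u) (in_colors u) \<sigma> (eval_term Q h u))
      (permute_list \<sigma> (map (eval_term Q h) vs)) =
    opact Q (out_color u) (concat (map in_colors vs))
      (block_perm \<sigma> (map length (permute_list \<sigma> (map in_colors vs))))
      (opcomp Q (out_color u) (in_colors u) (map in_colors vs) (eval_term Q h u)
        (map (eval_term Q h) vs))"
    using wf_term_colors[OF u] in_colors_lists[OF vs] eval_term_closed[OF u]
      eval_term_inputs[OF vs] comp_act_outer(2)
    by (intro Q.comp_act_outer) (simp_all add: out)
  then show ?case using \<sigma> by (simp add: permute_list_map comp_def)
next
  case (comp_act_inner u vs \<sigma>s)
  have u: "wf_term Col X u" and vs: "\<forall>v\<in>set vs. wf_term Col X v"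
    and out: "in_colors u = map out_color vs" using comp_act_inner(1) by auto
  have "opcomp Q (out_color u) (in_colors u) (map2 permute_list \<sigma>s (map in_colors vs))
      (eval_term Q h u)
      (map (\<lambda>i. opact Q (in_colors u ! i) (map in_colors vs ! i) (\<sigma>s ! i)
        (map (eval_term Q h) vs ! i)) [0..<length (in_colors u)]) =
    opact Q (out_color u) (concat (map in_colors vs))
      (sum_perm (map length (map in_colors vs)) \<sigma>s)
      (opcomp Q (out_color u) (in_colors u) (map in_colors vs) (eval_term Q h u)
        (map (eval_term Q h) vs))"
    using wf_term_colors[OF u] in_colors_lists[OF vs] eval_term_closed[OF u]
      eval_term_inputs[OF vs] comp_act_inner(2,3)
    by (intro Q.comp_act_inner) (simp_all add: out)
  moreover have "map2 permute_list \<sigma>s (map in_colors vs) = map in_colors (map2 ActT \<sigma>s vs)"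
    using comp_act_inner(2) by (auto intro!: nth_equalityI)
  moreover have "map (\<lambda>i. opact Q (in_colors u ! i) (map in_colors vs ! i) (\<sigma>s ! i)
        (map (eval_term Q h) vs ! i)) [0..<length (in_colors u)] =
      map (eval_term Q h) (map2 ActT \<sigma>s vs)"
    using comp_act_inner(2) out by (auto intro!: nth_equalityI)
  ultimately show ?case by (simp add: comp_def)
qed auto

lemma free_lift_class:
  assumes "wf_term Col X u"
  shows "free_lift Q h t c (term_class Col X u) = eval_term Q h u"
proof -
  have "u \<in> term_class Col X u" using assms by (simp add: term_class_def term_eq.refl)
  moreover have "eval_term Q h v = eval_term Q h u" if "v \<in> term_class Col X u" for v
    using that eval_term_eq[of u v] by (simp add: term_class_def)
  ultimately have "eval_term Q h ` term_class Col X u = {eval_term Q h u}" by blast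
  then show ?thesis by (simp add: free_lift_def)
qed

theorem free_lift_hom: "operad_hom Col (free_operad Col X) Q (free_lift Q h)"
proof (intro operad_hom.intro operad_hom_axioms.intro colored_operad_free Q)
  let ?F = "free_operad Col X" and ?cls = "term_class Col X" and ?l = "free_lift Q h"
  show "seq_hom Col (opset ?F) (opset Q) ?l"
    using eval_term_closed by (auto simp: seq_hom_def opset_free free_lift_class)
  fix t assume t: "t \<in> Col"
  then show "?l t [t] (opunit ?F t) = opunit Q t"
    by (simp add: opunit_free free_lift_class)
  fix c A assume c: "c \<in> lists Col" and "A \<in> opset ?F t c"
  from this(2) obtain u where u: "wf_term Col X u" "out_color u = t" "in_colors u = c"
    and A: "A = ?cls u" by (auto simp: opset_free)
  show "?l t (permute_list \<sigma> c) (opact ?F t c \<sigma> A) = opact Q t c \<sigma> (?l t c A)"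
    if "\<sigma> permutes {..<length c}" for \<sigma>
    using u that by (simp add: A opact_free free_lift_class)
  fix bs Bs assume "inputs (opset ?F) c bs Bs"
  then obtain vs where vs: "\<forall>v\<in>set vs. wf_term Col X v" "map out_color vs = c"
    "map in_colors vs = bs" and Bs: "Bs = map ?cls vs" by (rule inputs_free)
  have "map (\<lambda>i. ?l (c ! i) (bs ! i) (Bs ! i)) [0..<length c] = map (eval_term Q h) vs"
    using vs(1) arg_cong[OF vs(2), of length]
    by (auto intro!: nth_equalityI simp: Bs free_lift_class)
  then show "?l t (concat bs) (opcomp ?F t c bs A Bs) =
      opcomp Q t c bs (?l t c A) (map (\<lambda>i. ?l (c ! i) (bs ! i) (Bs ! i)) [0..<length c])"
    using opcomp_free[OF u vs] u vs
    by (simp add: A Bs free_lift_class)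
qed

theorem free_lift_unit:
  "seq_hom_eq Col X (\<lambda>t c x. free_lift Q h t c (free_unit Col X t c x)) h"
  by (auto simp: seq_hom_eq_def free_unit_class free_lift_class)

theorem free_lift_unique:
  assumes g: "operad_hom Col (free_operad Col X) Q g"
    and gen: "seq_hom_eq Col X (\<lambda>t c x. g t c (free_unit Col X t c x)) h"
  shows "seq_hom_eq Col (opset (free_operad Col X)) g (free_lift Q h)"
proof -
  let ?F = "free_operad Col X" and ?cls = "term_class Col X"
  interpret g: operad_hom Col ?F Q g by (rule g)
  have in_opset: "?cls u \<in> opset ?F (out_color u) (in_colors u)" if "wf_term Col X u" for u
    using that by (auto simp: opset_free)
  have "g (out_color u) (in_colors u) (?cls u) = eval_term Q h u" if "wf_term Col X u" for u
    using that
  proof (induction u)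
    case (Gen t c x)
    then show ?case using gen by (simp add: seq_hom_eq_def free_unit_class)
  next
    case (UnitT t)
    then show ?case using g.hom_unit[of t] by (simp add: opunit_free)
  next
    case (ActT \<sigma> u)
    then show ?case
      using g.hom_act[of "out_color u" "in_colors u" "?cls u" \<sigma>] in_opset[of u]
        wf_term_colors[of Col X u] by (simp add: opact_free)
  next
    case (CompT u vs)
    then have u: "wf_term Col X u" and vs: "\<forall>v\<in>set vs. wf_term Col X v"
      and out: "map out_color vs = in_colors u" by auto
    have len: "length vs = length (in_colors u)" using arg_cong[OF out, of length] by simp
    have nth: "in_colors u ! i = out_color (vs ! i)" if "i < length vs" for i
      using that by (simp add: out[symmetric])
    have "inputs (opset ?F) (in_colors u) (map in_colors vs) (map ?cls vs)"
      using vs in_opset len nth by (simp add: inputs_def)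
    moreover have "map (\<lambda>i. g (in_colors u ! i) (map in_colors vs ! i) (map ?cls vs ! i))
        [0..<length (in_colors u)] = map (eval_term Q h) vs"
      using len nth CompT.IH(2) vs by (auto intro!: nth_equalityI)
    ultimately show ?case
      using g.hom_comp[of "out_color u" "in_colors u" "map in_colors vs" "?cls u" "map ?cls vs"]
        opcomp_free[OF u HOL.refl HOL.refl vs out HOL.refl] in_opset[OF u] in_colors_lists[OF vs]
        wf_term_colors[OF u] CompT.IH(1)[OF u] by simp
  qed
  then show ?thesis by (auto simp: seq_hom_eq_def opset_free free_lift_class)
qed

end


section \<open>Orthogonal categories\<close>

record ('o, 'm) category =
  Ob :: "'o set"
  Mor :: "'m set"
  Dom :: "'m \<Rightarrow> 'o"
  Cod :: "'m \<Rightarrow> 'o"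
  Ide :: "'o \<Rightarrow> 'm"
  Cmp :: "'m \<Rightarrow> 'm \<Rightarrow> 'm"

definition hom_set :: "('o, 'm) category \<Rightarrow> 'o \<Rightarrow> 'o \<Rightarrow> 'm set" where
  "hom_set C a b = {f \<in> Mor C. Dom C f = a \<and> Cod C f = b}"

locale small_category =
  fixes C :: "('o, 'm) category"
  assumes dom_closed: "f \<in> Mor C \<Longrightarrow> Dom C f \<in> Ob C"
    and cod_closed: "f \<in> Mor C \<Longrightarrow> Cod C f \<in> Ob C"
    and ide_closed: "a \<in> Ob C \<Longrightarrow> Ide C a \<in> hom_set C a a"
    and cmp_closed: "\<lbrakk>f \<in> hom_set C a b; g \<in> hom_set C b d\<rbrakk> \<Longrightarrow> Cmp C g f \<in> hom_set C a d"
    and cmp_ide_left: "f \<in> hom_set C a b \<Longrightarrow> Cmp C (Ide C b) f = f"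
    and cmp_ide_right: "f \<in> hom_set C a b \<Longrightarrow> Cmp C f (Ide C a) = f"
    and cmp_assoc:
      "\<lbrakk>f \<in> hom_set C a b; g \<in> hom_set C b d; k \<in> hom_set C d e\<rbrakk>
       \<Longrightarrow> Cmp C k (Cmp C g f) = Cmp C (Cmp C k g) f"

locale orthogonal_category = small_category C
  for C :: "('o, 'm) category" +
  fixes perp :: "('m \<times> 'm) set"
  assumes perp_mor:
      "(f, g) \<in> perp \<Longrightarrow> f \<in> Mor C \<and> g \<in> Mor C \<and> Cod C f = Cod C g"
    and perp_sym: "(f, g) \<in> perp \<Longrightarrow> (g, f) \<in> perp"
    and perp_post:
      "\<lbrakk>(f\<^sub>1, f\<^sub>2) \<in> perp; g \<in> Mor C; Dom C g = Cod C f\<^sub>1\<rbrakk> \<Longrightarrow> (Cmp C g f\<^sub>1, Cmp C g f\<^sub>2) \<in> perp"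
    and perp_pre:
      "\<lbrakk>(f\<^sub>1, f\<^sub>2) \<in> perp; h\<^sub>1 \<in> Mor C; h\<^sub>2 \<in> Mor C; Cod C h\<^sub>1 = Dom C f\<^sub>1; Cod C h\<^sub>2 = Dom C f\<^sub>2\<rbrakk>
       \<Longrightarrow> (Cmp C f\<^sub>1 h\<^sub>1, Cmp C f\<^sub>2 h\<^sub>2) \<in> perp"

definition cat_operad :: "('o, 'm) category \<Rightarrow> ('o, (nat \<Rightarrow> nat) \<times> 'm list) operad" where
  "cat_operad C = \<lparr>
     opset = (\<lambda>t c. {(\<sigma>, fs). \<sigma> permutes {..<length c} \<and> length fs = length c \<and>
        (\<forall>i<length c. fs ! i \<in> hom_set C (c ! i) t)}),
     opact = (\<lambda>t c \<sigma>' (\<sigma>, fs). (\<sigma> \<circ> \<sigma>', permute_list \<sigma>' fs)),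
     opcomp = (\<lambda>t c bs (\<sigma>, fs) ys.
        (assoc_comp \<sigma> (map length bs) (map fst ys),
         concat (map2 (\<lambda>f y. map (Cmp C f) (snd y)) fs ys))),
     opunit = (\<lambda>t. (id, [Ide C t])) \<rparr>"

definition R_perp :: "('o, 'm) category \<Rightarrow> ('m \<times> 'm) set \<Rightarrow> ('o, 'm \<times> 'm) colseq" where
  "R_perp C perp t c = {(f\<^sub>1, f\<^sub>2). \<exists>c\<^sub>1 c\<^sub>2. c = [c\<^sub>1, c\<^sub>2] \<and>
     f\<^sub>1 \<in> hom_set C c\<^sub>1 t \<and> f\<^sub>2 \<in> hom_set C c\<^sub>2 t \<and> (f\<^sub>1, f\<^sub>2) \<in> perp}"

definition s_perp\<^sub>1 :: "'o \<Rightarrow> 'o list \<Rightarrow> 'm \<times> 'm \<Rightarrow> (nat \<Rightarrow> nat) \<times> 'm list" where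
  "s_perp\<^sub>1 t c = (\<lambda>(f\<^sub>1, f\<^sub>2). (id, [f\<^sub>1, f\<^sub>2]))"

definition s_perp\<^sub>2 :: "'o \<Rightarrow> 'o list \<Rightarrow> 'm \<times> 'm \<Rightarrow> (nat \<Rightarrow> nat) \<times> 'm list" where
  "s_perp\<^sub>2 t c = (\<lambda>(f\<^sub>1, f\<^sub>2). (transpose 0 1, [f\<^sub>1, f\<^sub>2]))"

text \<open>\<open>\<tau>\<close>, as a right permutation of \<open>fs\<close>, is a transposition of an adjacent orthogonal pair.\<close>

definition adjacent_orth_transp :: "('m \<times> 'm) set \<Rightarrow> 'm list \<Rightarrow> (nat \<Rightarrow> nat) \<Rightarrow> bool" where
  "adjacent_orth_transp perp fs \<tau> \<longleftrightarrow>
     (\<exists>j. Suc j < length fs \<and> \<tau> = transpose j (Suc j) \<and> (fs ! j, fs ! Suc j) \<in> perp)"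

definition perm_prod :: "(nat \<Rightarrow> nat) list \<Rightarrow> nat \<Rightarrow> nat" where
  "perm_prod \<tau>s = foldr (\<circ>) \<tau>s id"

definition perp_rel ::
  "('o, 'm) category \<Rightarrow> ('m \<times> 'm) set \<Rightarrow> 'o \<Rightarrow> 'o list \<Rightarrow>
   (((nat \<Rightarrow> nat) \<times> 'm list) \<times> ((nat \<Rightarrow> nat) \<times> 'm list)) set" where
  "perp_rel C perp t c = {((\<sigma>, fs), (\<sigma>', fs')).
     (\<sigma>, fs) \<in> opset (cat_operad C) t c \<and> (\<sigma>', fs') \<in> opset (cat_operad C) t c \<and>
     fs = fs' \<and>
     (\<exists>\<tau>s. \<sigma> \<circ> inv \<sigma>' = perm_prod \<tau>s \<and>
        (\<forall>k<length \<tau>s. adjacent_orth_transp perp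
           (permute_list (inv \<sigma> \<circ> perm_prod (take k \<tau>s)) fs) (\<tau>s ! k)))}"

end

theory Submission
  imports Defs
begin

text \<open>
  A permutation of \<open>{..<n}\<close> is determined by the order it induces on the indices, and a composite
  in the associative operad induces the lexicographic order. This gives the operad axioms for
  \<open>cat_operad C\<close>. Likewise \<open>(\<sigma>, f)\<close> and \<open>(\<sigma>', f)\<close> are related by transpositions of
  adjacent orthogonal pairs if and only if every pair of entries that \<open>\<sigma>\<close> and \<open>\<sigma>'\<close> order
  differently is orthogonal, as for traces (partially commutative words); in this form the relation
  is a congruence because orthogonality is stable under post- and precomposition.
  For the universal property it suffices that a morphism which coequalizes the two maps identifies
  words differing in one adjacent orthogonal pair: up to the symmetric group action, such a word
  is obtained by inserting the pair into a word with an identity morphism at that place.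
\<close>

section \<open>Permutations and the orders they induce\<close>

text \<open>Comparing orders avoids arithmetic with flattened positions: in associativity and in
  outer equivariance both sides compare positions by the same lexicographic rule, whatever their
  explicit values. The inversion criterion answers a different obstacle. Under composition, swapping
  two outer entries moves whole blocks past each other, and chains inside different blocks must be
  merged, so lifting chains of transpositions directly would mean building new chains. A condition
  on single pairs avoids this: two inputs of a composite lie either in one block or in two, and one
  stability property settles each case. Pairs are indexed by inputs, not by positions in the word,
  so the list of morphisms stays fixed while only the permutation changes. Chains remain necessary
  on the other side, because a morphism out of the operad is tested one transposition at a time. The
  free operad enters through its universal property: two morphisms out of it agree as soon as they
  agree on generators.\<close>

lemma permutes_eqI_less:
  fixes \<sigma> \<sigma>' :: "nat \<Rightarrow> nat"
  assumes \<sigma>: "\<sigma> permutes {..<n}" and \<sigma>': "\<sigma>' permutes {..<n}"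
    and less: "\<And>i j. i < n \<Longrightarrow> j < n \<Longrightarrow> \<sigma> i < \<sigma> j \<longleftrightarrow> \<sigma>' i < \<sigma>' j"
  shows "\<sigma> = \<sigma>'"
proof
  \<comment> \<open>The value at \<open>i\<close> is the rank of \<open>i\<close>: it counts the
    indices sent below \<open>\<rho> i\<close>, and all values below \<open>\<rho> i\<close> are
    attained. The induced order on the indices therefore determines the permutation.\<close>
  have rank: "\<rho> i = card {j. j < n \<and> \<rho> j < \<rho> i}" if \<rho>: "\<rho> permutes {..<n}" and i: "i < n" for \<rho> i
  proof -
    have i': "\<rho> i < n" using permutes_in_image[OF \<rho>, of i] i by simp
    have "{..<\<rho> i} = \<rho> ` {j. j < n \<and> \<rho> j < \<rho> i}"
    proof (intro set_eqI iffI)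
      fix p assume p: "p \<in> {..<\<rho> i}"
      then have "inv \<rho> p < n"
        using permutes_in_image[OF permutes_inv[OF \<rho>], of p] i' by simp
      then show "p \<in> \<rho> ` {j. j < n \<and> \<rho> j < \<rho> i}"
        using p by (intro image_eqI[of _ _ "inv \<rho> p"]) (simp_all add: permutes_inverses(1)[OF \<rho>])
    qed auto
    then have "card {..<\<rho> i} = card {j. j < n \<and> \<rho> j < \<rho> i}"
      using card_image[OF inj_on_subset[OF permutes_inj[OF \<rho>] subset_UNIV]] by metis
    then show ?thesis by simp
  qed
  fix i
  show "\<sigma> i = \<sigma>' i"
  proof (cases "i < n")
    case True
    then have "{j. j < n \<and> \<sigma> j < \<sigma> i} = {j. j < n \<and> \<sigma>' j < \<sigma>' i}" using less by blast
    then show ?thesis using rank[OF \<sigma> True] rank[OF \<sigma>' True] by simp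
  next
    case False
    then show ?thesis using permutes_not_in[OF \<sigma>] permutes_not_in[OF \<sigma>'] by simp
  qed
qed

section \<open>Lexicographic order on positions in blocks\<close>

lemma block_start_less_iff:
  fixes ks :: "nat list"
  assumes "i < length ks" "j < ks ! i" "i' < length ks" "j' < ks ! i'"
  shows "sum_list (take i ks) + j < sum_list (take i' ks) + j' \<longleftrightarrow> i < i' \<or> i = i' \<and> j < j'"
proof -
  have *: "sum_list (take a ks) + p < sum_list (take b ks)"
    if "a < b" "a < length ks" "p < ks ! a" for a b p
  proof -
    \<comment> \<open>Block \<open>b\<close> starts at the end of block \<open>a\<close> or later,
      since the first \<open>b\<close> blocks include the first \<open>Suc a\<close>.\<close>
    obtain d where d: "b = Suc a + d" using \<open>a < b\<close> by (metis Suc_leI le_iff_add)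
    have "sum_list (take a ks) + ks ! a = sum_list (take (Suc a) ks)"
      using that(2) by (simp add: take_Suc_conv_app_nth)
    also have "\<dots> \<le> sum_list (take b ks)" unfolding d take_add by simp
    finally show ?thesis using that(3) by linarith
  qed
  show ?thesis
    using *[of i i' j] *[of i' i j'] assms by (cases i i' rule: linorder_cases) auto
qed

lemma permutes_less: "\<sigma> permutes {..<n} \<Longrightarrow> i < n \<Longrightarrow> \<sigma> i < (n::nat)"
  using permutes_in_image[of \<sigma> "{..<n}" i] by simp

lemma assoc_comp_permutes:
  assumes "\<sigma> permutes {..<length ks}" "length \<sigma>s = length ks"
    "\<And>i. i < length ks \<Longrightarrow> \<sigma>s ! i permutes {..<ks ! i}"
  shows "assoc_comp \<sigma> ks \<sigma>s permutes {..<sum_list ks}"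
  unfolding assoc_comp_def
  by (intro permutes_compose sum_perm_permutes block_perm_permutes assms)

text \<open>The sum permutation stays inside each block, and the block permutation then moves block
  \<open>a\<close> to the start of block \<open>\<sigma> a\<close> in the reordered concatenation,
  so images compare first by target block and then inside it. Injectivity of \<sigma> turns equality
  of target blocks into \<open>i = i'\<close>.\<close>

lemma assoc_comp_less_iff:
  fixes ks :: "nat list"
  assumes \<sigma>: "\<sigma> permutes {..<length ks}"
    and \<sigma>s: "\<And>i. i < length ks \<Longrightarrow> \<sigma>s ! i permutes {..<ks ! i}"
    and ij: "i < length ks" "j < ks ! i" and ij': "i' < length ks" "j' < ks ! i'"
  shows "assoc_comp \<sigma> ks \<sigma>s (sum_list (take i ks) + j) <
      assoc_comp \<sigma> ks \<sigma>s (sum_list (take i' ks) + j') \<longleftrightarrow>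
    \<sigma> i < \<sigma> i' \<or> i = i' \<and> (\<sigma>s ! i) j < (\<sigma>s ! i) j'"
proof -
  \<comment> \<open>Block lengths in the target order: entry \<open>\<sigma> a\<close> of
    \<open>?ls\<close> is \<open>ks ! a\<close>.\<close>
  let ?ls = "permute_list (inv \<sigma>) ks"
  have val: "assoc_comp \<sigma> ks \<sigma>s (sum_list (take a ks) + b) =
      sum_list (take (\<sigma> a) ?ls) + (\<sigma>s ! a) b"
    and valid: "\<sigma> a < length ?ls" "(\<sigma>s ! a) b < ?ls ! \<sigma> a"
    if ab: "a < length ks" "b < ks ! a" for a b
  proof -
    have b': "(\<sigma>s ! a) b < ks ! a" by (rule permutes_less[OF \<sigma>s[OF ab(1)] ab(2)])
    show "assoc_comp \<sigma> ks \<sigma>s (sum_list (take a ks) + b) =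
        sum_list (take (\<sigma> a) ?ls) + (\<sigma>s ! a) b"
      by (simp add: assoc_comp_def sum_perm_start[OF ab] block_perm_start[OF \<sigma> ab(1) b'])
    show "\<sigma> a < length ?ls" using permutes_less[OF \<sigma> ab(1)] by simp
    then show "(\<sigma>s ! a) b < ?ls ! \<sigma> a"
      using b' by (simp add: permute_list_nth[OF permutes_inv[OF \<sigma>]] permutes_inverses[OF \<sigma>])
  qed
  show ?thesis
    using block_start_less_iff[OF valid[OF ij] valid[OF ij']] permutes_inj[OF \<sigma>]
    by (auto simp: val[OF ij] val[OF ij'] dest: injD)
qed

section \<open>Operad laws for permutations\<close>

lemma block_perm_id: "block_perm id ks = id"
proof
  fix p
  show "block_perm id ks p = id p"
  proof (cases "p < sum_list ks")
    case True
    then obtain i j where "i < length ks" "j < ks ! i" "p = sum_list (take i ks) + j"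
      using block_cases by blast
    then show ?thesis using block_perm_start[OF permutes_id] by simp
  qed (simp add: block_perm_def)
qed

lemma assoc_comp_unit_left:
  assumes "\<sigma> permutes {..<n}"
  shows "assoc_comp id [n] [\<sigma>] = \<sigma>"
  using permutes_not_in[OF assms] by (auto simp: assoc_comp_def block_perm_id sum_perm_def fun_eq_iff)

lemma assoc_comp_unit_right:
  assumes "\<sigma> permutes {..<n}"
  shows "assoc_comp \<sigma> (replicate n 1) (replicate n id) = \<sigma>"
proof (rule permutes_eqI_less[OF _ assms])
  let ?ks = "replicate n (1::nat)"
  show "assoc_comp \<sigma> ?ks (replicate n id) permutes {..<n}"
    using assoc_comp_permutes[of \<sigma> ?ks "replicate n id"] assms
    by (simp add: sum_list_replicate permutes_id)
  fix i j assume ij: "i < n" "j < n"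
  then show "assoc_comp \<sigma> ?ks (replicate n id) i < assoc_comp \<sigma> ?ks (replicate n id) j \<longleftrightarrow>
      \<sigma> i < \<sigma> j"
    \<comment> \<open>All blocks have length 1, so position \<open>i\<close> is place 0 of block
      \<open>i\<close>.\<close>
    using assoc_comp_less_iff[of \<sigma> ?ks "replicate n id" i 0 j 0] assms
    by (simp add: sum_list_replicate permutes_id)
qed

text \<open>Both sides count the inputs in front of inner block \<open>j\<close> of outer block
  \<open>i\<close>. This translates positions between the two bracketings in associativity.\<close>

lemma concat_start:
  fixes kss :: "nat list list"
  assumes "i < length kss" "j < length (kss ! i)"
  shows "sum_list (take (sum_list (take i (map length kss)) + j) (concat kss)) =
    sum_list (take i (map sum_list kss)) + sum_list (take j (kss ! i))"
  using assms
proof (induction kss arbitrary: i)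
  case (Cons ks kss)
  show ?case
  proof (cases i)
    case (Suc i')
    then show ?thesis using Cons.IH[of i'] Cons.prems by (simp add: add.assoc)
  qed (use Cons.prems in simp)
qed simp

text \<open>A position is a triple \<open>(i, j, k)\<close> of outer block, inner block and place.
  Both bracketings compare such triples lexicographically, by \<sigma>, then
  \<open>\<sigma>s ! i\<close>, then \<open>\<rho>ss ! i ! j\<close>.\<close>

lemma assoc_comp_assoc:
  fixes kss :: "nat list list"
  assumes \<sigma>: "\<sigma> permutes {..<length kss}"
    and len: "length \<sigma>s = length kss" "map length \<rho>ss = map length kss"
    and \<sigma>s: "\<And>i. i < length kss \<Longrightarrow> \<sigma>s ! i permutes {..<length (kss ! i)}"
    and \<rho>ss: "\<And>i j. i < length kss \<Longrightarrow> j < length (kss ! i) \<Longrightarrow> \<rho>ss ! i ! j permutes {..<kss ! i ! j}"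
  shows "assoc_comp (assoc_comp \<sigma> (map length kss) \<sigma>s) (concat kss) (concat \<rho>ss) =
    assoc_comp \<sigma> (map sum_list kss)
      (map (\<lambda>i. assoc_comp (\<sigma>s ! i) (kss ! i) (\<rho>ss ! i)) [0..<length kss])"
    (is "?L = ?R")
proof (rule permutes_eqI_less)
  let ?n = "sum_list (concat kss)"
  let ?ls = "map length kss" and ?ms = "map sum_list kss"
  let ?q = "\<lambda>i j. sum_list (take i ?ls) + j"
  let ?\<rho>s = "map (\<lambda>i. assoc_comp (\<sigma>s ! i) (kss ! i) (\<rho>ss ! i)) [0..<length kss]"
  have lens: "length \<rho>ss = length kss" "\<And>i. i < length kss \<Longrightarrow> length (\<rho>ss ! i) = length (kss ! i)"
    using len(2) by (metis length_map, metis length_map nth_map)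
  have sum: "sum_list ?ms = ?n" by (induction kss) auto
  have slen: "sum_list ?ls = length (concat kss)" by (simp add: length_concat)
  have inner: "assoc_comp \<sigma> ?ls \<sigma>s permutes {..<length (concat kss)}"
    using assoc_comp_permutes[of \<sigma> ?ls \<sigma>s] \<sigma> len(1) \<sigma>s by (simp add: slen)
  have \<rho>: "concat \<rho>ss ! q permutes {..<concat kss ! q}" if "q < length (concat kss)" for q
  proof -
    obtain i j where ij: "i < length kss" "j < length (kss ! i)" "q = ?q i j"
    proof (rule block_cases[of q ?ls])
      fix i j assume "i < length ?ls" "j < ?ls ! i" "q = ?q i j"
      then show thesis using that[of i j] by simp
    qed (use \<open>q < length (concat kss)\<close> in \<open>simp add: slen\<close>)
    have "concat \<rho>ss ! ?q i j = \<rho>ss ! i ! j"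
      using concat_nth_start[of i \<rho>ss j] ij lens len(2) by simp
    then show ?thesis using \<rho>ss[OF ij(1,2)] concat_nth_start[OF ij(1,2)] ij(3) by simp
  qed
  have clen: "length (concat \<rho>ss) = length (concat kss)" by (simp add: length_concat len(2))
  show "?L permutes {..<?n}"
    using inner clen \<rho> by (intro assoc_comp_permutes) auto
  have outer: "?\<rho>s ! i permutes {..<?ms ! i}" if "i < length kss" for i
    using that lens \<sigma>s \<rho>ss by (auto intro!: assoc_comp_permutes)
  show "?R permutes {..<?n}"
    using assoc_comp_permutes[of \<sigma> ?ms ?\<rho>s] \<sigma> outer by (simp add: sum)
  have rep: "\<exists>i j k. i < length kss \<and> j < length (kss ! i) \<and> k < kss ! i ! j \<and>
      p = sum_list (take i ?ms) + (sum_list (take j (kss ! i)) + k)" if p: "p < ?n" for p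
  proof -
    obtain i l where il: "i < length kss" "l < sum_list (kss ! i)" "p = sum_list (take i ?ms) + l"
      using block_cases[of p ?ms] p by (auto simp: sum)
    then show ?thesis using block_cases[OF il(2)] by metis
  qed
  fix p p' assume "p < ?n" "p' < ?n"
  from rep[OF this(1)] rep[OF this(2)] obtain i j k i' j' k' where
    p: "i < length kss" "j < length (kss ! i)" "k < kss ! i ! j"
      "p = sum_list (take i ?ms) + (sum_list (take j (kss ! i)) + k)" and
    p': "i' < length kss" "j' < length (kss ! i')" "k' < kss ! i' ! j'"
      "p' = sum_list (take i' ?ms) + (sum_list (take j' (kss ! i')) + k')" by blast
  have pos: "?q a b < length (concat kss)" "concat kss ! ?q a b = kss ! a ! b"
      "concat \<rho>ss ! ?q a b = \<rho>ss ! a ! b"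
      "sum_list (take b (kss ! a)) + d < sum_list (kss ! a)"
    if "a < length kss" "b < length (kss ! a)" "d < kss ! a ! b" for a b d
    using that block_pos_start[of a ?ls b] block_pos_start[of b "kss ! a" d]
      concat_nth_start[of a kss b] concat_nth_start[of a \<rho>ss b] lens len(2) slen by auto
  \<comment> \<open>On the left side the pair \<open>(i, j)\<close> is flattened to the single block
    index \<open>?q i j\<close> of \<open>concat kss\<close>.\<close>
  have L: "p = sum_list (take (?q i j) (concat kss)) + k" "p' = sum_list (take (?q i' j') (concat kss)) + k'"
    using concat_start[OF p(1,2)] concat_start[OF p'(1,2)] p(4) p'(4) by simp_all
  have q: "?q i j = ?q i' j' \<longleftrightarrow> i = i' \<and> j = j'"
    using block_eq[of i ?ls j i' j'] p p' by auto
  have "?L p < ?L p' \<longleftrightarrow> assoc_comp \<sigma> ?ls \<sigma>s (?q i j) < assoc_comp \<sigma> ?ls \<sigma>s (?q i' j') \<or>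
      ?q i j = ?q i' j' \<and> (\<rho>ss ! i ! j) k < (\<rho>ss ! i ! j) k'"
    unfolding L using assoc_comp_less_iff[OF inner \<rho>, of "?q i j" k "?q i' j'" k']
      pos[OF p(1-3)] pos[OF p'(1-3)] p(3) p'(3) by simp
  also have "\<dots> \<longleftrightarrow> \<sigma> i < \<sigma> i' \<or> i = i' \<and> (\<sigma>s ! i) j < (\<sigma>s ! i) j' \<or>
      i = i' \<and> j = j' \<and> (\<rho>ss ! i ! j) k < (\<rho>ss ! i ! j) k'"
    using assoc_comp_less_iff[of \<sigma> ?ls \<sigma>s i j i' j'] \<sigma> \<sigma>s p p' unfolding q by auto
  also have "\<dots> \<longleftrightarrow> ?R p < ?R p'"
  proof -
    have "?R p < ?R p' \<longleftrightarrow> \<sigma> i < \<sigma> i' \<or> i = i' \<and>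
        assoc_comp (\<sigma>s ! i) (kss ! i) (\<rho>ss ! i) (sum_list (take j (kss ! i)) + k) <
        assoc_comp (\<sigma>s ! i) (kss ! i) (\<rho>ss ! i) (sum_list (take j' (kss ! i')) + k')"
      unfolding p(4) p'(4)
      using assoc_comp_less_iff[of \<sigma> ?ms ?\<rho>s i _ i' _] \<sigma> outer p(1) p'(1)
        pos(4)[OF p(1-3)] pos(4)[OF p'(1-3)] by simp
    also have "\<dots> \<longleftrightarrow> \<sigma> i < \<sigma> i' \<or> i = i' \<and> ((\<sigma>s ! i) j < (\<sigma>s ! i) j' \<or>
        j = j' \<and> (\<rho>ss ! i ! j) k < (\<rho>ss ! i ! j) k')"
      using assoc_comp_less_iff[of "\<sigma>s ! i" "kss ! i" "\<rho>ss ! i" j k j' k'] \<sigma>s \<rho>ss p p' by auto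
    finally show ?thesis by blast
  qed
  finally show "?L p < ?L p' \<longleftrightarrow> ?R p < ?R p'" .
qed

text \<open>Block \<open>i\<close> of the permuted list is block \<open>\<pi> i\<close> of
  \<open>ks\<close>, and \<open>block_perm\<close> carries the one onto the other. Hence both sides
  compare positions through the pairs \<open>(\<pi> i, j)\<close>.\<close>

lemma assoc_comp_outer:
  assumes \<sigma>: "\<sigma> permutes {..<length ks}" and \<pi>: "\<pi> permutes {..<length ks}"
    and len: "length \<sigma>s = length ks" and \<sigma>s: "\<And>i. i < length ks \<Longrightarrow> \<sigma>s ! i permutes {..<ks ! i}"
  shows "assoc_comp (\<sigma> \<circ> \<pi>) (permute_list \<pi> ks) (permute_list \<pi> \<sigma>s) =
    assoc_comp \<sigma> ks \<sigma>s \<circ> block_perm \<pi> (permute_list \<pi> ks)"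
proof (rule permutes_eqI_less)
  let ?ls = "permute_list \<pi> ks" and ?\<rho>s = "permute_list \<pi> \<sigma>s"
  have sum: "sum_list ?ls = sum_list ks"
    using arg_cong[OF mset_permute_list[OF \<pi>], of sum_mset] by (simp only: sum_mset_sum_list)
  have \<pi>': "\<pi> permutes {..<length \<sigma>s}" "\<pi> permutes {..<length ?ls}" using \<pi> len by simp_all
  have inv_ls: "permute_list (inv \<pi>) ?ls = ks"
    using \<pi> permute_list_compose[of "inv \<pi>" ks \<pi>] by (simp add: permutes_inv permutes_inv_o(1))
  have nth: "\<pi> i < length ks" "?ls ! i = ks ! \<pi> i" "?\<rho>s ! i = \<sigma>s ! \<pi> i" if "i < length ks" for i
    using that permutes_less[OF \<pi> that] len
    by (simp_all add: permute_list_nth[OF \<pi>] permute_list_nth[OF \<pi>'(1)])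
  have \<rho>s: "?\<rho>s ! i permutes {..<?ls ! i}" if "i < length ?ls" for i
    using that nth[of i] \<sigma>s by simp
  have \<sigma>\<pi>: "\<sigma> \<circ> \<pi> permutes {..<length ?ls}" using permutes_compose[OF \<pi> \<sigma>] by simp
  show "assoc_comp (\<sigma> \<circ> \<pi>) ?ls ?\<rho>s permutes {..<sum_list ks}"
    using assoc_comp_permutes[OF \<sigma>\<pi> _ \<rho>s] len by (simp add: sum)
  show "assoc_comp \<sigma> ks \<sigma>s \<circ> block_perm \<pi> ?ls permutes {..<sum_list ks}"
    using block_perm_permutes[OF \<pi>'(2)] assoc_comp_permutes[OF \<sigma> len \<sigma>s]
    by (intro permutes_compose) (simp_all add: sum)
  fix p p' assume "p < sum_list ks" "p' < sum_list ks"
  then have "p < sum_list ?ls" "p' < sum_list ?ls" by (simp_all add: sum)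
  then obtain i j i' j' where p: "i < length ?ls" "j < ?ls ! i" "p = sum_list (take i ?ls) + j"
    and p': "i' < length ?ls" "j' < ?ls ! i'" "p' = sum_list (take i' ?ls) + j'"
    using block_cases by metis
  have "\<pi> i = \<pi> i' \<longleftrightarrow> i = i'" using permutes_inj[OF \<pi>] by (auto dest: injD)
  then show "assoc_comp (\<sigma> \<circ> \<pi>) ?ls ?\<rho>s p < assoc_comp (\<sigma> \<circ> \<pi>) ?ls ?\<rho>s p' \<longleftrightarrow>
      (assoc_comp \<sigma> ks \<sigma>s \<circ> block_perm \<pi> ?ls) p < (assoc_comp \<sigma> ks \<sigma>s \<circ> block_perm \<pi> ?ls) p'"
    using assoc_comp_less_iff[OF \<sigma>\<pi> \<rho>s p(1,2) p'(1,2)] p p' nth[of i] nth[of i']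
      assoc_comp_less_iff[OF \<sigma> \<sigma>s, of "\<pi> i" j "\<pi> i'" j']
    by (simp add: block_perm_start[OF \<pi>'(2)] inv_ls)
qed

lemma sum_perm_compose:
  assumes len: "length \<sigma>s = length ks" "length \<rho>s = length ks"
    and \<rho>s: "\<And>i. i < length ks \<Longrightarrow> \<rho>s ! i permutes {..<ks ! i}"
  shows "sum_perm ks (map2 (\<circ>) \<sigma>s \<rho>s) = sum_perm ks \<sigma>s \<circ> sum_perm ks \<rho>s"
proof
  fix p
  show "sum_perm ks (map2 (\<circ>) \<sigma>s \<rho>s) p = (sum_perm ks \<sigma>s \<circ> sum_perm ks \<rho>s) p"
  proof (cases "p < sum_list ks")
    case True
    then obtain i j where ij: "i < length ks" "j < ks ! i" "p = sum_list (take i ks) + j"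
      using block_cases by blast
    have "(\<rho>s ! i) j < ks ! i" by (rule permutes_less[OF \<rho>s[OF ij(1)] ij(2)])
    then show ?thesis using ij len by (simp add: sum_perm_start)
  qed (simp add: sum_perm_def)
qed

lemma sum_perm_Cons:
  "sum_perm (k # ks) (\<sigma> # \<sigma>s) p = (if p < k then \<sigma> p else k + sum_perm ks \<sigma>s (p - k))"
  by (auto simp: sum_perm_def split: prod.splits)

lemma sum_perm_id: "sum_perm ks (replicate (length ks) id) = id"
  by (induction ks) (auto simp: fun_eq_iff sum_perm_Cons, simp add: sum_perm_def)

text \<open>This permutation arises when a swapped pair is plugged into slot \<open>j\<close> and
  units into all other slots. Each further block of length 1 in front shifts the transposition by
  one position.\<close>

lemma sum_perm_adjacent_transp:
  "sum_perm (replicate j 1 @ 2 # replicate m 1)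
     (replicate j id @ transpose 0 1 # replicate m id) = transpose j (Suc j)"
proof (induction j)
  case 0
  show ?case
    using fun_cong[OF sum_perm_id[of "replicate m 1"]]
    by (auto simp: fun_eq_iff sum_perm_Cons id_def transpose_def)
next
  case (Suc j)
  then show ?case
    by (auto simp: fun_eq_iff sum_perm_Cons transpose_def)
qed

section \<open>Operad morphisms and quotients by congruences\<close>

lemma operad_hom_compose:
  assumes "operad_hom Col P Q f" "operad_hom Col Q S g"
  shows "operad_hom Col P S (\<lambda>t c x. g t c (f t c x))"
proof -
  interpret f: operad_hom Col P Q f by (rule assms)
  interpret g: operad_hom Col Q S g by (rule assms)
  have f: "f t c x \<in> opset Q t c" if "t \<in> Col" "c \<in> lists Col" "x \<in> opset P t c" for t c x
    using f.hom_closed that by (simp add: seq_hom_def)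
  show ?thesis
  proof
    show "seq_hom Col (opset P) (opset S) (\<lambda>t c x. g t c (f t c x))"
      using f.hom_closed g.hom_closed by (simp add: seq_hom_def)
  next
    fix t c bs x ys
    assume t: "t \<in> Col" and c: "c \<in> lists Col" and bs: "bs \<in> lists (lists Col)"
      and x: "x \<in> opset P t c" and ys: "inputs (opset P) c bs ys"
    have "inputs (opset Q) c bs (map (\<lambda>i. f (c ! i) (bs ! i) (ys ! i)) [0..<length c])"
      using ys c bs by (auto simp: inputs_def in_lists_conv_set intro!: f)
    then show "g t (concat bs) (f t (concat bs) (opcomp P t c bs x ys)) =
        opcomp S t c bs (g t c (f t c x))
          (map (\<lambda>i. g (c ! i) (bs ! i) (f (c ! i) (bs ! i) (ys ! i))) [0..<length c])"
      using f[OF t c x] t c bs x ys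
      by (simp add: f.hom_comp g.hom_comp cong: list.map_cong_simp)
  qed (simp_all add: f f.hom_act g.hom_act f.hom_unit g.hom_unit)
qed

section \<open>Quotient of an operad by a congruence\<close>

context
  fixes Col :: "'o set" and P :: "('o, 'p) operad" and E :: "'o \<Rightarrow> 'o list \<Rightarrow> ('p \<times> 'p) set"
  assumes P: "colored_operad Col P" and E: "operad_congruence Col P E"
begin

interpretation P: colored_operad Col P by (rule P)

lemma equiv_congruence: "t \<in> Col \<Longrightarrow> c \<in> lists Col \<Longrightarrow> equiv (opset P t c) (E t c)"
  using E by (simp add: operad_congruence_def)

lemma quot_map_eq_iff:
  assumes "t \<in> Col" "c \<in> lists Col" "x \<in> opset P t c" "y \<in> opset P t c"
  shows "quot_map E t c x = quot_map E t c y \<longleftrightarrow> (x, y) \<in> E t c"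
  using eq_equiv_class_iff[OF equiv_congruence[OF assms(1,2)] assms(3,4)] by (simp add: quot_map_def)

lemma mem_quot_map:
  assumes "t \<in> Col" "c \<in> lists Col" "x \<in> opset P t c"
  shows "y \<in> quot_map E t c x \<longleftrightarrow> y \<in> opset P t c \<and> quot_map E t c y = quot_map E t c x"
proof -
  have "y \<in> quot_map E t c x \<longleftrightarrow> (x, y) \<in> E t c" by (simp add: quot_map_def)
  moreover have "(x, y) \<in> E t c \<Longrightarrow> y \<in> opset P t c"
    using equiv_congruence[OF assms(1,2)] by (auto simp: equiv_def refl_on_def)
  ultimately show ?thesis using quot_map_eq_iff[OF assms(1,2,3)] by metis
qed

lemma opset_quot: "opset (quot_operad P E) t c = quot_map E t c ` opset P t c"
  by (auto simp: quot_operad_def quotient_def quot_map_def)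

lemma opunit_quot: "opunit (quot_operad P E) t = quot_map E t [t] (opunit P t)"
  by (simp add: quot_operad_def quot_map_def)

text \<open>The definition unites the classes obtained from all representatives. The congruence
  makes these classes equal, and \<open>x\<close> itself shows that the union is not over the empty
  set.\<close>

lemma opact_quot:
  assumes t: "t \<in> Col" and c: "c \<in> lists Col" and x: "x \<in> opset P t c"
    and \<sigma>: "\<sigma> permutes {..<length c}"
  shows "opact (quot_operad P E) t c \<sigma> (quot_map E t c x) =
    quot_map E t (permute_list \<sigma> c) (opact P t c \<sigma> x)"
proof -
  have c': "permute_list \<sigma> c \<in> lists Col" using c \<sigma> by (simp add: in_lists_conv_set)
  have "quot_map E t (permute_list \<sigma> c) (opact P t c \<sigma> y) =
      quot_map E t (permute_list \<sigma> c) (opact P t c \<sigma> x)" if "y \<in> quot_map E t c x" for y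
  proof -
    have y: "y \<in> opset P t c" "(y, x) \<in> E t c"
      using that mem_quot_map[OF t c x] quot_map_eq_iff[OF t c _ x] by auto
    have "(opact P t c \<sigma> y, opact P t c \<sigma> x) \<in> E t (permute_list \<sigma> c)"
      using E t c \<sigma> y(2) unfolding operad_congruence_def by blast
    then show ?thesis
      using quot_map_eq_iff[OF t c'] P.act_closed[OF t c _ \<sigma>] x y(1) by blast
  qed
  moreover have "x \<in> quot_map E t c x" by (simp add: mem_quot_map t c x)
  ultimately have "(\<Union>y\<in>quot_map E t c x. quot_map E t (permute_list \<sigma> c) (opact P t c \<sigma> y)) =
      quot_map E t (permute_list \<sigma> c) (opact P t c \<sigma> x)"
    by (intro SUP_eq_const) blast+
  then show ?thesis by (simp add: quot_operad_def quot_map_def)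
qed

text \<open>The colors vary from entry to entry and \<open>quot_map\<close> takes them as arguments,
  so the classes are formed index by index instead of by one \<open>map\<close> over
  \<open>ys\<close>.\<close>

definition quot_maps :: "'o list \<Rightarrow> 'o list list \<Rightarrow> 'p list \<Rightarrow> 'p set list" where
  "quot_maps c bs ys = map (\<lambda>i. quot_map E (c ! i) (bs ! i) (ys ! i)) [0..<length c]"

lemma length_quot_maps [simp]: "length (quot_maps c bs ys) = length c"
  by (simp add: quot_maps_def)

lemma nth_quot_maps [simp]:
  "i < length c \<Longrightarrow> quot_maps c bs ys ! i = quot_map E (c ! i) (bs ! i) (ys ! i)"
  by (simp add: quot_maps_def)

lemma opcomp_quot:
  assumes t: "t \<in> Col" and c: "c \<in> lists Col" and bs: "bs \<in> lists (lists Col)"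
    and x: "x \<in> opset P t c" and ys: "inputs (opset P) c bs ys"
  shows "opcomp (quot_operad P E) t c bs (quot_map E t c x) (quot_maps c bs ys) =
    quot_map E t (concat bs) (opcomp P t c bs x ys)"
proof -
  have bs': "concat bs \<in> lists Col" using bs by (auto simp: in_lists_conv_set)
  have len: "length bs = length c" "length ys = length c" using ys by (auto simp: inputs_def)
  have nth: "c ! i \<in> Col" "bs ! i \<in> lists Col" "ys ! i \<in> opset P (c ! i) (bs ! i)"
    if "i < length c" for i
    using that c bs ys len by (auto simp: inputs_def in_lists_conv_set)
  have "quot_map E t (concat bs) (opcomp P t c bs x' ys') =
      quot_map E t (concat bs) (opcomp P t c bs x ys)"
    if x': "x' \<in> quot_map E t c x" and ys': "ys' \<in> listset (quot_maps c bs ys)" for x' ys'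
  proof -
    have x': "x' \<in> opset P t c" "(x', x) \<in> E t c"
      using x' mem_quot_map[OF t c x] quot_map_eq_iff[OF t c _ x] by auto
    have ys': "length ys' = length c" "\<And>i. i < length c \<Longrightarrow> ys' ! i \<in> quot_map E (c ! i) (bs ! i) (ys ! i)"
      using ys' by (auto simp: in_listset_iff list_all2_conv_all_nth)
    have ysi: "ys' ! i \<in> opset P (c ! i) (bs ! i)" "(ys' ! i, ys ! i) \<in> E (c ! i) (bs ! i)"
      if "i < length c" for i
      using ys'(2)[OF that] mem_quot_map[OF nth[OF that]] quot_map_eq_iff[OF nth(1,2)[OF that]]
        nth(3)[OF that] by auto
    have in': "inputs (opset P) c bs ys'" using len ys'(1) ysi by (simp add: inputs_def)
    have "(opcomp P t c bs x' ys', opcomp P t c bs x ys) \<in> E t (concat bs)"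
      using E t c bs x'(2) in' ys ysi(2) unfolding operad_congruence_def by blast
    then show ?thesis
      using quot_map_eq_iff[OF t bs'] P.comp_closed[OF t c bs] x ys x'(1) in' by blast
  qed
  moreover have "x \<in> quot_map E t c x" by (simp add: mem_quot_map t c x)
  \<comment> \<open>The inner union is nonempty as well, so the double union of equal classes is
    that class.\<close>
  moreover have "ys \<in> listset (quot_maps c bs ys)"
    using len by (simp add: in_listset_iff list_all2_conv_all_nth mem_quot_map nth)
  ultimately have "(\<Union>x'\<in>quot_map E t c x. \<Union>ys'\<in>listset (quot_maps c bs ys).
      quot_map E t (concat bs) (opcomp P t c bs x' ys')) =
      quot_map E t (concat bs) (opcomp P t c bs x ys)"
    by (intro SUP_eq_const) blast+
  then show ?thesis by (simp add: quot_operad_def quot_map_def)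
qed

lemma inputs_quot:
  assumes "inputs (opset (quot_operad P E)) c bs As"
  obtains ys where "inputs (opset P) c bs ys" "As = quot_maps c bs ys"
proof -
  have "\<exists>y. As ! i = quot_map E (c ! i) (bs ! i) y \<and> y \<in> opset P (c ! i) (bs ! i)"
    if "i < length c" for i
    using assms that by (auto simp: inputs_def opset_quot)
  then obtain f where "\<And>i. i < length c \<Longrightarrow>
      As ! i = quot_map E (c ! i) (bs ! i) (f i) \<and> f i \<in> opset P (c ! i) (bs ! i)" by metis
  then show ?thesis
    using assms by (intro that[of "map f [0..<length c]"])
      (auto simp: inputs_def intro!: nth_equalityI)
qed

text \<open>Every operation of the quotient is the class of an operation of \<open>P\<close>, and
  the structure maps can be computed on representatives, so each axiom is the image of the same
  axiom of \<open>P\<close>. The work lies in showing that permuted, acted-on and concatenated lists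
  of representatives are again valid inputs.\<close>

theorem colored_operad_quot: "colored_operad Col (quot_operad P E)"
proof
  let ?Q = "quot_operad P E"
  fix t assume t: "t \<in> Col"
  show "opunit ?Q t \<in> opset ?Q t [t]"
    by (simp add: opunit_quot opset_quot P.unit_closed t)
  fix c A assume c: "c \<in> lists Col" and "A \<in> opset ?Q t c"
  from this(2) obtain x where x: "x \<in> opset P t c" and A: "A = quot_map E t c x"
    by (auto simp: opset_quot)
  show "opact ?Q t c id A = A"
    by (simp add: A opact_quot t c x permutes_id P.act_id)
  have "inputs (opset P) [t] [c] [x]" by (simp add: inputs_def x)
  moreover have "quot_maps [t] [c] [x] = [A]" by (simp add: quot_maps_def A)
  ultimately show "opcomp ?Q t [t] [c] (opunit ?Q t) [A] = A"
    using opcomp_quot[of t "[t]" "[c]" "opunit P t" "[x]"] t c x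
    by (simp add: opunit_quot P.unit_closed P.unit_left A)
  have "map (opunit ?Q) c = quot_maps c (map (\<lambda>a. [a]) c) (map (opunit P) c)"
    by (auto simp: opunit_quot intro!: nth_equalityI)
  moreover have "inputs (opset P) c (map (\<lambda>a. [a]) c) (map (opunit P) c)"
    using c P.unit_closed by (auto simp: inputs_def in_lists_conv_set)
  moreover have "map (\<lambda>a. [a]) c \<in> lists (lists Col)" using c by (auto simp: in_lists_conv_set)
  ultimately show "opcomp ?Q t c (map (\<lambda>a. [a]) c) A (map (opunit ?Q) c) = A"
    using opcomp_quot[of t c "map (\<lambda>a. [a]) c" x "map (opunit P) c"] t c x
    by (simp add: P.unit_right A)
  fix \<sigma> assume \<sigma>: "\<sigma> permutes {..<length c}"
  show "opact ?Q t c \<sigma> A \<in> opset ?Q t (permute_list \<sigma> c)"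
    by (simp add: A opact_quot t c x \<sigma> opset_quot P.act_closed)
  fix \<sigma>' assume \<sigma>': "\<sigma>' permutes {..<length c}"
  have "permute_list \<sigma> c \<in> lists Col" using c \<sigma> by (simp add: in_lists_conv_set)
  then show "opact ?Q t (permute_list \<sigma> c) \<sigma>' (opact ?Q t c \<sigma> A) = opact ?Q t c (\<sigma> \<circ> \<sigma>') A"
    using t c x \<sigma> \<sigma>'
    by (simp add: A opact_quot P.act_closed P.act_act permutes_compose permute_list_compose)
next
  let ?Q = "quot_operad P E"
  fix t c bs A As
  assume t: "t \<in> Col" and c: "c \<in> lists Col" and bs: "bs \<in> lists (lists Col)"
    and "A \<in> opset ?Q t c" and As: "inputs (opset ?Q) c bs As"
  from this(4) obtain x where x: "x \<in> opset P t c" and A: "A = quot_map E t c x"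
    by (auto simp: opset_quot)
  from As obtain ys where ys: "inputs (opset P) c bs ys" and As: "As = quot_maps c bs ys"
    by (rule inputs_quot)
  have len: "length bs = length c" "length ys = length c" using ys by (auto simp: inputs_def)
  have nth: "c ! i \<in> Col" "bs ! i \<in> lists Col" "ys ! i \<in> opset P (c ! i) (bs ! i)"
    if "i < length c" for i
    using that c bs ys len by (auto simp: inputs_def in_lists_conv_set)
  have bs': "concat bs \<in> lists Col" using bs by (auto simp: in_lists_conv_set)
  have comp: "opcomp ?Q t c bs A As = quot_map E t (concat bs) (opcomp P t c bs x ys)"
    unfolding A As by (rule opcomp_quot[OF t c bs x ys])
  have comp_in: "opcomp P t c bs x ys \<in> opset P t (concat bs)" by (rule P.comp_closed[OF t c bs x ys])
  show "opcomp ?Q t c bs A As \<in> opset ?Q t (concat bs)"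
    using comp_in by (simp add: comp opset_quot)
  {
    fix \<sigma> assume \<sigma>: "\<sigma> permutes {..<length c}"
    have \<sigma>': "\<sigma> permutes {..<length bs}" "\<sigma> permutes {..<length ys}"
      "\<sigma> permutes {..<length (quot_maps c bs ys)}" using \<sigma> len by simp_all
    have \<sigma>_less: "\<sigma> i < length c" if "i < length c" for i
      using permutes_in_image[OF \<sigma>, of i] that by simp
    note pnth = permute_list_nth[OF \<sigma>] permute_list_nth[OF \<sigma>'(1)] permute_list_nth[OF \<sigma>'(2)]
      permute_list_nth[OF \<sigma>'(3)]
    have colors: "permute_list \<sigma> c \<in> lists Col" "permute_list \<sigma> bs \<in> lists (lists Col)"
      using c bs \<sigma> \<sigma>' by (simp_all add: in_lists_conv_set)
    have "permute_list \<sigma> (quot_maps c bs ys) =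
        quot_maps (permute_list \<sigma> c) (permute_list \<sigma> bs) (permute_list \<sigma> ys)"
      using len \<sigma>_less by (auto intro!: nth_equalityI simp: pnth)
    moreover have "inputs (opset P) (permute_list \<sigma> c) (permute_list \<sigma> bs) (permute_list \<sigma> ys)"
      using ys len \<sigma>_less by (simp add: inputs_def pnth)
    moreover have "block_perm \<sigma> (map length (permute_list \<sigma> bs)) permutes {..<length (concat bs)}"
    proof -
      have "length (concat (permute_list \<sigma> bs)) = length (concat bs)"
        using arg_cong[OF permute_list_block_perm[OF \<sigma>'(1)], of length] by simp
      then show ?thesis
        using block_perm_permutes[of \<sigma> "map length (permute_list \<sigma> bs)"] \<sigma>'(1)
        by (simp add: length_concat)
    qed
    ultimately show "opcomp ?Q t (permute_list \<sigma> c) (permute_list \<sigma> bs) (opact ?Q t c \<sigma> A)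
        (permute_list \<sigma> As) =
      opact ?Q t (concat bs) (block_perm \<sigma> (map length (permute_list \<sigma> bs)))
        (opcomp ?Q t c bs A As)"
      unfolding comp unfolding A As using t c bs bs' x ys \<sigma> comp_in colors
      by (simp add: opact_quot opcomp_quot P.act_closed P.comp_act_outer
          permute_list_block_perm[OF \<sigma>'(1)])
  }
  {
    fix \<sigma>s :: "(nat \<Rightarrow> nat) list"
    assume \<sigma>s: "length \<sigma>s = length c" "\<And>i. i < length c \<Longrightarrow> \<sigma>s ! i permutes {..<length (bs ! i)}"
    let ?bs = "map2 permute_list \<sigma>s bs"
    let ?ys = "map (\<lambda>i. opact P (c ! i) (bs ! i) (\<sigma>s ! i) (ys ! i)) [0..<length c]"
    have "map (\<lambda>i. opact ?Q (c ! i) (bs ! i) (\<sigma>s ! i) (As ! i)) [0..<length c] = quot_maps c ?bs ?ys"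
      using \<sigma>s len nth by (auto intro!: nth_equalityI simp: As opact_quot)
    moreover have "inputs (opset P) c ?bs ?ys"
      using \<sigma>s len nth by (auto simp: inputs_def P.act_closed)
    moreover have "?bs \<in> lists (lists Col)"
      using \<sigma>s len nth by (auto simp: in_lists_conv_set set_zip)
    moreover have "permute_list (sum_perm (map length bs) \<sigma>s) (concat bs) = concat ?bs"
      using \<sigma>s len by (intro permute_list_sum_perm) auto
    moreover have "sum_perm (map length bs) \<sigma>s permutes {..<length (concat bs)}"
      using sum_perm_permutes[of \<sigma>s "map length bs"] \<sigma>s len by (simp add: length_concat)
    ultimately show "opcomp ?Q t c ?bs A
        (map (\<lambda>i. opact ?Q (c ! i) (bs ! i) (\<sigma>s ! i) (As ! i)) [0..<length c]) =
      opact ?Q t (concat bs) (sum_perm (map length bs) \<sigma>s) (opcomp ?Q t c bs A As)"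
      using P.comp_act_inner[OF t c bs x ys \<sigma>s] opcomp_quot[OF t c _ x, of ?bs ?ys]
        opact_quot[OF t bs' comp_in, of "sum_perm (map length bs) \<sigma>s"]
      unfolding comp unfolding A by simp
  }
  {
    fix as Cs
    assume as: "as \<in> lists (lists (lists Col))"
      and len': "length as = length c" "length Cs = length c"
      and Cs: "\<And>i. i < length c \<Longrightarrow> inputs (opset ?Q) (bs ! i) (as ! i) (Cs ! i)"
    have "\<exists>zs. inputs (opset P) (bs ! i) (as ! i) zs \<and> Cs ! i = quot_maps (bs ! i) (as ! i) zs"
      if "i < length c" for i
      using Cs[OF that] by (rule inputs_quot) blast
    then obtain f where f: "\<And>i. i < length c \<Longrightarrow> inputs (opset P) (bs ! i) (as ! i) (f i) \<and>
        Cs ! i = quot_maps (bs ! i) (as ! i) (f i)" by metis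
    define zs where "zs = map f [0..<length c]"
    have zs: "length zs = length c"
      "\<And>i. i < length c \<Longrightarrow> inputs (opset P) (bs ! i) (as ! i) (zs ! i)"
      "\<And>i. i < length c \<Longrightarrow> Cs ! i = quot_maps (bs ! i) (as ! i) (zs ! i)"
      using f by (simp_all add: zs_def)
    have lens: "map length as = map length bs" "map length zs = map length bs"
      "map length Cs = map length bs"
      using zs len len' by (auto intro!: nth_equalityI simp: inputs_def)
    \<comment> \<open>To compute the composite on the flattened lists by representatives, the
      flattened representatives must be inputs and their classes must form \<open>concat Cs\<close>.
      Both are checked position by position in block coordinates.\<close>
    have in_concat: "inputs (opset P) (concat bs) (concat as) (concat zs)"
      unfolding inputs_def
    proof (intro conjI allI impI)
      fix p assume p: "p < length (concat bs)"
      then obtain i j where ij: "i < length bs" "j < length (bs ! i)"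
        "p = sum_list (take i (map length bs)) + j"
        using block_cases[of p "map length bs"] by (auto simp: length_concat)
      then have "length (as ! i) = length (bs ! i)" "length (zs ! i) = length (bs ! i)"
        using lens[THEN arg_cong, of "\<lambda>l. l ! i"] len len' zs(1) by auto
      then show "concat zs ! p \<in> opset P (concat bs ! p) (concat as ! p)"
        using zs(2)[of i] ij len len' zs(1) lens concat_nth_start[of i bs j]
          concat_nth_start[of i as j] concat_nth_start[of i zs j] by (simp add: inputs_def)
    qed (simp_all add: length_concat lens)
    have "concat Cs = quot_maps (concat bs) (concat as) (concat zs)"
    proof (rule nth_equalityI)
      fix p assume "p < length (concat Cs)"
      then have p: "p < length (concat bs)" by (simp add: length_concat lens)
      then obtain i j where ij: "i < length bs" "j < length (bs ! i)"
        "p = sum_list (take i (map length bs)) + j"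
        using block_cases[of p "map length bs"] by (auto simp: length_concat)
      then have "length (as ! i) = length (bs ! i)" "length (zs ! i) = length (bs ! i)"
          "length (Cs ! i) = length (bs ! i)"
        using lens[THEN arg_cong, of "\<lambda>l. l ! i"] len len' zs(1) by auto
      then show "concat Cs ! p = quot_maps (concat bs) (concat as) (concat zs) ! p"
        using zs(3)[of i] ij len len' zs(1) lens p concat_nth_start[of i bs j]
          concat_nth_start[of i as j] concat_nth_start[of i zs j] concat_nth_start[of i Cs j]
        by simp
    qed (simp add: length_concat lens)
    moreover have as': "concat as \<in> lists (lists Col)" "map concat as \<in> lists (lists Col)"
      using as by (auto simp: in_lists_conv_set)
    ultimately have L: "opcomp ?Q t (concat bs) (concat as) (opcomp ?Q t c bs A As) (concat Cs) =
        quot_map E t (concat (concat as))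
          (opcomp P t (concat bs) (concat as) (opcomp P t c bs x ys) (concat zs))"
      unfolding comp by (simp add: opcomp_quot t bs' comp_in in_concat)
    let ?ws = "map (\<lambda>i. opcomp P (c ! i) (bs ! i) (as ! i) (ys ! i) (zs ! i)) [0..<length c]"
    have asi: "as ! i \<in> lists (lists Col)" if "i < length c" for i
      using as that len' by (metis in_lists_conv_set nth_mem)
    have "map (\<lambda>i. opcomp ?Q (c ! i) (bs ! i) (as ! i) (As ! i) (Cs ! i)) [0..<length c] =
        quot_maps c (map concat as) ?ws"
      by (rule nth_equalityI) (simp_all add: As opcomp_quot nth asi zs len len')
    moreover have "inputs (opset P) c (map concat as) ?ws"
      unfolding inputs_def by (simp add: P.comp_closed nth asi zs len len')
    ultimately have "opcomp ?Q t c (map concat as) A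
        (map (\<lambda>i. opcomp ?Q (c ! i) (bs ! i) (as ! i) (As ! i) (Cs ! i)) [0..<length c]) =
        quot_map E t (concat (map concat as)) (opcomp P t c (map concat as) x ?ws)"
      unfolding A using opcomp_quot[OF t c as'(2) x] by simp
    then show "opcomp ?Q t (concat bs) (concat as) (opcomp ?Q t c bs A As) (concat Cs) =
      opcomp ?Q t c (map concat as) A
        (map (\<lambda>i. opcomp ?Q (c ! i) (bs ! i) (as ! i) (As ! i) (Cs ! i)) [0..<length c])"
      using L P.comp_assoc[OF t c bs as x ys len'(1) zs(1,2)] by (simp add: concat_map_concat)
  }
qed

lemma quot_map_hom: "operad_hom Col P (quot_operad P E) (quot_map E)"
proof (intro operad_hom.intro operad_hom_axioms.intro P colored_operad_quot)
  fix t c bs x ys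
  assume "t \<in> Col" "c \<in> lists Col" "bs \<in> lists (lists Col)" "x \<in> opset P t c"
    "inputs (opset P) c bs ys"
  then show "quot_map E t (concat bs) (opcomp P t c bs x ys) =
      opcomp (quot_operad P E) t c bs (quot_map E t c x)
        (map (\<lambda>i. quot_map E (c ! i) (bs ! i) (ys ! i)) [0..<length c])"
    by (simp add: opcomp_quot quot_maps_def[symmetric])
qed (simp_all add: seq_hom_def opset_quot opact_quot opunit_quot)

lemma quot_factor:
  assumes h: "operad_hom Col P Z h"
    and resp: "\<And>t c x y. t \<in> Col \<Longrightarrow> c \<in> lists Col \<Longrightarrow> (x, y) \<in> E t c \<Longrightarrow> h t c x = h t c y"
  shows "\<exists>u. operad_hom Col (quot_operad P E) Z u \<and>
    seq_hom_eq Col (opset P) (\<lambda>t c x. u t c (quot_map E t c x)) h"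
proof -
  interpret h: operad_hom Col P Z h by (rule h)
  \<comment> \<open>The common value of \<open>h\<close> on a class: \<open>resp\<close> makes the
    image a singleton.\<close>
  define u where "u t c A = the_elem (h t c ` A)" for t c A
  have u: "u t c (quot_map E t c x) = h t c x"
    if "t \<in> Col" "c \<in> lists Col" "x \<in> opset P t c" for t c x
  proof -
    have "h t c y = h t c x" if "y \<in> quot_map E t c x" for y
      using resp[of t c x y] that \<open>t \<in> Col\<close> \<open>c \<in> lists Col\<close> by (simp add: quot_map_def)
    moreover have "x \<in> quot_map E t c x" using that by (simp add: mem_quot_map)
    ultimately have "h t c ` quot_map E t c x = {h t c x}" by blast
    then show ?thesis by (simp add: u_def)
  qed
  have "operad_hom Col (quot_operad P E) Z u"
  proof (intro operad_hom.intro operad_hom_axioms.intro colored_operad_quot h.cod.colored_operad_axioms)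
    show "seq_hom Col (opset (quot_operad P E)) (opset Z) u"
      using h.hom_closed by (auto simp: seq_hom_def opset_quot u)
    fix t assume t: "t \<in> Col"
    then show "u t [t] (opunit (quot_operad P E) t) = opunit Z t"
      by (simp add: opunit_quot u P.unit_closed h.hom_unit)
    fix c A assume c: "c \<in> lists Col" and "A \<in> opset (quot_operad P E) t c"
    from this(2) obtain x where x: "x \<in> opset P t c" and A: "A = quot_map E t c x"
      by (auto simp: opset_quot)
    show "u t (permute_list \<sigma> c) (opact (quot_operad P E) t c \<sigma> A) = opact Z t c \<sigma> (u t c A)"
      if \<sigma>: "\<sigma> permutes {..<length c}" for \<sigma>
    proof -
      have "permute_list \<sigma> c \<in> lists Col" using c \<sigma> by (simp add: in_lists_conv_set)
      then show ?thesis using t c x \<sigma> by (simp add: A opact_quot u P.act_closed h.hom_act)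
    qed
    fix bs Bs assume bs: "bs \<in> lists (lists Col)" and "inputs (opset (quot_operad P E)) c bs Bs"
    from this(2) obtain ys where ys: "inputs (opset P) c bs ys" and Bs: "Bs = quot_maps c bs ys"
      by (rule inputs_quot)
    have bs': "concat bs \<in> lists Col" using bs by (auto simp: in_lists_conv_set)
    have "c ! i \<in> Col" "bs ! i \<in> lists Col" "ys ! i \<in> opset P (c ! i) (bs ! i)"
      if "i < length c" for i
      using that c bs ys by (auto simp: inputs_def in_lists_conv_set)
    then have eq: "map (\<lambda>i. u (c ! i) (bs ! i) (Bs ! i)) [0..<length c] =
        map (\<lambda>i. h (c ! i) (bs ! i) (ys ! i)) [0..<length c]"
      by (simp add: Bs u)
    show "u t (concat bs) (opcomp (quot_operad P E) t c bs A Bs) =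
        opcomp Z t c bs (u t c A) (map (\<lambda>i. u (c ! i) (bs ! i) (Bs ! i)) [0..<length c])"
      unfolding eq using t c bs bs' x ys by (simp add: A Bs opcomp_quot u P.comp_closed h.hom_comp)
  qed
  then show ?thesis using u by (intro exI[of _ u]) (simp add: seq_hom_eq_def)
qed

text \<open>A morphism constant on classes factors through the quotient, and the factor is unique
  because every operation of the quotient is a class \<open>quot_map E t c x\<close>. For a concrete
  pair only \<open>coeq\<close> and \<open>resp\<close> depend on how \<open>E\<close> relates to
  \<open>r\<close> and \<open>s\<close>.\<close>

lemma quot_coequalizer:
  assumes r: "operad_hom Col F P r" and s: "operad_hom Col F P s"
    and coeq: "seq_hom_eq Col (opset F) (\<lambda>t c x. quot_map E t c (r t c x)) (\<lambda>t c x. quot_map E t c (s t c x))"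
    and resp: "\<And>(Z :: ('o, 'z) operad) h t c x y. operad_hom Col P Z h \<Longrightarrow>
      seq_hom_eq Col (opset F) (\<lambda>t c x. h t c (r t c x)) (\<lambda>t c x. h t c (s t c x)) \<Longrightarrow>
      t \<in> Col \<Longrightarrow> c \<in> lists Col \<Longrightarrow> (x, y) \<in> E t c \<Longrightarrow> h t c x = h t c y"
  shows "is_coequalizer TYPE('z) Col F P r s (quot_operad P E) (quot_map E)"
  unfolding is_coequalizer_def
proof (intro conjI r s quot_map_hom coeq allI impI, elim conjE)
  fix Z :: "('o, 'z) operad" and h
  assume h: "operad_hom Col P Z h"
    "seq_hom_eq Col (opset F) (\<lambda>t c x. h t c (r t c x)) (\<lambda>t c x. h t c (s t c x))"
  obtain u where u: "operad_hom Col (quot_operad P E) Z u"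
    "seq_hom_eq Col (opset P) (\<lambda>t c x. u t c (quot_map E t c x)) h"
    using quot_factor[OF h(1) resp[OF h]] by blast
  then show "\<exists>u. operad_hom Col (quot_operad P E) Z u \<and>
      seq_hom_eq Col (opset P) (\<lambda>t c x. u t c (quot_map E t c x)) h \<and>
      (\<forall>u'. operad_hom Col (quot_operad P E) Z u' \<and>
        seq_hom_eq Col (opset P) (\<lambda>t c x. u' t c (quot_map E t c x)) h \<longrightarrow>
        seq_hom_eq Col (opset (quot_operad P E)) u' u)"
    by (intro exI[of _ u]) (auto simp: seq_hom_eq_def opset_quot)
qed

end

section \<open>The operad of a category\<close>

lemma opset_cat:
  "x \<in> opset (cat_operad C) t c \<longleftrightarrow> fst x permutes {..<length c} \<and> length (snd x) = length c \<and>
     (\<forall>i<length c. snd x ! i \<in> hom_set C (c ! i) t)"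
  by (cases x) (simp add: cat_operad_def)

lemma opact_cat: "opact (cat_operad C) t c \<sigma> x = (fst x \<circ> \<sigma>, permute_list \<sigma> (snd x))"
  by (cases x) (simp add: cat_operad_def)

lemma opunit_cat: "opunit (cat_operad C) t = (id, [Ide C t])"
  by (simp add: cat_operad_def)

text \<open>The morphism component of a composite, kept apart from the permutation component so that
  every operad law splits into one about permutations and one about lists.\<close>

definition cmp_lists :: "('o, 'm) category \<Rightarrow> 'm list \<Rightarrow> 'm list list \<Rightarrow> 'm list" where
  "cmp_lists C fs gss = concat (map2 (\<lambda>f. map (Cmp C f)) fs gss)"

lemma opcomp_cat:
  "opcomp (cat_operad C) t c bs x ys =
   (assoc_comp (fst x) (map length bs) (map fst ys), cmp_lists C (snd x) (map snd ys))"
  by (cases x) (simp add: cat_operad_def cmp_lists_def zip_map2 comp_def case_prod_unfold)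

lemma map_length_cmp:
  "length gss = length fs \<Longrightarrow> map length (map2 (\<lambda>f. map (Cmp C f)) fs gss) = map length gss"
  by (auto intro: nth_equalityI)

lemma length_cmp_lists:
  "length gss = length fs \<Longrightarrow> length (cmp_lists C fs gss) = sum_list (map length gss)"
  by (simp only: cmp_lists_def length_concat map_length_cmp)

lemma nth_cmp_lists:
  assumes "length gss = length fs" "i < length fs" "j < length (gss ! i)"
  shows "cmp_lists C fs gss ! (sum_list (take i (map length gss)) + j) = Cmp C (fs ! i) (gss ! i ! j)"
  using concat_nth_start[of i "map2 (\<lambda>f. map (Cmp C f)) fs gss" j] assms
  by (simp add: cmp_lists_def map_length_cmp del: map_map)

lemma cmp_lists_Cons: "cmp_lists C (f # fs) (gs # gss) = map (Cmp C f) gs @ cmp_lists C fs gss"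
  by (simp add: cmp_lists_def)

lemma cmp_lists_append:
  "length gss = length fs \<Longrightarrow>
   cmp_lists C (fs @ fs') (gss @ gss') = cmp_lists C fs gss @ cmp_lists C fs' gss'"
  by (simp add: cmp_lists_def)

text \<open>Postcomposition happens block by block, so permuting the outer morphisms together with
  their inner lists permutes the blocks of the result; \<open>permute_list_block_perm\<close>
  expresses this on the concatenation.\<close>

lemma cmp_lists_permute:
  assumes \<pi>: "\<pi> permutes {..<length fs}" and len: "length gss = length fs"
  shows "cmp_lists C (permute_list \<pi> fs) (permute_list \<pi> gss) =
    permute_list (block_perm \<pi> (map length (permute_list \<pi> gss))) (cmp_lists C fs gss)"
proof -
  let ?m = "\<lambda>fs gss. map2 (\<lambda>f. map (Cmp C f)) fs gss"
  have "permute_list \<pi> (?m fs gss) = ?m (permute_list \<pi> fs) (permute_list \<pi> gss)"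
    using \<pi> len by (simp add: permute_list_map permute_list_zip)
  moreover from this have "map length (permute_list \<pi> (?m fs gss)) = map length (permute_list \<pi> gss)"
    using map_length_cmp[of "permute_list \<pi> gss" "permute_list \<pi> fs" C] len
    by (simp del: map_map)
  ultimately show ?thesis
    using permute_list_block_perm[of \<pi> "?m fs gss"] \<pi> len by (simp add: cmp_lists_def)
qed

lemma cmp_lists_permute_inner:
  assumes "length gss = length fs" "length \<rho>s = length fs"
    and \<rho>s: "\<And>i. i < length fs \<Longrightarrow> \<rho>s ! i permutes {..<length (gss ! i)}"
  shows "cmp_lists C fs (map2 permute_list \<rho>s gss) =
    permute_list (sum_perm (map length gss) \<rho>s) (cmp_lists C fs gss)"
proof -
  let ?m = "\<lambda>gss. map2 (\<lambda>f. map (Cmp C f)) fs gss"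
  have "map2 permute_list \<rho>s (?m gss) = ?m (map2 permute_list \<rho>s gss)"
    using assms by (auto intro!: nth_equalityI simp: permute_list_map)
  then show ?thesis
    using permute_list_sum_perm[of \<rho>s "?m gss"] assms
    by (simp add: cmp_lists_def map_length_cmp del: map_map)
qed

lemma cmp_lists_map_cmp:
  assumes "length hss = length gs"
    and "\<And>i h. i < length gs \<Longrightarrow> h \<in> set (hss ! i) \<Longrightarrow>
      Cmp C (Cmp C f (gs ! i)) h = Cmp C f (Cmp C (gs ! i) h)"
  shows "cmp_lists C (map (Cmp C f) gs) hss = map (Cmp C f) (cmp_lists C gs hss)"
proof -
  have "map2 (\<lambda>f. map (Cmp C f)) (map (Cmp C f) gs) hss =
      map (map (Cmp C f)) (map2 (\<lambda>f. map (Cmp C f)) gs hss)"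
    using assms by (auto intro!: nth_equalityI)
  then show ?thesis by (simp add: cmp_lists_def map_concat)
qed

text \<open>Associativity of \<open>Cmp\<close> is assumed for exactly the triples that occur, so
  the induction is about lists alone and the typing of morphisms is left to the caller.\<close>

lemma cmp_lists_assoc:
  assumes "length gss = length fs" "map length hsss = map length gss"
    and "\<And>i j h. i < length fs \<Longrightarrow> j < length (gss ! i) \<Longrightarrow> h \<in> set (hsss ! i ! j) \<Longrightarrow>
      Cmp C (Cmp C (fs ! i) (gss ! i ! j)) h = Cmp C (fs ! i) (Cmp C (gss ! i ! j) h)"
  shows "cmp_lists C (cmp_lists C fs gss) (concat hsss) =
    cmp_lists C fs (map2 (cmp_lists C) gss hsss)"
  using assms
proof (induction fs arbitrary: gss hsss)
  case Nil
  then show ?case by (simp add: cmp_lists_def)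
next
  case (Cons f fs)
  obtain gs gss' where gss: "gss = gs # gss'" using Cons.prems(1) by (cases gss) auto
  obtain hss hsss' where hsss: "hsss = hss # hsss'" using Cons.prems(2) gss by (cases hsss) auto
  have len: "length hss = length gs" using Cons.prems(2) gss hsss by simp
  have "cmp_lists C (map (Cmp C f) gs) hss = map (Cmp C f) (cmp_lists C gs hss)"
    using Cons.prems(3)[of 0] len by (intro cmp_lists_map_cmp) (simp_all add: gss hsss)
  moreover have "cmp_lists C (cmp_lists C fs gss') (concat hsss') =
      cmp_lists C fs (map2 (cmp_lists C) gss' hsss')"
    using Cons.prems(1,2) Cons.prems(3)[of "Suc _"] by (intro Cons.IH) (simp_all add: gss hsss)
  ultimately show ?case by (simp add: gss hsss cmp_lists_Cons cmp_lists_append len)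
qed

lemma inputs_cat:
  assumes "inputs (opset (cat_operad C)) c bs ys"
  shows "length bs = length c" "length ys = length c"
    "i < length c \<Longrightarrow> fst (ys ! i) permutes {..<length (bs ! i)}"
    "i < length c \<Longrightarrow> length (snd (ys ! i)) = length (bs ! i)"
    "i < length c \<Longrightarrow> j < length (bs ! i) \<Longrightarrow> snd (ys ! i) ! j \<in> hom_set C (bs ! i ! j) (c ! i)"
    "map length (map snd ys) = map length bs"
  using assms by (auto simp: inputs_def opset_cat intro!: nth_equalityI)

text \<open>In the permutation component the laws are those of the associative operad. In the list
  component they come from the unit and associativity axioms of \<open>C\<close> and the permutation
  rules for \<open>cmp_lists\<close>.\<close>

theorem (in small_category) colored_operad_cat: "colored_operad (Ob C) (cat_operad C)"
proof
  let ?P = "cat_operad C"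
  fix t assume t: "t \<in> Ob C"
  show "opunit ?P t \<in> opset ?P t [t]"
    using ide_closed[OF t] by (simp add: opunit_cat opset_cat permutes_id)
  fix c x assume c: "c \<in> lists (Ob C)" and x: "x \<in> opset ?P t c"
  have x1: "fst x permutes {..<length c}" and x2: "length (snd x) = length c"
    and x3: "\<And>i. i < length c \<Longrightarrow> snd x ! i \<in> hom_set C (c ! i) t"
    using x by (auto simp: opset_cat)
  show "opact ?P t c id x = x" by (simp add: opact_cat)
  have "map (Cmp C (Ide C t)) (snd x) = snd x"
    using cmp_ide_left[OF x3] x2 by (auto intro!: nth_equalityI)
  then show "opcomp ?P t [t] [c] (opunit ?P t) [x] = x"
    by (simp add: opcomp_cat opunit_cat assoc_comp_unit_left[OF x1] cmp_lists_def)
  have "cmp_lists C (snd x) (map snd (map (opunit ?P) c)) =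
      concat (map2 (\<lambda>f a. [Cmp C f (Ide C a)]) (snd x) c)"
    by (simp add: cmp_lists_def zip_map2 opunit_cat comp_def case_prod_unfold)
  also have "\<dots> = map2 (\<lambda>f a. Cmp C f (Ide C a)) (snd x) c"
    by (simp add: concat_map_singleton case_prod_unfold)
  also have "\<dots> = snd x"
    using cmp_ide_right[OF x3] x2 by (auto intro!: nth_equalityI)
  finally show "opcomp ?P t c (map (\<lambda>a. [a]) c) x (map (opunit ?P) c) = x"
    using assoc_comp_unit_right[OF x1]
    by (simp add: opcomp_cat comp_def opunit_cat map_replicate_const)
  fix \<sigma> assume \<sigma>: "\<sigma> permutes {..<length c}"
  then have \<sigma>x: "\<sigma> permutes {..<length (snd x)}" by (simp add: x2)
  show "opact ?P t c \<sigma> x \<in> opset ?P t (permute_list \<sigma> c)"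
    using permutes_compose[OF \<sigma> x1] x2 x3 permutes_less[OF \<sigma>]
    by (simp add: opact_cat opset_cat permute_list_nth[OF \<sigma>] permute_list_nth[OF \<sigma>x])
  fix \<sigma>' assume \<sigma>': "\<sigma>' permutes {..<length c}"
  show "opact ?P t (permute_list \<sigma> c) \<sigma>' (opact ?P t c \<sigma> x) = opact ?P t c (\<sigma> \<circ> \<sigma>') x"
    using \<sigma>' x2 by (simp add: opact_cat o_assoc permute_list_compose)
next
  let ?P = "cat_operad C"
  fix t c bs x ys
  assume t: "t \<in> Ob C" and c: "c \<in> lists (Ob C)" and x: "x \<in> opset ?P t c"
    and ys: "inputs (opset ?P) c bs ys"
  have x1: "fst x permutes {..<length c}" and x2: "length (snd x) = length c"
    and x3: "\<And>i. i < length c \<Longrightarrow> snd x ! i \<in> hom_set C (c ! i) t"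
    using x by (auto simp: opset_cat)
  note ys = inputs_cat[OF ys]
  show "opcomp ?P t c bs x ys \<in> opset ?P t (concat bs)"
  proof -
    have "assoc_comp (fst x) (map length bs) (map fst ys) permutes {..<length (concat bs)}"
      using assoc_comp_permutes[of "fst x" "map length bs" "map fst ys"] x1 ys
      by (simp add: length_concat)
    moreover have "cmp_lists C (snd x) (map snd ys) ! p \<in> hom_set C (concat bs ! p) t"
      if p: "p < length (concat bs)" for p
    proof -
      have "p < sum_list (map length bs)" using p by (simp add: length_concat)
      then obtain i j where ij: "i < length (map length bs)" "j < map length bs ! i"
        "p = sum_list (take i (map length bs)) + j" by (rule block_cases)
      then show ?thesis
        using nth_cmp_lists[of "map snd ys" "snd x" i j C] concat_nth_start[of i bs j]
          cmp_closed[OF ys(5)[of i j] x3[of i]] x2 ys(1,2,4) unfolding ys(6) by simp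
    qed
    ultimately show ?thesis
      using length_cmp_lists[of "map snd ys" "snd x" C] x2 ys(1,2) unfolding ys(6)
      by (simp add: opcomp_cat opset_cat length_concat)
  qed
  show "opcomp ?P t (permute_list \<sigma> c) (permute_list \<sigma> bs) (opact ?P t c \<sigma> x) (permute_list \<sigma> ys) =
      opact ?P t (concat bs) (block_perm \<sigma> (map length (permute_list \<sigma> bs)))
        (opcomp ?P t c bs x ys)" if \<sigma>: "\<sigma> permutes {..<length c}" for \<sigma>
  proof -
    have "map length (permute_list \<sigma> (map snd ys)) = map length (permute_list \<sigma> bs)"
      using permute_list_map[of \<sigma> "map snd ys" length] permute_list_map[of \<sigma> bs length] \<sigma> ys
      by simp
    then show ?thesis
      using assoc_comp_outer[of "fst x" "map length bs" \<sigma> "map fst ys"]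
        cmp_lists_permute[of \<sigma> "snd x" "map snd ys" C] \<sigma> x1 x2 ys(1-3)
      by (simp add: opcomp_cat opact_cat permute_list_map del: map_map)
  qed
  show "opcomp ?P t c (map2 permute_list \<sigma>s bs) x
        (map (\<lambda>i. opact ?P (c ! i) (bs ! i) (\<sigma>s ! i) (ys ! i)) [0..<length c]) =
      opact ?P t (concat bs) (sum_perm (map length bs) \<sigma>s) (opcomp ?P t c bs x ys)"
    if \<sigma>s: "length \<sigma>s = length c" "\<And>i. i < length c \<Longrightarrow> \<sigma>s ! i permutes {..<length (bs ! i)}"
    for \<sigma>s
  proof -
    let ?zs = "map (\<lambda>i. opact ?P (c ! i) (bs ! i) (\<sigma>s ! i) (ys ! i)) [0..<length c]"
    \<comment> \<open>The inner actions keep the block lengths, so the factor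
      \<open>block_perm\<close> is the same on both sides and only the sum permutations have to be
      multiplied.\<close>
    have "map length (map2 permute_list \<sigma>s bs) = map length bs"
      using \<sigma>s(1) ys(1) by (auto intro!: nth_equalityI)
    moreover have "map fst ?zs = map2 (\<circ>) (map fst ys) \<sigma>s"
      using \<sigma>s(1) ys(2) by (auto intro!: nth_equalityI simp: opact_cat)
    moreover have "map snd ?zs = map2 permute_list \<sigma>s (map snd ys)"
      using \<sigma>s(1) ys(2) by (auto intro!: nth_equalityI simp: opact_cat)
    moreover have "cmp_lists C (snd x) (map2 permute_list \<sigma>s (map snd ys)) =
        permute_list (sum_perm (map length bs) \<sigma>s) (cmp_lists C (snd x) (map snd ys))"
      unfolding ys(6)[symmetric]
      using \<sigma>s x2 ys(2,4) by (intro cmp_lists_permute_inner) simp_all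
    moreover have "sum_perm (map length bs) (map2 (\<circ>) (map fst ys) \<sigma>s) =
        sum_perm (map length bs) (map fst ys) \<circ> sum_perm (map length bs) \<sigma>s"
      using \<sigma>s ys(1,2) by (intro sum_perm_compose) simp_all
    ultimately show ?thesis
      by (simp add: opcomp_cat opact_cat assoc_comp_def o_assoc del: map_map)
  qed
  fix as zs
  assume len: "length as = length c" "length zs = length c"
    and zs: "\<And>i. i < length c \<Longrightarrow> inputs (opset ?P) (bs ! i) (as ! i) (zs ! i)"
  note zsi = inputs_cat[OF zs]
  let ?ws = "map (\<lambda>i. opcomp ?P (c ! i) (bs ! i) (as ! i) (ys ! i) (zs ! i)) [0..<length c]"
  let ?kss = "map (map length) as"
  have kss: "map length ?kss = map length bs"
    using len ys(1) zsi(1) by (auto intro!: nth_equalityI)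
  have "assoc_comp (assoc_comp (fst x) (map length ?kss) (map fst ys)) (concat ?kss)
        (concat (map (map fst) zs)) =
      assoc_comp (fst x) (map sum_list ?kss)
        (map (\<lambda>i. assoc_comp (map fst ys ! i) (?kss ! i) (map (map fst) zs ! i)) [0..<length ?kss])"
    using x1 len ys zsi by (intro assoc_comp_assoc) (auto intro!: nth_equalityI)
  also have "map sum_list ?kss = map length (map concat as)" by (simp add: length_concat comp_def)
  also have "map (\<lambda>i. assoc_comp (map fst ys ! i) (?kss ! i) (map (map fst) zs ! i)) [0..<length ?kss] =
      map fst ?ws"
    using len ys(2) by (auto simp: opcomp_cat)
  finally have perms: "assoc_comp (assoc_comp (fst x) (map length bs) (map fst ys))
      (map length (concat as)) (map fst (concat zs)) =
      assoc_comp (fst x) (map length (map concat as)) (map fst ?ws)"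
    unfolding kss by (simp add: map_concat del: map_map)
  have "cmp_lists C (cmp_lists C (snd x) (map snd ys)) (concat (map (map snd) zs)) =
      cmp_lists C (snd x) (map2 (cmp_lists C) (map snd ys) (map (map snd) zs))"
  proof (rule cmp_lists_assoc)
    show "map length (map (map snd) zs) = map length (map snd ys)"
      using len ys zsi by (auto intro!: nth_equalityI)
    fix i j h
    assume i: "i < length (snd x)" and j: "j < length (map snd ys ! i)"
      and h: "h \<in> set (map (map snd) zs ! i ! j)"
    then have i: "i < length c" and j: "j < length (bs ! i)" using x2 ys by auto
    then obtain k where k: "k < length (as ! i ! j)" "h = snd (zs ! i ! j) ! k"
      using h len zsi(2,4)[OF i] by (auto simp: in_set_conv_nth)
    show "Cmp C (Cmp C (snd x ! i) (map snd ys ! i ! j)) h =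
        Cmp C (snd x ! i) (Cmp C (map snd ys ! i ! j) h)"
      using cmp_assoc[OF zsi(5)[OF i j k(1)] ys(5)[OF i j] x3[OF i]] i ys(2) by (simp add: k(2))
  qed (simp add: x2 ys)
  also have "map2 (cmp_lists C) (map snd ys) (map (map snd) zs) = map snd ?ws"
    using len ys(2) by (auto intro!: nth_equalityI simp: opcomp_cat)
  finally show "opcomp ?P t (concat bs) (concat as) (opcomp ?P t c bs x ys) (concat zs) =
      opcomp ?P t c (map concat as) x ?ws"
    using perms by (simp add: opcomp_cat[of C t] map_concat del: map_map)
qed

section \<open>Transpositions of adjacent orthogonal pairs\<close>

text \<open>The current word is \<open>permute_list (inv \<sigma>) fs\<close>, whose entry at
  position \<open>j\<close> is \<open>fs ! inv \<sigma> j\<close>. Multiplying \<sigma> on the left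
  exchanges positions in this word, while \<open>fs\<close> itself stays fixed along a
  chain.\<close>

definition swap_step :: "('m \<times> 'm) set \<Rightarrow> 'm list \<Rightarrow> (nat \<Rightarrow> nat) \<Rightarrow> (nat \<Rightarrow> nat) \<Rightarrow> bool" where
  "swap_step perp fs \<sigma> \<sigma>' \<longleftrightarrow> (\<exists>j. Suc j < length fs \<and>
     (fs ! inv \<sigma> j, fs ! inv \<sigma> (Suc j)) \<in> perp \<and> \<sigma>' = transpose j (Suc j) \<circ> \<sigma>)"

lemma transpose_Suc_permutes: "Suc j < n \<Longrightarrow> transpose j (Suc j) permutes {..<n}"
  by (simp add: permutes_swap_id)

lemma swap_step_permutes:
  assumes "\<sigma> permutes {..<length fs}" "swap_step perp fs \<sigma> \<sigma>'"
  shows "\<sigma>' permutes {..<length fs}"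
  using assms by (auto simp: swap_step_def intro: permutes_compose transpose_Suc_permutes)

lemma swap_step_iff_adjacent:
  assumes \<sigma>: "\<sigma> permutes {..<length fs}"
  shows "swap_step perp fs \<sigma> \<sigma>' \<longleftrightarrow>
    (\<exists>\<tau>. adjacent_orth_transp perp (permute_list (inv \<sigma>) fs) \<tau> \<and> \<sigma>' = \<tau> \<circ> \<sigma>)"
proof -
  have "permute_list (inv \<sigma>) fs ! j = fs ! inv \<sigma> j" if "j < length fs" for j
    using permute_list_nth[OF permutes_inv[OF \<sigma>] that] .
  then show ?thesis
    unfolding swap_step_def adjacent_orth_transp_def by (metis Suc_lessD length_permute_list)
qed

text \<open>The first transposition \<tau> of a chain is an involution, so
  \<open>inv (\<tau> \<circ> \<rho>) = inv \<rho> \<circ> \<tau>\<close> and \<tau> can be moved to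
  the other side of the product identity. What remains is a full chain starting from
  \<open>\<tau> \<circ> \<rho>\<close>, so peeling off one transposition is one swap step.\<close>

lemma adjacent_chain_iff_swap_steps:
  assumes \<sigma>: "\<sigma> permutes {..<length fs}" and \<sigma>': "\<sigma>' permutes {..<length fs}"
  shows "(\<exists>\<tau>s. \<sigma> \<circ> inv \<sigma>' = perm_prod \<tau>s \<and>
      (\<forall>k<length \<tau>s. adjacent_orth_transp perp
         (permute_list (inv \<sigma> \<circ> perm_prod (take k \<tau>s)) fs) (\<tau>s ! k))) \<longleftrightarrow>
    (swap_step perp fs)\<^sup>*\<^sup>* \<sigma> \<sigma>'"
proof -
  let ?chain = "\<lambda>\<sigma> \<tau>s. \<sigma> \<circ> inv \<sigma>' = perm_prod \<tau>s \<and>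
      (\<forall>k<length \<tau>s. adjacent_orth_transp perp
         (permute_list (inv \<sigma> \<circ> perm_prod (take k \<tau>s)) fs) (\<tau>s ! k))"
  have chain_Nil: "?chain \<rho> [] \<longleftrightarrow> \<rho> = \<sigma>'" for \<rho>
  proof
    assume "?chain \<rho> []"
    then have "\<rho> \<circ> inv \<sigma>' \<circ> \<sigma>' = \<sigma>'" by (simp add: perm_prod_def)
    then show "\<rho> = \<sigma>'" by (simp add: Fun.comp_assoc permutes_inv_o(2)[OF \<sigma>'])
  qed (simp add: perm_prod_def permutes_inv_o(1)[OF \<sigma>'])
  have chain_Cons: "?chain \<rho> (\<tau> # \<tau>s) \<longleftrightarrow>
      adjacent_orth_transp perp (permute_list (inv \<rho>) fs) \<tau> \<and> ?chain (\<tau> \<circ> \<rho>) \<tau>s"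
    if \<rho>: "\<rho> permutes {..<length fs}" for \<rho> \<tau> \<tau>s
  proof -
    have "inv (\<tau> \<circ> \<rho>) = inv \<rho> \<circ> \<tau>" "\<rho> \<circ> inv \<sigma>' = \<tau> \<circ> perm_prod \<tau>s \<longleftrightarrow> \<tau> \<circ> \<rho> \<circ> inv \<sigma>' = perm_prod \<tau>s"
      if adj: "adjacent_orth_transp perp (permute_list (inv \<rho>) fs) \<tau>"
    proof -
      obtain j where \<tau>: "\<tau> = transpose j (Suc j)" using adj by (auto simp: adjacent_orth_transp_def)
      then have inv: "\<tau> \<circ> \<tau> = id" "inv \<tau> = \<tau>" by (simp_all add: inv_swap_id)
      show "inv (\<tau> \<circ> \<rho>) = inv \<rho> \<circ> \<tau>"
        using o_inv_distrib[of \<tau> \<rho>] permutes_bij[OF \<rho>] by (simp add: \<tau> inv_swap_id)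
      show "\<rho> \<circ> inv \<sigma>' = \<tau> \<circ> perm_prod \<tau>s \<longleftrightarrow> \<tau> \<circ> \<rho> \<circ> inv \<sigma>' = perm_prod \<tau>s"
        using inv(1) by (metis Fun.comp_assoc id_comp)
    qed
    moreover have "perm_prod (\<tau> # \<tau>s) = \<tau> \<circ> perm_prod \<tau>s" "perm_prod [] = id"
      for \<tau>s :: "(nat \<Rightarrow> nat) list"
      by (simp_all add: perm_prod_def)
    ultimately show ?thesis by (auto simp: All_less_Suc2 Fun.comp_assoc)
  qed
  show ?thesis
  proof
    show "(swap_step perp fs)\<^sup>*\<^sup>* \<sigma> \<sigma>'" if "\<exists>\<tau>s. ?chain \<sigma> \<tau>s"
    proof -
      from that obtain \<tau>s where "?chain \<sigma> \<tau>s" by blast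
      then show ?thesis using \<sigma>
      proof (induction \<tau>s arbitrary: \<sigma>)
        case Nil
        then have "\<sigma> = \<sigma>'" using chain_Nil[of \<sigma>] by blast
        then show ?case by simp
      next
        case (Cons \<tau> \<tau>s)
        then have "swap_step perp fs \<sigma> (\<tau> \<circ> \<sigma>)" and "?chain (\<tau> \<circ> \<sigma>) \<tau>s"
          using chain_Cons[OF Cons.prems(2)] swap_step_iff_adjacent[OF Cons.prems(2)] by blast+
        then show ?case
          using Cons.IH[of "\<tau> \<circ> \<sigma>"] swap_step_permutes Cons.prems(2)
          by (meson converse_rtranclp_into_rtranclp)
      qed
    qed
    show "\<exists>\<tau>s. ?chain \<sigma> \<tau>s" if "(swap_step perp fs)\<^sup>*\<^sup>* \<sigma> \<sigma>'"
      using that \<sigma>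
    proof (induction rule: converse_rtranclp_induct)
      case base
      show ?case using chain_Nil[of \<sigma>'] by blast
    next
      case (step \<rho> \<rho>')
      from step.hyps(1) step.prems obtain \<tau> where
        \<tau>: "adjacent_orth_transp perp (permute_list (inv \<rho>) fs) \<tau>" "\<rho>' = \<tau> \<circ> \<rho>"
        using swap_step_iff_adjacent by blast
      obtain \<tau>s where "?chain \<rho>' \<tau>s"
        using step.IH swap_step_permutes[OF step.prems step.hyps(1)] by blast
      then have "?chain \<rho> (\<tau> # \<tau>s)" using chain_Cons[OF step.prems] \<tau> by blast
      then show ?case by blast
    qed
  qed
qed

text \<open>A swap step changes the relative order of only the two entries that it exchanges.
  Following the chain while \<open>i\<close> stays in front of \<open>j\<close>, the step that first
  reverses them must exchange exactly this pair, and it is allowed only for an orthogonal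
  pair.\<close>

lemma swap_steps_inversions:
  assumes "(swap_step perp fs)\<^sup>*\<^sup>* \<sigma> \<sigma>'" and "\<sigma> permutes {..<length fs}"
    and "i < length fs" "j < length fs" "\<sigma> i < \<sigma> j" "\<sigma>' j < \<sigma>' i"
  shows "(fs ! i, fs ! j) \<in> perp"
  using assms
proof (induction rule: converse_rtranclp_induct)
  case (step \<rho> \<rho>')
  note \<rho> = step.prems(1)
  from step.hyps(1) obtain k where k: "(fs ! inv \<rho> k, fs ! inv \<rho> (Suc k)) \<in> perp"
    and \<rho>': "\<rho>' = transpose k (Suc k) \<circ> \<rho>" by (auto simp: swap_step_def)
  show ?case
  proof (cases "\<rho>' i < \<rho>' j")
    case True
    then show ?thesis
      using step.IH swap_step_permutes[OF \<rho> step.hyps(1)] step.prems by blast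
  next
    case False
    then have "\<rho> i = k" "\<rho> j = Suc k"
      using step.prems(4) by (auto simp: \<rho>' transpose_def split: if_splits)
    then show ?thesis using k permutes_inverses(2)[OF \<rho>] by metis
  qed
qed simp

text \<open>Without descents between neighbours the permutation is increasing. Applied to
  \<open>\<sigma>' \<circ> inv \<sigma>\<close>, this shows that distinct permutations always invert
  some pair that is adjacent for \<sigma>.\<close>

lemma permutes_eq_of_adjacent:
  fixes \<rho> :: "nat \<Rightarrow> nat"
  assumes \<rho>: "\<rho> permutes {..<n}" and adj: "\<And>k. Suc k < n \<Longrightarrow> \<rho> k < \<rho> (Suc k)"
  shows "\<rho> = id"
proof (rule permutes_eqI_less[OF \<rho> permutes_id])
  have mono: "\<rho> i < \<rho> j" if "i < j" "j < n" for i j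
    using that by (induction rule: less_Suc_induct) (use adj in \<open>auto intro: less_trans\<close>)
  show "\<rho> i < \<rho> j \<longleftrightarrow> id i < id j" if "i < n" "j < n" for i j
    using mono[of i j] mono[of j i] that by (cases i j rule: linorder_cases) auto
qed

text \<open>Induction on the number of inversions between \<open>\<sigma>\<close> and \<open>\<sigma>'\<close>: if there is one, then two
  entries that are adjacent for \<open>\<sigma>\<close> are inverted, and swapping them removes exactly this inversion.\<close>

lemma inversions_swap_steps:
  assumes "\<sigma> permutes {..<length fs}" "\<sigma>' permutes {..<length fs}"
    and "\<And>i j. i < length fs \<Longrightarrow> j < length fs \<Longrightarrow> \<sigma> i < \<sigma> j \<Longrightarrow> \<sigma>' j < \<sigma>' i \<Longrightarrow> (fs ! i, fs ! j) \<in> perp"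
  shows "(swap_step perp fs)\<^sup>*\<^sup>* \<sigma> \<sigma>'"
proof -
  let ?n = "length fs"
  \<comment> \<open>The target \<sigma>' stays fixed. Writing first the entry that \<sigma> puts
    first counts each inversion once.\<close>
  define I where "I \<sigma> = {(i, j). i < ?n \<and> j < ?n \<and> \<sigma> i < \<sigma> j \<and> \<sigma>' j < \<sigma>' i}" for \<sigma> :: "nat \<Rightarrow> nat"
  have fin: "finite (I \<sigma>)" for \<sigma>
    by (rule finite_subset[of _ "{..<?n} \<times> {..<?n}"]) (auto simp: I_def)
  have "(swap_step perp fs)\<^sup>*\<^sup>* \<sigma> \<sigma>'"
    if "\<sigma> permutes {..<?n}" "\<And>i j. (i, j) \<in> I \<sigma> \<Longrightarrow> (fs ! i, fs ! j) \<in> perp" for \<sigma>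
    using that
  proof (induction "card (I \<sigma>)" arbitrary: \<sigma> rule: less_induct)
    case less
    note \<sigma> = less.prems(1)
    have inv: "inv \<sigma> permutes {..<?n}" by (rule permutes_inv[OF \<sigma>])
    show ?case
    proof (cases "\<exists>k. Suc k < ?n \<and> \<sigma>' (inv \<sigma> (Suc k)) < \<sigma>' (inv \<sigma> k)")
      case True
      then obtain k where k: "Suc k < ?n" "\<sigma>' (inv \<sigma> (Suc k)) < \<sigma>' (inv \<sigma> k)" by blast
      let ?i = "inv \<sigma> k" and ?j = "inv \<sigma> (Suc k)" and ?\<rho> = "transpose k (Suc k) \<circ> \<sigma>"
      have ij: "(?i, ?j) \<in> I \<sigma>"
        using k permutes_less[OF inv] by (simp add: I_def permutes_inverses(1)[OF \<sigma>])
      have step: "swap_step perp fs \<sigma> ?\<rho>"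
        using k(1) less.prems(2)[OF ij] by (auto simp: swap_step_def)
      have "I ?\<rho> \<subseteq> I \<sigma>"
      proof (clarify)
        fix a b assume ab: "(a, b) \<in> I ?\<rho>"
        \<comment> \<open>The only pair that could be new in \<open>I ?\<rho>\<close> is
          \<open>(?j, ?i)\<close>, but \<sigma>' also puts \<open>?j\<close> before
          \<open>?i\<close>.\<close>
        have "\<sigma> a < \<sigma> b"
        proof (rule ccontr)
          assume "\<not> \<sigma> a < \<sigma> b"
          then have "\<sigma> a = Suc k" "\<sigma> b = k"
            using ab by (auto simp: I_def transpose_def split: if_splits)
          then have "a = ?j" "b = ?i" using permutes_inverses(2)[OF \<sigma>] by metis+
          then show False using ab k(2) by (simp add: I_def)
        qed
        then show "(a, b) \<in> I \<sigma>" using ab by (simp add: I_def)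
      qed
      moreover have "(?i, ?j) \<notin> I ?\<rho>" by (simp add: I_def permutes_inverses(1)[OF \<sigma>])
      ultimately have "I ?\<rho> \<subset> I \<sigma>" using ij by blast
      then have "(swap_step perp fs)\<^sup>*\<^sup>* ?\<rho> \<sigma>'"
        using less.prems(2) psubset_card_mono[OF fin]
        by (intro less.hyps swap_step_permutes[OF \<sigma> step]) blast+
      with step show ?thesis by (rule converse_rtranclp_into_rtranclp)
    next
      case False
      have ne: "\<sigma>' (inv \<sigma> (Suc k)) \<noteq> \<sigma>' (inv \<sigma> k)" for k
        using permutes_inj[OF assms(2)] permutes_inj[OF inv] by (metis injD n_not_Suc_n)
      have "\<sigma>' \<circ> inv \<sigma> = id"
        using False ne by (intro permutes_eq_of_adjacent[OF permutes_compose[OF inv assms(2)]])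
          (metis comp_apply linorder_neqE_nat)
      then have "\<sigma>' \<circ> inv \<sigma> \<circ> \<sigma> = \<sigma>" by simp
      then have "\<sigma>' = \<sigma>" by (simp add: Fun.comp_assoc permutes_inv_o(2)[OF \<sigma>])
      then show ?thesis by simp
    qed
  qed
  then show ?thesis using assms(1,3) by (auto simp: I_def)
qed

lemma perp_rel_iff_swap_steps:
  "(x, y) \<in> perp_rel C perp t c \<longleftrightarrow>
   x \<in> opset (cat_operad C) t c \<and> y \<in> opset (cat_operad C) t c \<and> snd x = snd y \<and>
   (swap_step perp (snd x))\<^sup>*\<^sup>* (fst x) (fst y)"
  using adjacent_chain_iff_swap_steps[of "fst x" "snd x" "fst y" perp]
  by (cases x; cases y) (auto simp: perp_rel_def opset_cat)

text \<open>In this form the relation is visibly transitive and compatible with composition.\<close>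

lemma perp_rel_iff_inversions:
  "(x, y) \<in> perp_rel C perp t c \<longleftrightarrow>
   x \<in> opset (cat_operad C) t c \<and> y \<in> opset (cat_operad C) t c \<and> snd x = snd y \<and>
   (\<forall>i<length c. \<forall>j<length c. fst x i < fst x j \<and> fst y j < fst y i \<longrightarrow>
      (snd x ! i, snd x ! j) \<in> perp)"
proof -
  have "(swap_step perp (snd x))\<^sup>*\<^sup>* (fst x) (fst y) \<longleftrightarrow>
      (\<forall>i<length c. \<forall>j<length c. fst x i < fst x j \<and> fst y j < fst y i \<longrightarrow>
        (snd x ! i, snd x ! j) \<in> perp)"
    if "x \<in> opset (cat_operad C) t c" "y \<in> opset (cat_operad C) t c" "snd x = snd y"
    using that swap_steps_inversions[of perp "snd x" "fst x" "fst y"]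
      inversions_swap_steps[of "fst x" "snd x" "fst y" perp]
    by (auto simp: opset_cat)
  then show ?thesis unfolding perp_rel_iff_swap_steps by blast
qed

section \<open>Compatibility of the relation with the operad structure\<close>

context orthogonal_category
begin

lemma perp_rel_congruence: "operad_congruence (Ob C) (cat_operad C) (perp_rel C perp)"
  unfolding operad_congruence_def
proof (intro conjI ballI allI impI; (elim conjE)?)
  let ?P = "cat_operad C"
  interpret P: colored_operad "Ob C" ?P by (rule colored_operad_cat)
  fix t c assume t: "t \<in> Ob C" and c: "c \<in> lists (Ob C)"
  have neq: "\<sigma> i \<noteq> \<sigma> j" if "\<sigma> permutes {..<length c}" "i \<noteq> j" for \<sigma> i j
    using permutes_inj[OF that(1)] that(2) by (auto dest: injD)
  show "equiv (opset ?P t c) (perp_rel C perp t c)"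
  proof (rule equivI)
    show "perp_rel C perp t c \<subseteq> opset ?P t c \<times> opset ?P t c"
      by (auto simp: perp_rel_iff_inversions)
    show "refl_on (opset ?P t c) (perp_rel C perp t c)"
      by (auto simp: refl_on_def perp_rel_iff_inversions)
    show "sym (perp_rel C perp t c)"
    proof (rule symI)
      \<comment> \<open>Exchanging the two permutations amounts to exchanging \<open>i\<close> and
        \<open>j\<close>, hence to reversing the orthogonal pair.\<close>
      fix x y assume "(x, y) \<in> perp_rel C perp t c"
      then show "(y, x) \<in> perp_rel C perp t c"
        unfolding perp_rel_iff_inversions using perp_sym by metis
    qed
    show "trans (perp_rel C perp t c)"
    proof (rule transI)
      fix x y z assume xy: "(x, y) \<in> perp_rel C perp t c" and yz: "(y, z) \<in> perp_rel C perp t c"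
      then have "fst y permutes {..<length c}" by (simp add: perp_rel_iff_inversions opset_cat)
      \<comment> \<open>If \<open>x\<close> and \<open>z\<close> order a pair differently, then
        \<open>y\<close> disagrees with one of them, because by \<open>neq\<close> it orders the
        pair strictly.\<close>
      from neq[OF this] show "(x, z) \<in> perp_rel C perp t c"
        using xy yz unfolding perp_rel_iff_inversions
        by (metis less_irrefl linorder_neqE_nat)
    qed
  qed
  fix x x' assume xx': "(x, x') \<in> perp_rel C perp t c"
  then have x: "x \<in> opset ?P t c" "x' \<in> opset ?P t c" and snd: "snd x' = snd x"
    and perp: "\<And>i j. i < length c \<Longrightarrow> j < length c \<Longrightarrow> fst x i < fst x j \<Longrightarrow> fst x' j < fst x' i \<Longrightarrow>
      (snd x ! i, snd x ! j) \<in> perp" by (auto simp: perp_rel_iff_inversions)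
  {
    fix \<sigma> assume \<sigma>: "\<sigma> permutes {..<length c}"
    \<comment> \<open>Inputs \<open>i\<close> and \<open>j\<close> after the action are inputs
      \<open>\<sigma> i\<close> and \<open>\<sigma> j\<close> before it, with the same order and the
      same morphisms.\<close>
    have "length (snd x) = length c" using x(1) by (simp add: opset_cat)
    then have "permute_list \<sigma> (snd x) ! i = snd x ! \<sigma> i" if "i < length c" for i
      using \<sigma> that by (simp add: permute_list_nth)
    then show "(opact ?P t c \<sigma> x, opact ?P t c \<sigma> x') \<in> perp_rel C perp t (permute_list \<sigma> c)"
      using P.act_closed[OF t c x(1) \<sigma>] P.act_closed[OF t c x(2) \<sigma>] perp permutes_less[OF \<sigma>]
      by (auto simp: perp_rel_iff_inversions opact_cat snd)
  }
  fix bs ys ys' assume bs: "bs \<in> lists (lists (Ob C))"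
    and ys: "inputs (opset ?P) c bs ys" and ys': "inputs (opset ?P) c bs ys'"
    and rel: "\<forall>i<length c. (ys ! i, ys' ! i) \<in> perp_rel C perp (c ! i) (bs ! i)"
  note in1 = inputs_cat[OF ys] and in2 = inputs_cat[OF ys']
  let ?ls = "map length bs"
  have "map snd ys' = map snd ys"
    using rel in1(2) in2(2) by (auto intro!: nth_equalityI simp: perp_rel_iff_inversions)
  then have snd_comp: "snd (opcomp ?P t c bs x' ys') = snd (opcomp ?P t c bs x ys)"
    by (simp add: opcomp_cat snd)
  have x1: "fst x permutes {..<length ?ls}" "fst x' permutes {..<length ?ls}"
    and x2: "length (snd x) = length c" and x3: "\<And>i. i < length c \<Longrightarrow> snd x ! i \<in> hom_set C (c ! i) t"
    using x in1(1) by (auto simp: opset_cat)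
  have y1: "map fst ys ! i permutes {..<?ls ! i}" "map fst ys' ! i permutes {..<?ls ! i}"
    if "i < length ?ls" for i using that in1(1,2,3) in2(2,3) by auto
  have "(snd (opcomp ?P t c bs x ys) ! p, snd (opcomp ?P t c bs x ys) ! q) \<in> perp"
    if p: "p < length (concat bs)" and q: "q < length (concat bs)"
      and lt: "fst (opcomp ?P t c bs x ys) p < fst (opcomp ?P t c bs x ys) q"
      and gt: "fst (opcomp ?P t c bs x' ys') q < fst (opcomp ?P t c bs x' ys') p" for p q
  proof -
    have "p < sum_list ?ls" "q < sum_list ?ls" using p q by (simp_all add: length_concat)
    then obtain i j k l where
      ij: "i < length ?ls" "j < ?ls ! i" "p = sum_list (take i ?ls) + j" and
      kl: "k < length ?ls" "l < ?ls ! k" "q = sum_list (take k ?ls) + l"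
      using block_cases by metis
    have i: "i < length c" and k: "k < length c" using ij kl in1(1) by simp_all
    have j: "j < length (bs ! i)" and l: "l < length (bs ! k)" using ij kl by simp_all
    have nth: "snd (opcomp ?P t c bs x ys) ! (sum_list (take a ?ls) + b) =
        Cmp C (snd x ! a) (snd (ys ! a) ! b)" if "a < length c" "b < length (bs ! a)" for a b
      using nth_cmp_lists[of "map snd ys" "snd x" a b C] that in1(1,2,4) x2
      unfolding in1(6) by (simp add: opcomp_cat)
    have f: "snd x ! i \<in> Mor C" "Dom C (snd x ! i) = c ! i"
      "snd x ! k \<in> Mor C" "Dom C (snd x ! k) = c ! k"
      using x3[OF i] x3[OF k] by (simp_all add: hom_set_def)
    have g: "snd (ys ! i) ! j \<in> Mor C" "Cod C (snd (ys ! i) ! j) = c ! i"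
      "snd (ys ! k) ! l \<in> Mor C" "Cod C (snd (ys ! k) ! l) = c ! k"
      using in1(5)[OF i j] in1(5)[OF k l] by (simp_all add: hom_set_def)
    \<comment> \<open>If the blocks \<open>i\<close> and \<open>k\<close> differ, the outer pair is
      inverted and stability under precomposition applies. If they agree, the outer alternatives are
      impossible, so the inner pair is inverted and stability under postcomposition applies.\<close>
    have lt': "fst x i < fst x k \<or> i = k \<and> fst (ys ! i) j < fst (ys ! i) l"
      using lt assoc_comp_less_iff[OF x1(1) y1(1) ij(1,2) kl(1,2)] i in1(2)
      by (simp add: opcomp_cat ij(3) kl(3))
    have gt': "fst x' k < fst x' i \<or> i = k \<and> fst (ys' ! i) l < fst (ys' ! i) j"
      using gt assoc_comp_less_iff[OF x1(2) y1(2) kl(1,2) ij(1,2)] i k in2(2)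
      by (auto simp add: opcomp_cat ij(3) kl(3))
    show ?thesis
    proof (cases "i = k")
      case True
      then have "(snd (ys ! i) ! j, snd (ys ! i) ! l) \<in> perp"
        using rel i j l lt' gt' by (auto simp: perp_rel_iff_inversions)
      then show ?thesis
        unfolding ij(3) kl(3) nth[OF i j] nth[OF k l]
        using perp_post[of "snd (ys ! i) ! j" "snd (ys ! i) ! l" "snd x ! i"] f g True by simp
    next
      case False
      then have "(snd x ! i, snd x ! k) \<in> perp" using perp[OF i k] lt' gt' by blast
      then show ?thesis
        unfolding ij(3) kl(3) nth[OF i j] nth[OF k l] using perp_pre f g by simp
    qed
  qed
  then show "(opcomp ?P t c bs x ys, opcomp ?P t c bs x' ys') \<in> perp_rel C perp t (concat bs)"
    using P.comp_closed[OF t c bs x(1) ys] P.comp_closed[OF t c bs x(2) ys'] snd_comp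
    by (auto simp: perp_rel_iff_inversions)
qed

end

section \<open>The coequalizer\<close>

context small_category
begin

lemma cmp_lists_ide:
  "list_all2 (\<lambda>a f. f \<in> hom_set C a t) as fs \<Longrightarrow> cmp_lists C fs (map (\<lambda>a. [Ide C a]) as) = fs"
  by (induction rule: list_all2_induct) (auto simp: cmp_lists_def cmp_ide_right)

text \<open>The outer permutation is \<open>id\<close>, so the composite permutation is the plain
  sum of the inner ones. The identity morphism in the slot of color \<open>t\<close> lets
  \<open>f\<close> and \<open>g\<close> through unchanged, and units fill the other slots.\<close>

lemma opcomp_cat_insert:
  assumes fs: "list_all2 (\<lambda>a f. f \<in> hom_set C a t) as fs"
    and gs: "list_all2 (\<lambda>a f. f \<in> hom_set C a t) bs gs"
    and f: "f \<in> hom_set C a t" and g: "g \<in> hom_set C b t"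
  shows "opcomp (cat_operad C) t (as @ t # bs) (map (\<lambda>a. [a]) as @ [a, b] # map (\<lambda>a. [a]) bs)
      (id, fs @ Ide C t # gs)
      (map (opunit (cat_operad C)) as @ (\<rho>, [f, g]) # map (opunit (cat_operad C)) bs) =
    (sum_perm (replicate (length as) 1 @ 2 # replicate (length bs) 1)
       (replicate (length as) id @ \<rho> # replicate (length bs) id), fs @ f # g # gs)"
  using cmp_lists_ide[OF fs] cmp_lists_ide[OF gs] list_all2_lengthD[OF fs]
    cmp_ide_left[OF f] cmp_ide_left[OF g]
  by (simp add: opcomp_cat assoc_comp_def block_perm_id opunit_cat comp_def map_replicate_const
      cmp_lists_append cmp_lists_Cons numeral_2_eq_2)

end

context orthogonal_category
begin

section \<open>Morphisms that identify the two orders of an orthogonal pair\<close>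

context
  fixes Z :: "('o, 'z) operad" and h :: "'o \<Rightarrow> 'o list \<Rightarrow> (nat \<Rightarrow> nat) \<times> 'm list \<Rightarrow> 'z"
  assumes h: "operad_hom (Ob C) (cat_operad C) Z h"
    and swap: "\<And>t a b f g. t \<in> Ob C \<Longrightarrow> f \<in> hom_set C a t \<Longrightarrow> g \<in> hom_set C b t \<Longrightarrow> (f, g) \<in> perp \<Longrightarrow>
      h t [a, b] (id, [f, g]) = h t [a, b] (transpose 0 1, [f, g])"
begin

interpretation h: operad_hom "Ob C" "cat_operad C" Z h by (rule h)

lemma hom_adjacent_transp:
  assumes t: "t \<in> Ob C" and as: "as \<in> lists (Ob C)" and bs: "bs \<in> lists (Ob C)"
    and fs: "list_all2 (\<lambda>a f. f \<in> hom_set C a t) as fs"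
    and gs: "list_all2 (\<lambda>a f. f \<in> hom_set C a t) bs gs"
    and f: "f \<in> hom_set C a t" and g: "g \<in> hom_set C b t" and fg: "(f, g) \<in> perp"
  shows "h t (as @ a # b # bs) (id, fs @ f # g # gs) =
    h t (as @ a # b # bs) (transpose (length as) (Suc (length as)), fs @ f # g # gs)"
proof -
  let ?P = "cat_operad C"
  let ?c = "as @ t # bs" and ?bs = "map (\<lambda>a. [a]) as @ [a, b] # map (\<lambda>a. [a]) bs"
  let ?x = "(id, fs @ Ide C t # gs)"
  let ?ys = "\<lambda>\<rho>. map (opunit ?P) as @ (\<rho>, [f, g]) # map (opunit ?P) bs"
  have ab: "a \<in> Ob C" "b \<in> Ob C" using f g dom_closed by (auto simp: hom_set_def)
  have len: "length fs = length as" "length gs = length bs"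
    using list_all2_lengthD[OF fs] list_all2_lengthD[OF gs] by simp_all
  have c: "?c \<in> lists (Ob C)" and bs': "?bs \<in> lists (lists (Ob C))"
    using t as bs ab by auto
  have x: "?x \<in> opset ?P t ?c"
    using list_all2_nthD2[OF fs] list_all2_nthD2[OF gs] ide_closed[OF t] len
    by (auto simp: opset_cat permutes_id nth_append nth_Cons')
  have ys: "inputs (opset ?P) ?c ?bs (?ys \<rho>)" if "\<rho> permutes {..<2}" for \<rho>
    using that f g as bs h.dom.unit_closed
    by (auto simp: inputs_def nth_append nth_Cons' opset_cat[of "(\<rho>, [f, g])"] less_Suc_eq
        in_lists_conv_set numeral_2_eq_2)
  have perms: "id permutes {..<2::nat}" "transpose 0 (1::nat) permutes {..<2}"
    by (simp_all add: permutes_id permutes_swap_id)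
  \<comment> \<open>The two lists of inner operations differ only in slot \<open>length as\<close>,
    and there \<open>swap\<close> makes the values of \<open>h\<close> equal.\<close>
  have "map (\<lambda>i. h (?c ! i) (?bs ! i) (?ys id ! i)) [0..<length ?c] =
      map (\<lambda>i. h (?c ! i) (?bs ! i) (?ys (transpose 0 1) ! i)) [0..<length ?c]"
    using swap[OF t f g fg] by (auto simp: nth_append nth_Cons')
  then have "h t (concat ?bs) (opcomp ?P t ?c ?bs ?x (?ys id)) =
      h t (concat ?bs) (opcomp ?P t ?c ?bs ?x (?ys (transpose 0 1)))"
    by (simp only: h.hom_comp[OF t c bs' x ys[OF perms(1)]] h.hom_comp[OF t c bs' x ys[OF perms(2)]])
  moreover have "sum_perm (replicate (length as) 1 @ 2 # replicate (length bs) 1)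
      (replicate (length as) id @ id # replicate (length bs) id) = id"
    using sum_perm_id[of "replicate (length as) 1 @ 2 # replicate (length bs) 1"]
    by (simp add: replicate_add replicate_app_Cons_same)
  ultimately show ?thesis
    unfolding opcomp_cat_insert[OF fs gs f g] sum_perm_adjacent_transp by simp
qed

text \<open>Equivariance reduces to the trivial permutation: \<open>x\<close> is the action of
  \<open>?\<sigma>\<close> on \<open>(id, ?w)\<close>, where \<open>?w\<close> lists the morphisms
  in the order given by \<open>?\<sigma>\<close>, and the same action sends
  \<open>(transpose j (Suc j), ?w)\<close> to the swapped operation. In \<open>?w\<close> the
  orthogonal pair is adjacent as a pair of inputs.\<close>

lemma hom_swap_step:
  assumes t: "t \<in> Ob C" and c: "c \<in> lists (Ob C)" and x: "x \<in> opset (cat_operad C) t c"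
    and step: "swap_step perp (snd x) (fst x) \<sigma>'"
  shows "h t c x = h t c (\<sigma>', snd x)"
proof -
  let ?P = "cat_operad C" and ?\<sigma> = "fst x"
  have \<sigma>: "?\<sigma> permutes {..<length c}" and len: "length (snd x) = length c"
    and mor: "\<And>i. i < length c \<Longrightarrow> snd x ! i \<in> hom_set C (c ! i) t"
    using x by (auto simp: opset_cat)
  have inv: "inv ?\<sigma> permutes {..<length c}" by (rule permutes_inv[OF \<sigma>])
  let ?d = "permute_list (inv ?\<sigma>) c" and ?w = "permute_list (inv ?\<sigma>) (snd x)"
  from step len obtain j where j: "Suc j < length c"
    and perp: "(snd x ! inv ?\<sigma> j, snd x ! inv ?\<sigma> (Suc j)) \<in> perp"
    and \<sigma>': "\<sigma>' = transpose j (Suc j) \<circ> ?\<sigma>" by (auto simp: swap_step_def)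
  have d: "?d \<in> lists (Ob C)" using c inv by (simp add: in_lists_conv_set)
  have nth: "?d ! i = c ! inv ?\<sigma> i" "?w ! i = snd x ! inv ?\<sigma> i" if "i < length c" for i
    using that inv len by (simp_all add: permute_list_nth)
  have w: "?w ! i \<in> hom_set C (?d ! i) t" if "i < length c" for i
    using mor[OF permutes_less[OF inv that]] by (simp add: nth that)
  then have w2: "list_all2 (\<lambda>a f. f \<in> hom_set C a t) ?d ?w"
    by (simp add: list_all2_conv_all_nth len)
  have split: "ds = take j ds @ ds ! j # ds ! Suc j # drop (Suc (Suc j)) ds"
    if "length ds = length c" for ds :: "'x list"
    using j that by (metis Cons_nth_drop_Suc Suc_lessD append_take_drop_id)
  have "h t ?d (id, ?w) = h t ?d (transpose j (Suc j), ?w)"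
  proof -
    have "h t (take j ?d @ ?d ! j # ?d ! Suc j # drop (Suc (Suc j)) ?d)
        (id, take j ?w @ ?w ! j # ?w ! Suc j # drop (Suc (Suc j)) ?w) =
      h t (take j ?d @ ?d ! j # ?d ! Suc j # drop (Suc (Suc j)) ?d)
        (transpose (length (take j ?d)) (Suc (length (take j ?d))),
         take j ?w @ ?w ! j # ?w ! Suc j # drop (Suc (Suc j)) ?w)"
    proof (rule hom_adjacent_transp[OF t])
      show "take j ?d \<in> lists (Ob C)" "drop (Suc (Suc j)) ?d \<in> lists (Ob C)"
        using d by (auto simp: in_lists_conv_set dest: in_set_takeD in_set_dropD)
      show "(?w ! j, ?w ! Suc j) \<in> perp" using perp j by (simp add: nth)
    qed (use w2 w j in \<open>auto intro: list_all2_takeI list_all2_dropI\<close>)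
    then show ?thesis using split[of ?d] split[of ?w] len j by simp
  qed
  moreover have "(\<rho>, ?w) \<in> opset ?P t ?d" if "\<rho> permutes {..<length c}" for \<rho>
    using that w by (simp add: opset_cat len)
  moreover have "permute_list ?\<sigma> ?d = c" "permute_list ?\<sigma> ?w = snd x"
    using permute_list_compose[OF \<sigma>, of "inv ?\<sigma>"] permute_list_compose[of ?\<sigma> "snd x" "inv ?\<sigma>"] \<sigma> len
    by (simp_all add: permutes_inv_o(2)[OF \<sigma>])
  ultimately show ?thesis
    using h.hom_act[OF t d, of "(id, ?w)" ?\<sigma>] h.hom_act[OF t d, of "(transpose j (Suc j), ?w)" ?\<sigma>]
      \<sigma> transpose_Suc_permutes[OF j]
    by (simp add: opact_cat \<sigma>' permutes_id)
qed

lemma hom_perp_rel: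
  assumes t: "t \<in> Ob C" and c: "c \<in> lists (Ob C)" and xy: "(x, y) \<in> perp_rel C perp t c"
  shows "h t c x = h t c y"
proof -
  have x: "x \<in> opset (cat_operad C) t c" and snd: "snd x = snd y"
    and steps: "(swap_step perp (snd x))\<^sup>*\<^sup>* (fst x) (fst y)"
    using xy by (auto simp: perp_rel_iff_swap_steps)
  \<comment> \<open>Membership is carried along because each further swap step has to start from an
    operation of the operad.\<close>
  from steps have "(fst y, snd x) \<in> opset (cat_operad C) t c \<and> h t c x = h t c (fst y, snd x)"
  proof (induction rule: rtranclp_induct)
    case base
    show ?case using x by simp
  next
    case (step \<rho> \<rho>')
    then have "(\<rho>', snd x) \<in> opset (cat_operad C) t c"
      using swap_step_permutes[of \<rho> "snd x" perp \<rho>'] by (simp add: opset_cat)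
    then show ?case using step hom_swap_step[OF t c, of "(\<rho>, snd x)" \<rho>'] by simp
  qed
  then show ?thesis by (simp add: snd)
qed

end

section \<open>The two maps on generators and the universal property\<close>

lemma s_perp_hom:
  "seq_hom (Ob C) (R_perp C perp) (opset (cat_operad C)) s_perp\<^sub>1"
  "seq_hom (Ob C) (R_perp C perp) (opset (cat_operad C)) s_perp\<^sub>2"
  by (auto simp: seq_hom_def R_perp_def s_perp\<^sub>1_def s_perp\<^sub>2_def opset_cat permutes_id
      permutes_swap_id less_Suc_eq nth_Cons')

lemma s_perp_related:
  assumes "x \<in> R_perp C perp t c"
  shows "(s_perp\<^sub>1 t c x, s_perp\<^sub>2 t c x) \<in> perp_rel C perp t c"
proof -
  obtain f g a b where x: "x = (f, g)" "c = [a, b]" "f \<in> hom_set C a t" "g \<in> hom_set C b t"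
    "(f, g) \<in> perp" using assms by (auto simp: R_perp_def)
  have "swap_step perp [f, g] id (transpose 0 1)"
    using x(5) by (auto simp: swap_step_def inv_id)
  then show ?thesis
    using x by (auto simp: perp_rel_iff_swap_steps s_perp\<^sub>1_def s_perp\<^sub>2_def opset_cat permutes_id
      permutes_swap_id less_Suc_eq nth_Cons')
qed

theorem quot_perp_coequalizer:
  "is_coequalizer TYPE('z) (Ob C) (free_operad (Ob C) (R_perp C perp)) (cat_operad C)
     (free_lift (cat_operad C) s_perp\<^sub>1) (free_lift (cat_operad C) s_perp\<^sub>2)
     (quot_operad (cat_operad C) (perp_rel C perp)) (quot_map (perp_rel C perp))"
proof (rule quot_coequalizer[OF colored_operad_cat perp_rel_congruence])
  let ?P = "cat_operad C" and ?R = "R_perp C perp" and ?F = "free_operad (Ob C) (R_perp C perp)"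
  let ?q = "quot_map (perp_rel C perp)" and ?Q = "quot_operad (cat_operad C) (perp_rel C perp)"
  let ?l1 = "free_lift ?P s_perp\<^sub>1" and ?l2 = "free_lift ?P s_perp\<^sub>2"
  note unit = free_lift_unit[OF colored_operad_cat s_perp_hom(1)]
    free_lift_unit[OF colored_operad_cat s_perp_hom(2)]
  show l: "operad_hom (Ob C) ?F ?P ?l1" "operad_hom (Ob C) ?F ?P ?l2"
    by (intro free_lift_hom colored_operad_cat s_perp_hom)+
  have q: "operad_hom (Ob C) ?P ?Q ?q"
    by (rule quot_map_hom[OF colored_operad_cat perp_rel_congruence])
  then interpret q: operad_hom "Ob C" ?P ?Q ?q .
  \<comment> \<open>Both composites with the quotient map restrict to \<open>?g\<close> on
    generators, so by uniqueness of lifts each equals \<open>free_lift ?Q ?g\<close>. This extends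
    the equality from generators to the whole free operad.\<close>
  let ?g = "\<lambda>t c x. ?q t c (s_perp\<^sub>1 t c x)"
  have g: "seq_hom (Ob C) ?R (opset ?Q) ?g"
    using s_perp_hom(1) q.hom_closed by (simp add: seq_hom_def)
  have "seq_hom_eq (Ob C) (opset ?F) (\<lambda>t c x. ?q t c (?l1 t c x)) (free_lift ?Q ?g)"
    using unit(1) by (intro free_lift_unique q.cod.colored_operad_axioms g operad_hom_compose[OF l(1) q])
      (simp add: seq_hom_eq_def)
  moreover have "seq_hom_eq (Ob C) (opset ?F) (\<lambda>t c x. ?q t c (?l2 t c x)) (free_lift ?Q ?g)"
  proof (intro free_lift_unique q.cod.colored_operad_axioms g operad_hom_compose[OF l(2) q])
    have "?q t c (s_perp\<^sub>2 t c x) = ?q t c (s_perp\<^sub>1 t c x)"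
      if "t \<in> Ob C" "c \<in> lists (Ob C)" "x \<in> ?R t c" for t c x
      using s_perp_related[OF that(3)] s_perp_hom that
        quot_map_eq_iff[OF colored_operad_cat perp_rel_congruence that(1,2), of "s_perp\<^sub>1 t c x" "s_perp\<^sub>2 t c x"]
      by (simp add: seq_hom_def)
    then show "seq_hom_eq (Ob C) ?R (\<lambda>t c x. ?q t c (?l2 t c (free_unit (Ob C) ?R t c x))) ?g"
      using unit(2) by (simp add: seq_hom_eq_def)
  qed
  ultimately show "seq_hom_eq (Ob C) (opset ?F) (\<lambda>t c x. ?q t c (?l1 t c x)) (\<lambda>t c x. ?q t c (?l2 t c x))"
    by (simp add: seq_hom_eq_def)
  fix Z :: "('o, 'z) operad" and h t c x y
  assume h: "operad_hom (Ob C) ?P Z h"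
    and eq: "seq_hom_eq (Ob C) (opset ?F) (\<lambda>t c x. h t c (?l1 t c x)) (\<lambda>t c x. h t c (?l2 t c x))"
    and t: "t \<in> Ob C" and c: "c \<in> lists (Ob C)" and xy: "(x, y) \<in> perp_rel C perp t c"
  \<comment> \<open>Conversely, evaluating at generators through \<open>free_unit\<close> recovers
    the two original operations, so a coequalizing \<open>h\<close> identifies them.\<close>
  have gen: "h t c (s_perp\<^sub>1 t c x) = h t c (s_perp\<^sub>2 t c x)"
    if "t \<in> Ob C" "c \<in> lists (Ob C)" "x \<in> ?R t c" for t c x
    using eq unit free_unit_hom[of "Ob C" ?R] that
    unfolding seq_hom_eq_def seq_hom_def by metis
  show "h t c x = h t c y"
  proof (rule hom_perp_rel[OF h _ t c xy])
    fix t a b f g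
    assume fg: "t \<in> Ob C" "f \<in> hom_set C a t" "g \<in> hom_set C b t" "(f, g) \<in> perp"
    then have "[a, b] \<in> lists (Ob C)" using dom_closed by (auto simp: hom_set_def)
    then show "h t [a, b] (id, [f, g]) = h t [a, b] (transpose 0 1, [f, g])"
      using gen[of t "[a, b]" "(f, g)"] fg by (simp add: R_perp_def s_perp\<^sub>1_def s_perp\<^sub>2_def)
  qed
qed

end

theorem proposition3p9:
  fixes C :: "('o, 'm) category" and perp :: "('m \<times> 'm) set"
  assumes "orthogonal_category C perp"
  shows "operad_congruence (Ob C) (cat_operad C) (perp_rel C perp) \<and>
    colored_operad (Ob C) (quot_operad (cat_operad C) (perp_rel C perp)) \<and>
    is_coequalizer TYPE('z) (Ob C)
      (free_operad (Ob C) (R_perp C perp)) (cat_operad C)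
      (free_lift (cat_operad C) s_perp\<^sub>1) (free_lift (cat_operad C) s_perp\<^sub>2)
      (quot_operad (cat_operad C) (perp_rel C perp)) (quot_map (perp_rel C perp))"
proof -
  interpret orthogonal_category C perp by (rule assms)
  show ?thesis
    using perp_rel_congruence colored_operad_quot[OF colored_operad_cat perp_rel_congruence]
      quot_perp_coequalizer by blast
qed

end
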